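(* For every integer $n>1$, $$\mathcal{Q}(T_{n,n-1})=\operatorname{ch}\left(\chi^{(n-1,n-1)}\downarrow^{\mathfrak{S}_{2n-2}}_{\mathfrak{S}_n}\right),$$ where $\chi^{(n-1,n-1)}$ is the irreducible $\mathfrak{S}_{2n-2}$-character indexed by the partition $(n-1,n-1)$ and $\downarrow$ denotes restriction to $\mathfrak{S}_n$.
   Context: $\overrightarrow{K}_n$ is the transitive tournament with vertex set $\{1,\dots,n\}$ and directed edges $(i,j)$, $i<j$. $T_{n,n-1}$ is the set of transitive $(n-1)$-partitions of $\overrightarrow{K}_n$: unordered partitions of the edge set into $n-1$ nonempty blocks such that every cycle of the underlying undirected graph contains two edges in the same block with opposite orientations with respect to a traversal of the cycle. For $p\in T_{n,n-1}$, $\operatorname{Des}(p):=\{i\in\{1,\dots,n-1\}: \text{the edge }(i,i+1)\text{ forms a singleton block in }p\}$, and $\mathcal{Q}(T_{n,n-1}):=\sum_{p\in T_{n,n-1}}\mathcal{F}_{\operatorname{Des}(p)}$, where for $J\subseteq\{1,\dots,n-1\}$, $\mathcal{F}_J(\mathbf{x}):=\sum x_{i_1}\cdots x_{i_n}$ over $i_1\le\dots\le i_n$ with $i_j<i_{j+1}$ whenever $j\in J$. $\operatorname{ch}$ is the Frobenius characteristic map, the linear map from class functions on $\mathfrak{S}_n$ to symmetric functions with $\operatorname{ch}(\chi^\lambda)=s_\lambda$ (Schur function) for each $\lambda\vdash n$. *)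

theory Defs
  imports
    Complex_Main
    "HOL-Library.Disjoint_Sets"
    "HOL-Library.FuncSet"
    "HOL-Library.Function_Algebras"
    "HOL-Library.Multiset"
    "HOL-Combinatorics.Permutations"
begin

section \<open>Transitive partitions of the transitive tournament\<close>

definition tournament_edges :: "nat \<Rightarrow> (nat \<times> nat) set" where
  "tournament_edges n = {(i, j). 1 \<le> i \<and> i < j \<and> j \<le> n}"

text \<open>
  A cycle of the underlying undirected graph of a digraph \<open>E\<close> is given together with a
  traversal, as the list of its vertices in the order of the traversal; the closing edge
  joins the last vertex to the first one.
\<close>

definition next_vertex :: "nat list \<Rightarrow> nat \<Rightarrow> nat" where
  "next_vertex c i = c ! (Suc i mod length c)"

definition undirected_cycle :: "(nat \<times> nat) set \<Rightarrow> nat list \<Rightarrow> bool" where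
  "undirected_cycle E c \<longleftrightarrow> 3 \<le> length c \<and> distinct c \<and>
     (\<forall>i < length c. (c ! i, next_vertex c i) \<in> E \<union> E\<inverse>)"

text \<open>
  In the next definition the \<open>i\<close>-th edge of the cycle is traversed along its direction
  and the \<open>j\<close>-th edge against its direction.
\<close>

definition transitive_partition :: "(nat \<times> nat) set \<Rightarrow> (nat \<times> nat) set set \<Rightarrow> bool" where
  "transitive_partition E P \<longleftrightarrow> partition_on E P \<and>
     (\<forall>c. undirected_cycle E c \<longrightarrow>
        (\<exists>B \<in> P. \<exists>i < length c. \<exists>j < length c.
           (c ! i, next_vertex c i) \<in> B \<and> (next_vertex c j, c ! j) \<in> B))"

definition transitive_partitions :: "nat \<Rightarrow> nat \<Rightarrow> (nat \<times> nat) set set set" where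
  "transitive_partitions n k =
     {P. transitive_partition (tournament_edges n) P \<and> card P = k}"

definition Des :: "nat \<Rightarrow> (nat \<times> nat) set set \<Rightarrow> nat set" where
  "Des n P = {i \<in> {1..n - 1}. {(i, i + 1)} \<in> P}"


section \<open>Quasisymmetric and symmetric functions\<close>

text \<open>
  A formal power series in countably many commuting variables \<open>x\<^sub>0, x\<^sub>1, \<dots>\<close> is the
  function that sends a monomial to its coefficient, where the monomial
  \<open>x\<^sub>a x\<^sub>b \<cdots>\<close> is the multiset \<open>{#a, b, \<dots>#}\<close> of its variable indices.
  Addition is pointwise; the pointwise product of functions is not used.
\<close>

type_synonym series = "nat multiset \<Rightarrow> complex"

definition fundamental_qsym :: "nat \<Rightarrow> nat set \<Rightarrow> series" where
  "fundamental_qsym n J = (\<lambda>m. of_nat (card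
     {xs. length xs = n \<and> sorted xs \<and>
          (\<forall>j \<in> J. xs ! (j - 1) < xs ! j) \<and> mset xs = m}))"

definition Q_series :: "nat \<Rightarrow> (nat \<times> nat) set set set \<Rightarrow> series" where
  "Q_series n T = (\<Sum>P \<in> T. fundamental_qsym n (Des n P))"

definition symmetric_function :: "series \<Rightarrow> bool" where
  "symmetric_function f \<longleftrightarrow>
     (\<exists>d. \<forall>m. size m > d \<longrightarrow> f m = 0) \<and>
     (\<forall>\<sigma>. bij \<sigma> \<longrightarrow> (\<forall>m. f (image_mset \<sigma> m) = f m))"

definition partitions_of :: "nat \<Rightarrow> nat list set" where
  "partitions_of n = {\<mu>. sorted_wrt (\<ge>) \<mu> \<and> 0 \<notin> set \<mu> \<and> sum_list \<mu> = n}"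

text \<open>Cells \<open>(r, c)\<close> are numbered from \<open>0\<close>: row first, column second.\<close>

definition diagram :: "nat list \<Rightarrow> (nat \<times> nat) set" where
  "diagram \<mu> = {(r, c). r < length \<mu> \<and> c < \<mu> ! r}"

definition ssyt :: "nat list \<Rightarrow> (nat \<times> nat \<Rightarrow> nat) set" where
  "ssyt \<mu> = {T \<in> diagram \<mu> \<rightarrow>\<^sub>E UNIV.
     (\<forall>r c d. c < d \<and> (r, c) \<in> diagram \<mu> \<and> (r, d) \<in> diagram \<mu> \<longrightarrow> T (r, c) \<le> T (r, d)) \<and>
     (\<forall>r s c. r < s \<and> (r, c) \<in> diagram \<mu> \<and> (s, c) \<in> diagram \<mu> \<longrightarrow> T (r, c) < T (s, c))}"

definition schur :: "nat list \<Rightarrow> series" where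
  "schur \<mu> = (\<lambda>m. of_nat (card
     {T \<in> ssyt \<mu>. image_mset T (mset_set (diagram \<mu>)) = m}))"


section \<open>Irreducible characters of the symmetric groups\<close>

definition scale_fun :: "complex \<Rightarrow> ('a \<Rightarrow> complex) \<Rightarrow> 'a \<Rightarrow> complex" where
  "scale_fun a f = (\<lambda>x. a * f x)"

global_interpretation cfun: vector_space "scale_fun :: complex \<Rightarrow> ('a \<Rightarrow> complex) \<Rightarrow> 'a \<Rightarrow> complex"
  by unfold_locales (auto simp: scale_fun_def fun_eq_iff algebra_simps)

text \<open>
  The trace of a linear endomorphism \<open>L\<close> of a finite-dimensional subspace \<open>V\<close>, computed in
  some basis of \<open>V\<close>.
\<close>

definition trace_on :: "('a \<Rightarrow> complex) set \<Rightarrow> (('a \<Rightarrow> complex) \<Rightarrow> ('a \<Rightarrow> complex)) \<Rightarrow> complex" where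
  "trace_on V L =
     (let B = (SOME B. cfun.independent B \<and> cfun.span B = V)
      in \<Sum>b \<in> B. cfun.representation B (L b) b)"

definition tableaux :: "nat list \<Rightarrow> (nat \<times> nat \<Rightarrow> nat) set" where
  "tableaux \<mu> = {t. bij_betw t (diagram \<mu>) {1..sum_list \<mu>}}"

text \<open>
  The row-equivalence class of a tableau \<open>t\<close> is encoded as the list of the sets of entries of
  its rows, from top to bottom. The permutation module on tabloids then consists of
  complex-valued functions of such lists.
\<close>

type_synonym tabloid = "nat set list"

definition tabloid_of :: "nat list \<Rightarrow> (nat \<times> nat \<Rightarrow> nat) \<Rightarrow> tabloid" where
  "tabloid_of \<mu> t = map (\<lambda>r. (\<lambda>c. t (r, c)) ` {..<\<mu> ! r}) [0..<length \<mu>]"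

definition permute_tabloid :: "(nat \<Rightarrow> nat) \<Rightarrow> tabloid \<Rightarrow> tabloid" where
  "permute_tabloid w X = map (image w) X"

text \<open>The linear action determined by \<open>w \<cdot> {t} = {w t}\<close> on basis elements.\<close>

definition tabloid_action :: "(nat \<Rightarrow> nat) \<Rightarrow> (tabloid \<Rightarrow> complex) \<Rightarrow> tabloid \<Rightarrow> complex" where
  "tabloid_action w f = (\<lambda>X. f (permute_tabloid (inv w) X))"

definition column_stabilizer :: "nat list \<Rightarrow> (nat \<times> nat \<Rightarrow> nat) \<Rightarrow> (nat \<Rightarrow> nat) set" where
  "column_stabilizer \<mu> t = {q. q permutes {1..sum_list \<mu>} \<and>
     (\<forall>c. q ` {t (r, c) |r. (r, c) \<in> diagram \<mu>} = {t (r, c) |r. (r, c) \<in> diagram \<mu>})}"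

definition polytabloid :: "nat list \<Rightarrow> (nat \<times> nat \<Rightarrow> nat) \<Rightarrow> tabloid \<Rightarrow> complex" where
  "polytabloid \<mu> t = (\<lambda>X. \<Sum>q \<in> column_stabilizer \<mu> t.
     if X = permute_tabloid q (tabloid_of \<mu> t) then of_int (sign q) else 0)"

definition specht_module :: "nat list \<Rightarrow> (tabloid \<Rightarrow> complex) set" where
  "specht_module \<mu> = cfun.span (polytabloid \<mu> ` tableaux \<mu>)"

text \<open>
  The symmetric group on \<open>n\<close> letters is the set of all \<open>w\<close> with \<open>w permutes {1..n}\<close>, so that
  it is a subset of the symmetric group on \<open>N\<close> letters for all \<open>N \<ge> n\<close>. Functions on it are
  extended by \<open>0\<close> to all functions \<open>nat \<Rightarrow> nat\<close>.
\<close>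

definition irr_character :: "nat list \<Rightarrow> (nat \<Rightarrow> nat) \<Rightarrow> complex" where
  "irr_character \<mu> = (\<lambda>w. if w permutes {1..sum_list \<mu>}
     then trace_on (specht_module \<mu>) (tabloid_action w) else 0)"

definition restrict_to_Sym :: "nat \<Rightarrow> ((nat \<Rightarrow> nat) \<Rightarrow> complex) \<Rightarrow> (nat \<Rightarrow> nat) \<Rightarrow> complex" where
  "restrict_to_Sym n f = (\<lambda>w. if w permutes {1..n} then f w else 0)"

definition class_functions :: "nat \<Rightarrow> ((nat \<Rightarrow> nat) \<Rightarrow> complex) set" where
  "class_functions n = {f.
     (\<forall>w. \<not> w permutes {1..n} \<longrightarrow> f w = 0) \<and>
     (\<forall>u w. u permutes {1..n} \<and> w permutes {1..n} \<longrightarrow> f (u \<circ> w \<circ> inv u) = f w)}"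


section \<open>The Frobenius characteristic map\<close>

text \<open>
  The irreducible characters form a basis of the space of class functions, so these
  conditions determine \<open>ch\<close> uniquely on \<^term>\<open>class_functions n\<close>.
\<close>

definition frobenius_characteristic :: "nat \<Rightarrow> (((nat \<Rightarrow> nat) \<Rightarrow> complex) \<Rightarrow> series) \<Rightarrow> bool" where
  "frobenius_characteristic n ch \<longleftrightarrow>
     (\<forall>f \<in> class_functions n. symmetric_function (ch f)) \<and>
     (\<forall>f \<in> class_functions n. \<forall>g \<in> class_functions n. ch (f + g) = ch f + ch g) \<and>
     (\<forall>a. \<forall>f \<in> class_functions n. ch (scale_fun a f) = scale_fun a (ch f)) \<and>
     (\<forall>\<mu> \<in> partitions_of n. ch (irr_character \<mu>) = schur \<mu>)"

end

theory Submission
  imports Defs "HOL-Computational_Algebra.Polynomial"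
begin

text \<open>
  Both sides are governed by the linear form
  \<open>N \<mapsto> \<Sum>j. (binom(n-2, n-1-j) - binom(n-2, n-2-j)) N\<^sub>j\<close> on sequences with \<open>N\<^sub>j = N\<^sub>n\<^sub>-\<^sub>j\<close>,
  and Abel summation rewrites it as a combination of the differences \<open>N\<^sub>i - N\<^sub>i\<^sub>-\<^sub>1\<close> with \<open>1 \<le> i \<le> n/2\<close>.

  Characters: for \<open>2k \<le> N\<close> the permutation module on \<open>k\<close>-subsets of \<open>{1..N}\<close> is the direct sum of the
  Specht module of \<open>(N-k, k)\<close> and an isomorphic copy of the module on \<open>(k-1)\<close>-subsets, so this irreducible
  character counts fixed \<open>k\<close>-subsets minus fixed \<open>(k-1)\<close>-subsets. Restricting the fixed-point counts from
  \<open>2n-2\<close> to \<open>n\<close> letters gives the linear form, with \<open>N\<^sub>j\<close> the number of fixed \<open>j\<close>-subsets of \<open>{1..n}\<close>.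
  Likewise the coefficient of a monomial \<open>m\<close> in the Schur function of \<open>(n-i, i)\<close> is \<open>N\<^sub>i - N\<^sub>i\<^sub>-\<^sub>1\<close>
  where \<open>N\<^sub>j\<close> is now the number of sub-multisets of \<open>m\<close> of size \<open>j\<close>.

  Partitions: a transitive partition with \<open>n-1\<close> blocks is a colouring in which \<open>(i, i+1)\<close> has colour \<open>i\<close>
  and the colour of \<open>(j, l)\<close> is one of those of \<open>(j, k)\<close> and \<open>(k, l)\<close>, that is, a binary tree with \<open>n-1\<close>
  nodes whose leaves are the descents. Adding the vertices from right to left, a tree is built
  by successive choices on its left spine, and the number of trees with leaves in a
  prescribed set satisfies a ballot recursion. Its solution is the coefficient of \<open>t\<^sup>n\<^sup>-\<^sup>1\<close> in
  \<open>(1 - t) (1 + t)\<^sup>n\<^sup>-\<^sup>2 \<Sum>j. N\<^sub>j t\<^sup>j\<close>, which is again the linear form.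
\<close>

section \<open>Sub-multisets and ballot numbers\<close>

text \<open>The comparison is made monomial by monomial. A monomial \<open>m\<close> has one weakly
  increasing arrangement, so its coefficient in F_J is 1 or 0 according to whether J lies in the set
  S of strict ascents of that word. The left side therefore asks for the number of partitions whose
  descents lie in S, and the counts N_j are read off from the same word. On the right,
  \<open>ch\<close> is known only through linearity and its values on irreducible characters. The
  permutation characters N_j are for this reason replaced by the differences N_i - N_(i-1), which
  are irreducible for 1 <= i <= n/2; this forces the Abel summation and the folding of its second
  half onto the first by N_j = N_(n-j). The parameter n-2 is the number (2n-2) - n of letters lost
  in the restriction. On the tree side the factor 1 - t plays the part of a reflection: it
  annihilates the middle coefficient of a symmetric polynomial of odd degree, which starts the
  telescoping that solves the ballot recursion.\<close>

lemma finite_submultisets: "finite {A. A \<subseteq># m}"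
proof (induction m)
  case (add x m)
  have "{A. A \<subseteq># add_mset x m} \<subseteq> {A. A \<subseteq># m} \<union> add_mset x ` {A. A \<subseteq># m}"
  proof
    fix A assume "A \<in> {A. A \<subseteq># add_mset x m}"
    then have A: "A \<subseteq># add_mset x m" by simp
    show "A \<in> {A. A \<subseteq># m} \<union> add_mset x ` {A. A \<subseteq># m}"
    proof (cases "x \<in># A")
      case True
      then have "A = add_mset x (A - {#x#})" by simp
      moreover have "A - {#x#} \<subseteq># m"
        using A by (simp add: subset_eq_diff_conv)
      ultimately show ?thesis by blast
    next
      case False
      then have "A \<subseteq># m" using A
        by (metis add_mset_remove_trivial diff_single_trivial subset_eq_diff_conv union_mset_add_mset_right add.right_neutral)
      then show ?thesis by simp
    qed
  qed
  then show ?case using add.IH by (meson finite_UnI finite_imageI finite_subset)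
qed simp

text \<open>For k <= \<open>size m\<close> this is also the coefficient of the monomial
  \<open>m\<close> in the product of the complete homogeneous symmetric functions of degrees k and
  \<open>size m - k\<close>.\<close>

definition sub_count :: "'a multiset \<Rightarrow> nat \<Rightarrow> nat" where
  "sub_count m k = card {A. A \<subseteq># m \<and> size A = k}"

text \<open>The product over the distinct letters x of 1 + t + ... + t^(count m x). The coefficients
  are integers because the factor 1 - t will be applied.\<close>

definition sub_poly :: "'a multiset \<Rightarrow> int poly" where
  "sub_poly m = (\<Sum>A | A \<subseteq># m. monom 1 (size A))"

text \<open>When one more copy of \<open>x\<close> is adjoined, the new sub-multisets are precisely
  those that use up \<open>x\<close>; this polynomial is the increment in
  \<open>sub_poly_add\<close>.\<close>

definition full_poly :: "'a multiset \<Rightarrow> 'a \<Rightarrow> int poly" where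
  "full_poly m x = (\<Sum>A | A \<subseteq># m \<and> count A x = count m x. monom 1 (size A))"

lemma coeff_sub_poly: "coeff (sub_poly m) k = int (sub_count m k)"
proof -
  have "coeff (sub_poly m) k = (\<Sum>A | A \<subseteq># m. if size A = k then 1 else 0)"
    unfolding sub_poly_def coeff_sum by (simp add: coeff_monom)
  also have "\<dots> = int (card ({A. A \<subseteq># m} \<inter> {A. size A = k}))"
    using finite_submultisets[of m] by (simp add: sum.If_cases)
  finally show ?thesis by (simp add: sub_count_def Int_def)
qed

lemma sub_count_0 [simp]: "sub_count m 0 = 1"
proof -
  have "{A. A \<subseteq># m \<and> size A = 0} = {{#}}" by auto
  then show ?thesis by (simp add: sub_count_def)
qed

lemma sub_count_above: "k > size m \<Longrightarrow> sub_count m k = 0"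
  unfolding sub_count_def using size_mset_mono by (fastforce simp: card_eq_0_iff)

lemma sub_count_sym: "k \<le> size m \<Longrightarrow> sub_count m (size m - k) = sub_count m k"
  unfolding sub_count_def
  by (rule bij_betw_same_card[where f = "\<lambda>A. m - A"], rule bij_betw_byWitness[where f' = "\<lambda>A. m - A"])
     (auto simp: size_Diff_submset multiset_eq_iff diff_diff_cancel mset_subset_eq_count dest: size_mset_mono)

lemma full_poly_add: "full_poly (add_mset x m) x = monom 1 1 * full_poly m x"
proof -
  have "full_poly (add_mset x m) x = (\<Sum>A | A \<subseteq># m \<and> count A x = count m x. monom 1 (size (add_mset x A)))"
    unfolding full_poly_def
  proof (rule sum.reindex_bij_witness[where j = "\<lambda>A. A - {#x#}" and i = "add_mset x"], goal_cases)
    case (1 A)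
    then have "x \<in># A" by (metis (mono_tags, lifting) count_add_mset count_eq_zero_iff mem_Collect_eq nat.simps(3))
    then show ?case by simp
  next
    case (2 A)
    then show ?case by (auto simp: subset_eq_diff_conv)
  next
    case (5 A)
    then have "x \<in># A" by (metis (mono_tags, lifting) count_add_mset count_eq_zero_iff mem_Collect_eq nat.simps(3))
    then show ?case by simp
  qed auto
  also have "\<dots> = monom 1 1 * full_poly m x"
    by (simp add: full_poly_def sum_distrib_left mult_monom)
  finally show ?thesis .
qed

lemma full_poly_notin: "x \<notin># m \<Longrightarrow> full_poly m x = sub_poly m"
  unfolding full_poly_def sub_poly_def
  by (rule sum.cong) (auto simp: not_in_iff dest: mset_subset_eq_count[of _ _ x])

lemma sub_poly_add: "sub_poly (add_mset x m) = sub_poly m + full_poly (add_mset x m) x"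
proof -
  have *: "{A. A \<subseteq># add_mset x m} = {A. A \<subseteq># m} \<union> {A. A \<subseteq># add_mset x m \<and> count A x = count (add_mset x m) x}"
    (is "?L = ?B \<union> ?C")
  proof (intro equalityI subsetI)
    fix A assume A: "A \<in> ?L"
    show "A \<in> ?B \<union> ?C"
    proof (cases "count A x = count (add_mset x m) x")
      case False
      have "A \<subseteq># m"
      proof (rule mset_subset_eqI)
        fix a
        have "count A a \<le> count (add_mset x m) a" using A by (intro mset_subset_eq_count) simp
        then show "count A a \<le> count m a" using False by (auto split: if_splits)
      qed
      then show ?thesis by simp
    qed (use A in auto)
  qed (auto intro: subset_mset.order_trans)
  have "?B \<inter> ?C = {}"
    by (auto dest: mset_subset_eq_count[of _ _ x])
  then show ?thesis
    unfolding sub_poly_def full_poly_def *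
    using finite_submultisets[of m] finite_submultisets[of "add_mset x m"] by (subst sum.union_disjoint) (auto simp: *)
qed

section \<open>Palindromic polynomials\<close>

definition palindromic :: "nat \<Rightarrow> int poly \<Rightarrow> bool" where
  "palindromic d p \<longleftrightarrow> degree p \<le> d \<and> (\<forall>j\<le>d. coeff p (d - j) = coeff p j)"

lemma palindromic_sub_poly: "palindromic (size m) (sub_poly m)"
  unfolding palindromic_def
  by (auto simp: coeff_sub_poly sub_count_sym sub_count_above intro!: degree_le)

lemma coeff_one_plus_mult: "coeff ([:1, 1:] * p) j = coeff p j + (if j = 0 then 0 else coeff p (j - 1))"
  for p :: "'a::comm_ring_1 poly"
  by (cases j) simp_all

lemma palindromic_mult:
  assumes "palindromic d p"
  shows "palindromic (Suc d) ([:1, 1:] * p)"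
  unfolding palindromic_def
proof (intro conjI allI impI)
  have d: "degree p \<le> d" using assms by (simp add: palindromic_def)
  show "degree ([:1, 1:] * p) \<le> Suc d"
    using degree_mult_le[of "[:1, 1:]" p] d by simp
  fix j assume j: "j \<le> Suc d"
  have top: "coeff p (Suc d) = 0" using d by (simp add: coeff_eq_0)
  have sym: "\<And>j. j \<le> d \<Longrightarrow> coeff p (d - j) = coeff p j" using assms by (simp add: palindromic_def)
  consider "j = 0" | "j = Suc d" | i where "j = Suc i" "i < d" using j by (cases j) force+
  then show "coeff ([:1, 1:] * p) (Suc d - j) = coeff ([:1, 1:] * p) j"
  proof cases
    case 3
    then have "d - i = Suc (d - Suc i)" by simp
    then show ?thesis unfolding coeff_one_plus_mult using 3 sym[of i] sym[of "Suc i"] by simp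
  qed (use top sym[of 0] sym[of d] in \<open>simp_all add: coeff_one_plus_mult del: mult_pCons_left\<close>)
qed

lemma palindromic_power_mult:
  "palindromic d p \<Longrightarrow> palindromic (k + d) ([:1, 1:] ^ k * p)"
  by (induction k) (auto simp: mult.assoc intro: palindromic_mult simp del: mult_pCons_left)

text \<open>
  Counts the ways to add the vertices \<open>i, \<dots>, 1\<close> to a tree on \<open>{i+1..n}\<close> whose left spine has \<open>s\<close>
  nodes, so that leaves occur in \<open>S\<close> only; \<open>up\<close> says that the node \<open>i+1\<close> is at present a leaf. It stays
  one unless the next vertex is added at the bottom of the spine too.
\<close>

fun ballot_count :: "nat set \<Rightarrow> nat \<Rightarrow> nat \<Rightarrow> bool \<Rightarrow> nat" where
  "ballot_count S 0 s up = (if up \<and> 1 \<notin> S then 0 else 1)"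
| "ballot_count S (Suc i) s up = ballot_count S i (Suc s) True +
     (if up \<and> Suc (Suc i) \<notin> S then 0 else \<Sum>x=1..s. ballot_count S i x False)"

text \<open>Induction on the number of vertices still to be added. One more spine node is one more
  factor 1 + t, so the sum over the new spine lengths telescopes, and its lower end vanishes by
  symmetry. The two hypotheses on \<open>S\<close> say that position j repeats the previous letter
  or carries a new one. The subtraction in \<open>i + s - 1\<close> truncates only for i = s = 0,
  where the constant coefficient does not depend on the exponent.\<close>

lemma ballot_count_eq_coeff:
  fixes xs :: "'a list"
  assumes "i < length xs"
    and S: "\<And>j. 1 \<le> j \<Longrightarrow> j < length xs \<Longrightarrow> j \<notin> S \<Longrightarrow> xs ! (j - 1) = xs ! j"
    and S': "\<And>j. 1 \<le> j \<Longrightarrow> j < length xs \<Longrightarrow> j \<in> S \<Longrightarrow> xs ! j \<notin> set (take j xs)"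
  defines "Q \<equiv> \<lambda>i. sub_poly (mset (take (Suc i) xs))"
    and "R \<equiv> \<lambda>i. full_poly (mset (take (Suc i) xs)) (xs ! i)"
  shows "int (ballot_count S i s up) =
    coeff ([:1, -1:] * ([:1, 1:] ^ (i + s - 1) * (if up \<and> Suc i \<notin> S then R i else Q i))) i"
  using assms(1)
proof (induction i arbitrary: s up)
  case 0
  have "coeff (R 0) 0 = 0"
    using 0 full_poly_add[of "xs ! 0" "{#}"] by (simp add: R_def take_Suc_conv_app_nth coeff_mult_0)
  moreover have "coeff (Q 0) 0 = 1" by (simp add: Q_def coeff_sub_poly)
  ultimately show ?case by (simp add: coeff_mult_0 coeff_0_power)
next
  case (Suc i)
  note IH = Suc.IH
  have mset_Suc: "mset (take (Suc (Suc i)) xs) = add_mset (xs ! Suc i) (mset (take (Suc i) xs))"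
    using Suc.prems by (simp add: take_Suc_conv_app_nth)
  have Q_Suc: "Q (Suc i) = Q i + R (Suc i)"
    unfolding Q_def R_def mset_Suc by (rule sub_poly_add)
  \<comment> \<open>A repeated letter is used up together with its earlier copies, which gives
    \<open>R i\<close>; a new letter leaves the rest free, which gives \<open>Q i\<close>. In both
    cases the letter itself contributes a factor t.\<close>
  have R_Suc: "R (Suc i) = monom 1 1 * (if Suc i \<notin> S then R i else Q i)"
    using S[of "Suc i"] S'[of "Suc i"] Suc.prems
    unfolding Q_def R_def mset_Suc full_poly_add by (auto simp: full_poly_notin)
  define c where "c k p = coeff ([:1, -1:] * ([:1, 1:] ^ k * p))" for k and p :: "int poly"
  have c_add: "c k (p + q) j = c k p j + c k q j" for k p q j
    by (simp add: c_def distrib_left del: mult_pCons_left mult_pCons_right)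
  have c_shift: "c k (monom 1 1 * p) (Suc j) = c k p j" for k p j
    unfolding c_def by (simp add: monom_altdef mult_ac)
  have up: "int (ballot_count S i (Suc s) True) = c (i + s) (R (Suc i)) (Suc i)"
    using Suc.IH[of "Suc s" True] Suc.prems unfolding R_Suc c_shift by (simp add: c_def)
  have down: "int (\<Sum>x=1..s. ballot_count S i x False) = c (i + s) (Q i) (Suc i)"
  proof (induction s)
    case 0
    \<comment> \<open>\<open>Q i\<close> belongs to i + 1 letters, so the product is symmetric about
      i + 1/2. Its coefficients at i and i + 1 agree, and 1 - t cancels them.\<close>
    have "palindromic (i + Suc i) ([:1, 1:] ^ i * Q i)"
      using palindromic_power_mult[OF palindromic_sub_poly, of i "mset (take (Suc i) xs)"] Suc.prems
      by (simp add: Q_def min_def)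
    then have "coeff ([:1, 1:] ^ i * Q i) (i + Suc i - i) = coeff ([:1, 1:] ^ i * Q i) i"
      unfolding palindromic_def by (metis le_add1)
    then show ?case by (simp add: c_def)
  next
    case (Suc s)
    have "c (Suc (i + s)) (Q i) (Suc i) = c (i + s) (Q i + monom 1 1 * Q i) (Suc i)"
      unfolding c_def by (simp add: monom_altdef algebra_simps)
    then have step: "c (i + Suc s) (Q i) (Suc i) = c (i + s) (Q i) (Suc i) + c (i + s) (Q i) i"
      unfolding c_add c_shift by simp
    have "int (ballot_count S i (Suc s) False) = c (i + s) (Q i) i"
      using IH[of "Suc s" False] \<open>Suc i < length xs\<close>
      by (simp add: c_def del: mult_pCons_left mult_pCons_right)
    then show ?case using Suc.IH step by simp
  qed
  \<comment> \<open>The two branches add up to \<open>Q (Suc i)\<close>, which is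
    \<open>Q i + R (Suc i)\<close>; if the second one is forbidden, \<open>R (Suc i)\<close>
    remains.\<close>
  show ?case
    using up down unfolding c_def[symmetric] by (simp add: Q_Suc c_add)
qed

text \<open>The two sums belong to the subset sizes n-1 and n-2 in the presence of n-2 extra
  letters, as produced by \<open>fixed_subsets_restrict\<close>. Kept apart, they avoid a binomial
  coefficient with negative lower index. The ring is generic since the form is evaluated over the
  integers for partitions and over the complex numbers for characters.\<close>

definition restriction_sum :: "nat \<Rightarrow> (nat \<Rightarrow> 'a::comm_ring_1) \<Rightarrow> 'a" where
  "restriction_sum n N =
     (\<Sum>j\<le>n - 1. of_nat (n - 2 choose (n - 1 - j)) * N j) -
     (\<Sum>j\<le>n - 2. of_nat (n - 2 choose (n - 2 - j)) * N j)"

lemma restriction_sum_eq: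
  fixes N :: "nat \<Rightarrow> 'a::comm_ring_1"
  assumes n: "n \<ge> 2" and sym: "\<And>j. j \<le> n \<Longrightarrow> N (n - j) = N j"
  shows "restriction_sum n N = (\<Sum>i=1..n div 2.
    (of_nat (n - 2 choose (i - 1)) - of_nat (n - 2 choose (n - i))) * (N i - N (i - 1)))"
proof -
  obtain k where k: "n = Suc (Suc k)" using n by (metis add_2_eq_Suc le_Suc_ex)
  define f where "f i = of_nat (k choose (i - 1)) * (N i - N (i - 1))" for i
  have "(\<Sum>j\<le>Suc k. of_nat (k choose (Suc k - j)) * N j) =
      (\<Sum>j\<le>k. of_nat (k choose (k - j)) * N (Suc j))"
    by (subst sum.atMost_Suc_shift) (simp add: binomial_eq_0)
  then have "restriction_sum n N = (\<Sum>j\<le>k. of_nat (k choose j) * (N (Suc j) - N j))"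
    by (simp add: restriction_sum_def k sum_subtractf[symmetric] right_diff_distrib binomial_symmetric[symmetric])
  also have "\<dots> = (\<Sum>i=1..Suc k. f i)"
    unfolding f_def by (rule sum.reindex_bij_witness[where i = "\<lambda>i. i - 1" and j = Suc]) auto
  \<comment> \<open>The term i = n vanishes; including it makes the range invariant under the
    reflection that sends i to n + 1 - i.\<close>
  also have "\<dots> = (\<Sum>i=1..n. f i)" by (simp add: k f_def binomial_eq_0)
  finally have eq: "restriction_sum n N = (\<Sum>i=1..n. f i)" .
  define h where "h = n div 2"
  have refl: "f (n + 1 - i) = - (of_nat (n - 2 choose (n - i)) * (N i - N (i - 1)))" if "1 \<le> i" "i \<le> n" for i
  proof -
    have "N (n + 1 - i) = N (i - 1)" using sym[of "i - 1"] that by simp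
    moreover have "N (n - i) = N i" using sym that by simp
    ultimately show ?thesis using that by (simp add: f_def k Suc_diff_le algebra_simps)
  qed
  have split: "{1..n} = {1..h} \<union> {h + 1..n - h} \<union> {n - h + 1..n}"
    using n by (auto simp: h_def)
  have "(\<Sum>i=1..n. f i) = sum f {1..h} + sum f {h + 1..n - h} + sum f {n - h + 1..n}"
    unfolding split by (subst sum.union_disjoint; (subst sum.union_disjoint)?) (auto simp: h_def)
  \<comment> \<open>For odd n this is the one index fixed by the reflection, where the two values of
    \<open>N\<close> coincide.\<close>
  also have "sum f {h + 1..n - h} = 0"
  proof (rule sum.neutral, rule ballI)
    fix i assume "i \<in> {h + 1..n - h}"
    then have "i = h + 1" "n = 2 * h + 1" by (auto simp: h_def)
    then show "f i = 0" using sym[of h] by (simp add: f_def)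
  qed
  also have "sum f {n - h + 1..n} = (\<Sum>i=1..h. - (of_nat (n - 2 choose (n - i)) * (N i - N (i - 1))))"
    by (rule sum.reindex_bij_witness[where i = "\<lambda>i. n + 1 - i" and j = "\<lambda>i. n + 1 - i"])
       (use n refl[of "n + 1 - _"] in \<open>auto simp: h_def\<close>)
  finally show ?thesis
    unfolding eq h_def[symmetric] by (simp add: f_def k sum_subtractf sum_negf left_diff_distrib)
qed

lemma coeff_one_plus_power: "coeff ([:1, 1:] ^ k :: 'a::comm_ring_1 poly) i = of_nat (k choose i)"
proof (induction k arbitrary: i)
  case (Suc k)
  then show ?case by (cases i) (simp_all add: add.commute)
qed (auto simp: binomial_eq_0)

lemma coeff_eq_restriction_sum:
  assumes "n \<ge> 2"
  shows "coeff ([:1, -1:] * ([:1, 1:] ^ (n - 2) * p)) (n - 1) = restriction_sum n (coeff p)"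
proof -
  have conv: "coeff ([:1, 1:] ^ k * p) i = (\<Sum>j\<le>i. of_nat (k choose (i - j)) * coeff p j)" for k i
    by (subst mult.commute) (simp add: coeff_mult coeff_one_plus_power mult.commute)
  have "n - 1 = Suc (n - 2)" using assms by simp
  then show ?thesis unfolding restriction_sum_def conv[symmetric] by simp
qed

section \<open>Transitive partitions as colourings\<close>

text \<open>
  The colour of a block is the smaller end \<open>j\<close> of the edge \<open>(j, j+1)\<close> in it, and non-edges
  have the dummy colour \<open>0\<close>.
\<close>

definition colouring :: "nat \<Rightarrow> nat \<Rightarrow> (nat \<Rightarrow> nat \<Rightarrow> nat) \<Rightarrow> bool" where
  "colouring n i c \<longleftrightarrow>
     (\<forall>j k. \<not> (i \<le> j \<and> j < k \<and> k \<le> n) \<longrightarrow> c j k = 0) \<and>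
     (\<forall>j. i \<le> j \<and> j < n \<longrightarrow> c j (Suc j) = j) \<and>
     (\<forall>j k l. i \<le> j \<and> j < k \<and> k < l \<and> l \<le> n \<longrightarrow> c j l = c j k \<or> c j l = c k l)"

lemma colouring_outside: "colouring n i c \<Longrightarrow> \<not> (i \<le> j \<and> j < k \<and> k \<le> n) \<Longrightarrow> c j k = 0"
  unfolding colouring_def by blast

lemma colouring_Suc: "colouring n i c \<Longrightarrow> i \<le> j \<Longrightarrow> j < n \<Longrightarrow> c j (Suc j) = j"
  unfolding colouring_def by blast

lemma colouring_triangle:
  "colouring n i c \<Longrightarrow> i \<le> j \<Longrightarrow> j < k \<Longrightarrow> k < l \<Longrightarrow> l \<le> n \<Longrightarrow> c j l = c j k \<or> c j l = c k l"
  unfolding colouring_def by blast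

text \<open>In the tree, \<open>c j k\<close> is the node among j, ..., k-1 that is nearest to the
  root. The bounds follow by splitting off the first edge of the path from j to k: the colour is j
  or that of the remaining path.\<close>

lemma colouring_bounds:
  assumes "colouring n i c" "i \<le> j" "j < k" "k \<le> n"
  shows "j \<le> c j k \<and> c j k < k"
  using assms(2-)
proof (induction "k - j" arbitrary: j k rule: less_induct)
  case less
  show ?case
  proof (cases "k = Suc j")
    case True
    then show ?thesis using colouring_Suc[OF assms(1)] less.prems by simp
  next
    case False
    then have "c j k = c j (Suc j) \<or> c j k = c (Suc j) k"
      using colouring_triangle[OF assms(1)] less.prems by simp
    moreover have "Suc j \<le> c (Suc j) k \<and> c (Suc j) k < k"
      using less.hyps[of k "Suc j"] less.prems False by simp
    moreover have "c j (Suc j) = j" using colouring_Suc[OF assms(1)] less.prems by simp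
    ultimately show ?thesis using less.prems by auto
  qed
qed

text \<open>The colouring induced on the vertices from \<open>i\<close> on. The default 0 is that of
  \<open>colouring\<close>, so that equality of functions is equality of the induced
  colourings.\<close>

definition cut_below :: "nat \<Rightarrow> (nat \<Rightarrow> nat \<Rightarrow> nat) \<Rightarrow> nat \<Rightarrow> nat \<Rightarrow> nat" where
  "cut_below i c = (\<lambda>j k. if i \<le> j then c j k else 0)"

text \<open>
  In terms of the binary tree on \<open>{i..n}\<close>, these are the last vertices of the subtrees hanging at the
  left spine, the external leaf \<open>i\<close> included. A new vertex \<open>i\<close> is added by choosing the subtree on
  \<open>{i+1..u}\<close> that becomes the right subtree of the node \<open>i\<close>.
\<close>

definition spine :: "nat \<Rightarrow> nat \<Rightarrow> (nat \<Rightarrow> nat \<Rightarrow> nat) \<Rightarrow> nat set" where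
  "spine n i c = {v. i \<le> v \<and> v \<le> n \<and> (\<forall>j k. i \<le> j \<and> j \<le> v \<and> v < k \<and> k \<le> n \<longrightarrow> c j k = c i k)}"

definition extend :: "nat \<Rightarrow> nat \<Rightarrow> (nat \<Rightarrow> nat \<Rightarrow> nat) \<Rightarrow> nat \<Rightarrow> nat \<Rightarrow> nat \<Rightarrow> nat" where
  "extend n i c u = (\<lambda>j k. if j = i \<and> i < k \<and> k \<le> n then (if k \<le> u then i else c (Suc i) k) else c j k)"

section \<open>Growing a colouring by one vertex\<close>

lemma colouring_cut_below: "colouring n i c \<Longrightarrow> i \<le> i' \<Longrightarrow> colouring n i' (cut_below i' c)"
  unfolding colouring_def[of n i' "cut_below i' c"]
  by (intro conjI allI impI)
     (simp_all add: cut_below_def colouring_outside colouring_Suc colouring_triangle)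

lemma cut_below_cut_below: "i \<le> i' \<Longrightarrow> cut_below i' (cut_below i c) = cut_below i' c"
  unfolding cut_below_def by (auto simp: fun_eq_iff)

lemma cut_below_same: "colouring n i c \<Longrightarrow> cut_below i c = c"
  by (intro ext) (simp add: cut_below_def colouring_outside)

lemma cut_below_extend:
  "colouring n (Suc i) c \<Longrightarrow> cut_below (Suc i) (extend n i c u) = c"
  by (intro ext) (simp add: cut_below_def extend_def colouring_outside)

lemma spine_bounds: "v \<in> spine n i c \<Longrightarrow> i \<le> v \<and> v \<le> n"
  by (simp add: spine_def)

lemma spineD: "v \<in> spine n i c \<Longrightarrow> i \<le> j \<Longrightarrow> j \<le> v \<Longrightarrow> v < k \<Longrightarrow> k \<le> n \<Longrightarrow> c j k = c i k"
  unfolding spine_def by blast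

lemma finite_spine [simp]: "finite (spine n i c)"
  by (rule finite_subset[of _ "{..n}"]) (auto simp: spine_def)

lemma colouring_extend:
  assumes c: "colouring n (Suc i) c" and u: "u \<in> spine n (Suc i) c" and "i < n"
  shows "colouring n i (extend n i c u)"
  unfolding colouring_def
proof (intro conjI allI impI)
  fix j k assume "\<not> (i \<le> j \<and> j < k \<and> k \<le> n)"
  then show "extend n i c u j k = 0"
    using colouring_outside[OF c, of j k] by (auto simp: extend_def)
next
  fix j assume "i \<le> j \<and> j < n"
  then show "extend n i c u j (Suc j) = j"
    using colouring_Suc[OF c, of j] spine_bounds[OF u] by (auto simp: extend_def)
next
  fix j k l assume jkl: "i \<le> j \<and> j < k \<and> k < l \<and> l \<le> n"
  show "extend n i c u j l = extend n i c u j k \<or> extend n i c u j l = extend n i c u k l"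
  proof (cases "j = i")
    case True
    consider "l \<le> u" | "k \<le> u" "u < l" | "u < k" by linarith
    then show ?thesis
    proof cases
      case 2
      \<comment> \<open>The edges from k and from \<open>Suc i\<close> to l both cross the cut after
        u, hence have equal colours, and the new edge (i, l) copies the latter.\<close>
      then have "c k l = c (Suc i) l" using spineD[OF u, of k l] jkl spine_bounds[OF u] True by simp
      then show ?thesis using True 2 jkl by (simp add: extend_def)
    next
      case 3
      have "Suc i < k" using 3 spine_bounds[OF u] by simp
      then show ?thesis
        using True 3 jkl colouring_triangle[OF c, of "Suc i" k l] by (auto simp: extend_def)
    qed (use True jkl in \<open>simp add: extend_def\<close>)
  next
    case False
    then show ?thesis using jkl colouring_triangle[OF c, of j k l] by (auto simp: extend_def)
  qed
qed

lemma colouring_is_extend: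
  assumes c: "colouring n i c" and "i < n"
  obtains u where "u \<in> spine n (Suc i) (cut_below (Suc i) c)" "c = extend n i (cut_below (Suc i) c) u"
proof -
  \<comment> \<open>The right subtree of the node i ends at the last vertex that is joined to i by
    an edge of colour i.\<close>
  define U where "U = {k. i < k \<and> k \<le> n \<and> c i k = i}"
  define u where "u = Max U"
  have "finite U" by (rule finite_subset[of _ "{..n}"]) (auto simp: U_def)
  moreover have SU: "Suc i \<in> U" using colouring_Suc[OF c, of i] \<open>i < n\<close> by (simp add: U_def)
  ultimately have uU: "u \<in> U" and u_max: "\<And>k. k \<in> U \<Longrightarrow> k \<le> u" unfolding u_def by (auto intro: Max_in)
  then have u: "Suc i \<le> u" "u \<le> n" "c i u = i" by (auto simp: U_def)
  have low: "c i k = i" if "i < k" "k \<le> u" for k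
  proof (cases "k = u")
    case False
    then have "c i u = c i k \<or> c i u = c k u" using colouring_triangle[OF c, of i k u] that u by simp
    moreover have "c k u \<ge> k" using colouring_bounds[OF c, of k u] that False u by simp
    ultimately show ?thesis using u that by auto
  qed (use u in simp)
  have high: "c i k = c (Suc i) k" if "u < k" "k \<le> n" for k
  proof -
    have "c i k = c i (Suc i) \<or> c i k = c (Suc i) k"
      using colouring_triangle[OF c, of i "Suc i" k] that u by simp
    moreover have "c i k \<noteq> i" using u_max[of k] that u by (auto simp: U_def)
    ultimately show ?thesis using low[of "Suc i"] u by simp
  qed
  have "u \<in> spine n (Suc i) (cut_below (Suc i) c)"
    unfolding spine_def
  proof (intro CollectI conjI allI impI)
    fix j k assume jk: "Suc i \<le> j \<and> j \<le> u \<and> u < k \<and> k \<le> n"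
    then have "c i k = c i j \<or> c i k = c j k" using colouring_triangle[OF c, of i j k] by simp
    moreover have "c i k \<noteq> i" using u_max[of k] jk u by (auto simp: U_def)
    ultimately have "c i k = c j k" using low[of j] jk by auto
    then show "cut_below (Suc i) c j k = cut_below (Suc i) c (Suc i) k"
      using high[of k] jk by (simp add: cut_below_def)
  qed (use u in auto)
  moreover have "c = extend n i (cut_below (Suc i) c) u"
  proof (intro ext)
    fix j k
    show "c j k = extend n i (cut_below (Suc i) c) u j k"
      using low[of k] high[of k] colouring_outside[OF c, of j k]
      by (auto simp: extend_def cut_below_def)
  qed
  ultimately show ?thesis using that by blast
qed

text \<open>The subtrees ending before \<open>u\<close> are absorbed into the right subtree of i:
  their ends are bypassed by the edges from i and from \<open>Suc i\<close> to u, whose colours are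
  i and larger than i. The vertex u stays, as the end of that right subtree, and i joins as the new
  external leaf.\<close>

lemma spine_extend:
  assumes c: "colouring n (Suc i) c" and u: "u \<in> spine n (Suc i) c" and "i < n"
  shows "spine n i (extend n i c u) = insert i {v \<in> spine n (Suc i) c. u \<le> v}"
proof (intro equalityI subsetI)
  fix v assume v: "v \<in> spine n i (extend n i c u)"
  show "v \<in> insert i {v \<in> spine n (Suc i) c. u \<le> v}"
  proof (cases "v = i")
    case False
    then have iv: "i < v" "v \<le> n" using spine_bounds[OF v] by simp_all
    have v': "\<And>j k. i \<le> j \<and> j \<le> v \<and> v < k \<and> k \<le> n \<Longrightarrow> extend n i c u j k = extend n i c u i k"
      using v unfolding spine_def by blast
    have uv: "u \<le> v"
    proof (rule ccontr)
      assume "\<not> u \<le> v"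
      then have "extend n i c u (Suc i) u = extend n i c u i u" using v'[of "Suc i" u] iv spine_bounds[OF u] by simp
      moreover have "c (Suc i) u \<ge> Suc i" using colouring_bounds[OF c, of "Suc i" u] \<open>\<not> u \<le> v\<close> iv spine_bounds[OF u] by simp
      ultimately show False using \<open>\<not> u \<le> v\<close> iv spine_bounds[OF u] by (simp add: extend_def)
    qed
    have "v \<in> spine n (Suc i) c" unfolding spine_def
    proof (intro CollectI conjI allI impI)
      fix j k assume jk: "Suc i \<le> j \<and> j \<le> v \<and> v < k \<and> k \<le> n"
      then show "c j k = c (Suc i) k" using v'[of j k] uv iv by (simp add: extend_def)
    qed (use iv in auto)
    then show ?thesis using uv by simp
  qed simp
next
  fix v assume "v \<in> insert i {v \<in> spine n (Suc i) c. u \<le> v}"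
  then consider "v = i" | "v \<in> spine n (Suc i) c" "u \<le> v" by blast
  then show "v \<in> spine n i (extend n i c u)"
  proof cases
    case 2
    then have *: "\<And>j k. Suc i \<le> j \<and> j \<le> v \<and> v < k \<and> k \<le> n \<Longrightarrow> c j k = c (Suc i) k"
      and "Suc i \<le> v" "v \<le> n" using spineD spine_bounds by blast+
    show ?thesis unfolding spine_def
    proof (intro CollectI conjI allI impI)
      fix j k assume jk: "i \<le> j \<and> j \<le> v \<and> v < k \<and> k \<le> n"
      then show "extend n i c u j k = extend n i c u i k"
        using *[of j k] \<open>u \<le> v\<close> \<open>Suc i \<le> v\<close> by (auto simp: extend_def)
    qed (use \<open>Suc i \<le> v\<close> \<open>v \<le> n\<close> in auto)
  qed (use \<open>i < n\<close> in \<open>auto simp: spine_def\<close>)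
qed

text \<open>The node i has no right child. Of two neighbouring nodes i-1 and i, either i-1 has a
  right child or i has a left child, so i > 1 is a leaf when \<open>up_step\<close> holds at i and
  fails at i-1. The case \<open>Suc i = n\<close> is the last node, for which there is no edge to
  test.\<close>

definition up_step :: "nat \<Rightarrow> nat \<Rightarrow> (nat \<Rightarrow> nat \<Rightarrow> nat) \<Rightarrow> bool" where
  "up_step n i c \<longleftrightarrow> i < n \<and> (Suc i = n \<or> c i (Suc (Suc i)) \<noteq> i)"

lemma up_step_extend:
  assumes c: "colouring n (Suc i) c" and u: "u \<in> spine n (Suc i) c" and "i < n"
  shows "up_step n i (extend n i c u) \<longleftrightarrow> u = Suc i"
  using spine_bounds[OF u] \<open>i < n\<close> colouring_Suc[OF c, of "Suc i"]
  by (auto simp: up_step_def extend_def)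

lemma up_step_cut_below: "i' \<le> i \<Longrightarrow> up_step n i (cut_below i' c) = up_step n i c"
  by (simp add: up_step_def cut_below_def)

text \<open>The condition that all leaves lie in \<open>S\<close>, split into single nodes. It looks
  only at the edges from j-1 and j, hence is decided once the vertex j-1 has been added.\<close>

definition admissible :: "nat \<Rightarrow> nat set \<Rightarrow> nat \<Rightarrow> (nat \<Rightarrow> nat \<Rightarrow> nat) \<Rightarrow> bool" where
  "admissible n S j c \<longleftrightarrow> (up_step n j c \<and> (j = 1 \<or> \<not> up_step n (j - 1) c) \<longrightarrow> j \<in> S)"

text \<open>Counting the elements not below \<open>u\<close> numbers a finite linear order from the
  top. This converts the choice of a cut on the spine into the length of the new spine.\<close>

lemma sum_card_upper:
  fixes V :: "'a::linorder set"
  assumes "finite V"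
  shows "(\<Sum>u\<in>V. g (card {v \<in> V. u \<le> v})) = (\<Sum>x=1..card V. g x)"
proof (rule sum.reindex_bij_betw)
  let ?r = "\<lambda>u. card {v \<in> V. u \<le> v}"
  have lt: "?r b < ?r a" if "a \<in> V" "a < b" for a b
  proof (rule psubset_card_mono)
    have "a \<in> {v \<in> V. a \<le> v}" "a \<notin> {v \<in> V. b \<le> v}" using that by auto
    moreover have "{v \<in> V. b \<le> v} \<subseteq> {v \<in> V. a \<le> v}" using that by auto
    ultimately show "{v \<in> V. b \<le> v} \<subset> {v \<in> V. a \<le> v}" by blast
  qed (use assms in simp)
  have inj: "inj_on ?r V"
  proof (rule inj_onI, rule ccontr)
    fix a b assume ab: "a \<in> V" "b \<in> V" "?r a = ?r b" "a \<noteq> b"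
    from ab(4) have "a < b \<or> b < a" by (simp add: neq_iff)
    then show False using lt[of a b] lt[of b a] ab(1-3) by auto
  qed
  have "?r ` V \<subseteq> {1..card V}"
    using assms by (auto simp: Suc_le_eq card_gt_0_iff intro: card_mono)
  moreover have "card (?r ` V) = card {1..card V}" using card_image[OF inj] by simp
  ultimately have "?r ` V = {1..card V}" by (simp add: card_subset_eq)
  then show "bij_betw ?r V {1..card V}" using inj by (simp add: bij_betw_def)
qed

section \<open>Counting the completions of a colouring\<close>

lemma finite_colourings: "finite {c. colouring n i c}"
proof (rule finite_imageD)
  let ?f = "\<lambda>c. (\<lambda>(j, k). (c j k :: nat))"
  show "inj_on ?f {c. colouring n i c}"
    by (rule inj_onI) (auto simp: fun_eq_iff)
  have "?f ` {c. colouring n i c} \<subseteq>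
      {f. \<forall>e. (e \<in> {..n} \<times> {..n} \<longrightarrow> f e \<in> {..n}) \<and> (e \<notin> {..n} \<times> {..n} \<longrightarrow> f e = 0)}"
  proof (intro subsetI, elim imageE, intro CollectI allI)
    fix f c and e :: "nat \<times> nat" assume f: "f = ?f c" and c: "c \<in> {c. colouring n i c}"
    obtain j k where e: "e = (j, k)" by fastforce
    show "(e \<in> {..n} \<times> {..n} \<longrightarrow> f e \<in> {..n}) \<and> (e \<notin> {..n} \<times> {..n} \<longrightarrow> f e = 0)"
      using c colouring_outside[of n i c j k] colouring_bounds[of n i c j k]
      by (cases "i \<le> j \<and> j < k \<and> k \<le> n") (auto simp: f e)
  qed
  then show "finite (?f ` {c. colouring n i c})"
    by (rule finite_subset) (intro finite_set_of_finite_funs; simp)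
qed

text \<open>Sorting the completions by the cut at which the next vertex is attached reproduces the
  recursion of \<open>ballot_count\<close>. One is subtracted from the size of the spine because
  \<open>spine\<close> also lists the external leaf i, while \<open>ballot_count\<close> counts
  nodes.\<close>

lemma card_completions:
  assumes "1 \<le> i" "i \<le> n" "colouring n i c"
  shows "card {d. colouring n 1 d \<and> cut_below i d = c \<and> (\<forall>j\<in>{1..i}. admissible n S j d)} =
    ballot_count S (i - 1) (card (spine n i c) - 1) (up_step n i c)"
  using assms
proof (induction i arbitrary: c rule: nat_induct_at_least)
  case base
  have "{d. colouring n 1 d \<and> cut_below 1 d = c \<and> (\<forall>j\<in>{1..1}. admissible n S j d)} =
      (if admissible n S 1 c then {c} else {})"
    using base cut_below_same by auto
  then show ?case by (simp add: admissible_def)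
next
  case (Suc i)
  have c: "colouring n (Suc i) c" and "i < n" "1 \<le> i" using Suc by auto
  define V where "V = spine n (Suc i) c"
  define X where "X u = {d. colouring n 1 d \<and> cut_below i d = extend n i c u \<and> (\<forall>j\<in>{1..i}. admissible n S j d)}" for u
  define b where "b \<longleftrightarrow> up_step n (Suc i) c \<and> Suc i \<notin> S"
  have finV: "finite V" and minV: "Suc i \<in> V" and geV: "\<And>u. u \<in> V \<Longrightarrow> Suc i \<le> u"
    using \<open>i < n\<close> by (auto simp: V_def spine_def)
  have card_X: "card (X u) = ballot_count S (i - 1) (card {v \<in> V. u \<le> v}) (u = Suc i)" if u: "u \<in> V" for u
  proof -
    have "i \<notin> {v \<in> V. u \<le> v}" using geV[of i] by auto
    then show ?thesis
      using Suc.IH[of "extend n i c u"] u finV \<open>i < n\<close> colouring_extend[OF c]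
      unfolding X_def V_def by (simp add: spine_extend[OF c] up_step_extend[OF c])
  qed
  \<comment> \<open>Attaching i decides about the node \<open>Suc i\<close>. With u =
    \<open>Suc i\<close> it receives the left child i; otherwise it never gets a left child, and is
    a leaf if it has no right child either.\<close>
  have step: "admissible n S (Suc i) d \<longleftrightarrow> u = Suc i \<or> \<not> b" if "d \<in> X u" "u \<in> V" for d u
  proof -
    have d: "cut_below i d = extend n i c u" using that by (simp add: X_def)
    have "up_step n i d \<longleftrightarrow> u = Suc i"
      using up_step_extend[OF c, of u] up_step_cut_below[of i i n d] that \<open>i < n\<close> by (simp add: d V_def)
    moreover have "cut_below (Suc i) d = c"
      using cut_below_cut_below[of i "Suc i" d] cut_below_extend[OF c] by (simp add: d)
    then have "up_step n (Suc i) d = up_step n (Suc i) c"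
      using up_step_cut_below[of "Suc i" "Suc i" n d] by simp
    ultimately show ?thesis using \<open>1 \<le> i\<close> by (auto simp: admissible_def b_def)
  qed
  have decomp: "{d. colouring n 1 d \<and> cut_below (Suc i) d = c \<and> (\<forall>j\<in>{1..Suc i}. admissible n S j d)} =
      (\<Union>u\<in>V. if u = Suc i \<or> \<not> b then X u else {})" (is "?L = ?R")
  proof (intro equalityI subsetI)
    fix d assume d: "d \<in> ?L"
    let ?d = "cut_below i d"
    have cd: "colouring n i ?d" using d \<open>1 \<le> i\<close> by (auto intro: colouring_cut_below)
    have cut: "cut_below (Suc i) ?d = c" using d by (simp add: cut_below_cut_below)
    obtain u where u: "u \<in> V" "?d = extend n i c u"
      using colouring_is_extend[OF cd \<open>i < n\<close>] unfolding cut V_def by blast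
    then have "d \<in> X u" using d by (simp add: X_def)
    moreover have "u = Suc i \<or> \<not> b" using step[OF \<open>d \<in> X u\<close> \<open>u \<in> V\<close>] d by simp
    ultimately show "d \<in> ?R" using u by auto
  next
    fix d assume "d \<in> ?R"
    then obtain u where u: "u \<in> V" "u = Suc i \<or> \<not> b" "d \<in> X u" by (auto split: if_splits)
    then have "cut_below (Suc i) d = c"
      using cut_below_cut_below[of i "Suc i" d] cut_below_extend[OF c] by (simp add: X_def)
    moreover have "admissible n S (Suc i) d" using step[OF u(3,1)] u(2) by simp
    ultimately show "d \<in> ?L" using u(3) by (auto simp: X_def le_Suc_eq)
  qed
  have fX: "finite (X u)" for u
    by (rule finite_subset[OF _ finite_colourings[of n 1]]) (auto simp: X_def)
  have disj: "X u \<inter> X u' = {}" if "u \<in> V" "u' \<in> V" "u \<noteq> u'" for u u'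
  proof (rule ccontr)
    assume "X u \<inter> X u' \<noteq> {}"
    then have eq: "extend n i c u = extend n i c u'" by (auto simp: X_def)
    have "False" if "a \<in> V" "b \<in> V" "a < b" "extend n i c a = extend n i c b" for a b
    proof -
      have "b \<le> n" "Suc i \<le> a" using that(1,2) spine_bounds unfolding V_def by blast+
      then have "c (Suc i) b = i" using fun_cong[OF fun_cong[OF that(4)], of i b] that by (simp add: extend_def)
      then show False using colouring_bounds[OF c, of "Suc i" b] \<open>b \<le> n\<close> \<open>Suc i \<le> a\<close> that by simp
    qed
    from this[of u u'] this[of u' u] show False using eq that by (auto simp: neq_iff)
  qed
  define g where "g x = (if b then 0 else ballot_count S (i - 1) x False)" for x
  have "card ?L = (\<Sum>u\<in>V. card (if u = Suc i \<or> \<not> b then X u else {}))"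
    unfolding decomp by (subst card_UN_disjoint) (use finV fX disj in \<open>auto split: if_splits\<close>)
  also have "\<dots> = card (X (Suc i)) + (\<Sum>u\<in>V - {Suc i}. if b then 0 else card (X u))"
    by (subst sum.remove[OF finV minV]) (cases b; auto intro!: sum.cong)
  also have "card (X (Suc i)) = ballot_count S (i - 1) (card V) True"
  proof -
    have "{v \<in> V. Suc i \<le> v} = V" using geV by auto
    then show ?thesis using card_X[OF minV] by simp
  qed
  \<comment> \<open>\<open>Suc i\<close> is the least element of \<open>V\<close>, so removing it
    leaves the upper sets of the other cuts unchanged.\<close>
  also have "(\<Sum>u\<in>V - {Suc i}. if b then 0 else card (X u)) = (\<Sum>u\<in>V - {Suc i}. g (card {v \<in> V - {Suc i}. u \<le> v}))"
  proof (rule sum.cong[OF refl])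
    fix u assume u: "u \<in> V - {Suc i}"
    then have "{v \<in> V. u \<le> v} = {v \<in> V - {Suc i}. u \<le> v}" using geV[of u] by auto
    then show "(if b then 0 else card (X u)) = g (card {v \<in> V - {Suc i}. u \<le> v})"
      using card_X[of u] u by (simp add: g_def)
  qed
  also have "\<dots> = (\<Sum>x=1..card V - 1. g x)"
    by (subst sum_card_upper) (use finV minV in auto)
  finally have total: "card ?L = ballot_count S (i - 1) (card V) True + (\<Sum>x=1..card V - 1. g x)" .
  obtain p where p: "i = Suc p" using \<open>1 \<le> i\<close> by (cases i) auto
  obtain s where s: "card V = Suc s" using finV minV by (cases "card V") auto
  have g_sum: "(\<Sum>x=1..k. g x) = (if b then 0 else \<Sum>x=1..k. ballot_count S (i - 1) x False)" for k
    by (cases b) (simp_all add: g_def)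
  show ?case
    unfolding total unfolding V_def[symmetric] s unfolding g_sum by (simp add: p b_def)
qed

lemma card_colourings:
  assumes "1 \<le> n"
  shows "card {d. colouring n 1 d \<and> (\<forall>j\<in>{1..n - 1}. admissible n S j d)} = ballot_count S (n - 1) 0 False"
proof -
  \<comment> \<open>The start is the tree on the single vertex n: it has no node, and the external
    leaf n is its whole spine.\<close>
  have "spine n n (\<lambda>_ _. 0) = {n}" by (auto simp: spine_def)
  moreover have "colouring n n (\<lambda>_ _. 0)" by (simp add: colouring_def)
  moreover have cut: "cut_below n d = (\<lambda>_ _. 0)" if "colouring n 1 d" for d
    using colouring_outside[OF that] by (auto simp: cut_below_def fun_eq_iff)
  have "{d. colouring n 1 d \<and> cut_below n d = (\<lambda>_ _. 0) \<and> (\<forall>j\<in>{1..n}. admissible n S j d)} =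
     {d. colouring n 1 d \<and> (\<forall>j\<in>{1..n - 1}. admissible n S j d)}"
  proof -
    have "{1..n} = insert n {1..n - 1}" using assms by auto
    moreover have "admissible n S n d" for d by (simp add: admissible_def up_step_def)
    ultimately show ?thesis using cut by auto
  qed
  ultimately show ?thesis using card_completions[of n n "\<lambda>_ _. 0" S] assms by (simp add: up_step_def)
qed

section \<open>Colour classes and transitive partitions\<close>

definition colour_class :: "nat \<Rightarrow> (nat \<Rightarrow> nat \<Rightarrow> nat) \<Rightarrow> nat \<Rightarrow> (nat \<times> nat) set" where
  "colour_class n c i = {(j, k) \<in> tournament_edges n. c j k = i}"

definition colour_classes :: "nat \<Rightarrow> (nat \<Rightarrow> nat \<Rightarrow> nat) \<Rightarrow> (nat \<times> nat) set set" where
  "colour_classes n c = colour_class n c ` {1..n - 1}"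

text \<open>The pairs in \<open>D\<close> are steps of a closed walk in the direction of traversal,
  so a step to a smaller vertex runs against its edge. The two steps may traverse the same
  edge.\<close>

definition conflict :: "(nat \<Rightarrow> nat \<Rightarrow> nat) \<Rightarrow> (nat \<times> nat) set \<Rightarrow> bool" where
  "conflict c D \<longleftrightarrow> (\<exists>(a, b) \<in> D. \<exists>(a', b') \<in> D. a < b \<and> b' < a' \<and> c a b = c b' a')"

lemma conflictI: "(a, b) \<in> D \<Longrightarrow> (a', b') \<in> D \<Longrightarrow> a < b \<Longrightarrow> b' < a' \<Longrightarrow> c a b = c b' a' \<Longrightarrow> conflict c D"
  unfolding conflict_def by blast

text \<open>If y lies between x and z, one step of the detour inherits the colour and the direction
  of the shortcut. If y lies outside, the triangle condition for the longest edge leaves two cases: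
  that edge has the colour and the direction of the shortcut, or the two steps of the detour
  conflict with each other.\<close>

lemma conflict_detour:
  assumes c: "colouring n 1 c" and conf: "conflict c (insert (x, z) D)"
    and ran: "{x, y, z} \<subseteq> {1..n}" and dist: "x \<noteq> y" "y \<noteq> z" "x \<noteq> z"
  shows "conflict c (insert (x, y) (insert (y, z) D))" (is "conflict c ?D")
proof -
  have tri: "c j l = c j k \<or> c j l = c k l" if "1 \<le> j" "j < k" "k < l" "l \<le> n" for j k l
    using colouring_triangle[OF c] that by blast
  obtain a b a' b' where ab: "(a, b) \<in> insert (x, z) D" "(a', b') \<in> insert (x, z) D"
    "a < b" "b' < a'" "c a b = c b' a'"
    using conf unfolding conflict_def by blast
  have up: "conflict c ?D \<or> (\<exists>(p, q) \<in> ?D. p < q \<and> c p q = c x z)" if "x < z"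
  proof -
    consider "x < y" "y < z" | "z < y" | "y < x" using dist by linarith
    then show ?thesis
    proof cases
      case 1 then show ?thesis using tri[of x y z] ran by auto
    next
      case 2 then show ?thesis using tri[of x z y] ran that
        by (auto intro: conflictI[of x y _ y z])
    next
      case 3 then show ?thesis using tri[of y x z] ran that
        by (auto intro: conflictI[of y z _ x y])
    qed
  qed
  have down: "conflict c ?D \<or> (\<exists>(p, q) \<in> ?D. q < p \<and> c q p = c z x)" if "z < x"
  proof -
    consider "z < y" "y < x" | "x < y" | "y < z" using dist by linarith
    then show ?thesis
    proof cases
      case 1 then show ?thesis using tri[of z y x] ran by auto
    next
      case 2 then show ?thesis using tri[of z x y] ran that
        by (auto intro: conflictI[of x y _ y z])
    next
      case 3 then show ?thesis using tri[of y z x] ran that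
        by (auto intro: conflictI[of y z _ x y])
    qed
  qed
  show ?thesis
  proof (cases "(a, b) = (x, z)")
    case True
    then have "(a', b') \<in> D" using ab by auto
    moreover have "conflict c ?D" if "(p, q) \<in> ?D" "p < q" "c p q = c x z" for p q
      using that True ab \<open>(a', b') \<in> D\<close> by (intro conflictI[of p q _ a' b']) auto
    ultimately show ?thesis using up True ab by blast
  next
    case False
    then have D: "(a, b) \<in> D" using ab by auto
    show ?thesis
    proof (cases "(a', b') = (x, z)")
      case True
      moreover have "conflict c ?D" if "(p, q) \<in> ?D" "q < p" "c q p = c z x" for p q
        using that True ab D by (intro conflictI[of a b _ p q]) auto
      ultimately show ?thesis using down ab by blast
    next
      case False
      then show ?thesis using D ab by (intro conflictI[of a b _ a' b']) auto
    qed
  qed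
qed

lemma conflict_cycle:
  assumes "colouring n 1 c" "distinct xs" "2 \<le> length xs" "set xs \<subseteq> {1..n}"
  shows "conflict c (set (zip xs (rotate1 xs)))"
  using assms(2-)
proof (induction xs rule: length_induct)
  case (1 xs)
  then obtain x z r where xs: "xs = x # z # r"
    by (metis One_nat_def Suc_1 Suc_le_length_iff)
  show ?case
  proof (cases r)
    case Nil
    then show ?thesis using 1 by (cases "x < z") (auto simp: xs conflict_def)
  next
    case (Cons w s)
    have "conflict c (set (zip (x # w # s) (rotate1 (x # w # s))))"
      using 1(2-) by (intro 1(1)[rule_format]) (auto simp: xs Cons)
    then show ?thesis
      using conflict_detour[OF assms(1), of x w "set (zip (w # s) (s @ [x]))" z] 1(2-) by (auto simp: xs Cons insert_commute)
  qed
qed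

lemma next_vertex_rotate1: "i < length c \<Longrightarrow> next_vertex c i = rotate1 c ! i"
  by (simp add: next_vertex_def nth_rotate1)

lemma transitive_partition_colour_classes:
  assumes c: "colouring n 1 c"
  shows "transitive_partition (tournament_edges n) (colour_classes n c)"
  unfolding transitive_partition_def
proof (intro conjI allI impI)
  have mem: "(j, k) \<in> colour_class n c (c j k) \<and> c j k \<in> {1..n - 1}" if "(j, k) \<in> tournament_edges n" for j k
    using that colouring_bounds[OF c, of j k] by (auto simp: colour_class_def tournament_edges_def)
  show "partition_on (tournament_edges n) (colour_classes n c)"
  proof (rule partition_onI)
    show "\<Union> (colour_classes n c) = tournament_edges n"
      using mem by (force simp: colour_classes_def colour_class_def)
    show "{} \<notin> colour_classes n c"
    proof
      assume "{} \<in> colour_classes n c"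
      then obtain i where "{} = colour_class n c i" "i \<in> {1..n - 1}" by (auto simp: colour_classes_def)
      moreover from this have "1 \<le> i" "i < n" by auto
      then have "(i, Suc i) \<in> colour_class n c i"
        using colouring_Suc[OF c \<open>1 \<le> i\<close>] by (simp add: colour_class_def tournament_edges_def)
      ultimately show False by blast
    qed
  qed (auto simp: colour_classes_def colour_class_def disjnt_def)
  fix xs assume xs: "undirected_cycle (tournament_edges n) xs"
  have sub: "set xs \<subseteq> {1..n}"
  proof
    fix x assume "x \<in> set xs"
    then obtain i where "i < length xs" "x = xs ! i" by (auto simp: in_set_conv_nth)
    then have "(x, next_vertex xs i) \<in> tournament_edges n \<union> (tournament_edges n)\<inverse>"
      using xs by (auto simp: undirected_cycle_def)
    then show "x \<in> {1..n}" by (auto simp: tournament_edges_def)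
  qed
  have "conflict c (set (zip xs (rotate1 xs)))"
    using conflict_cycle[OF c _ _ sub] xs by (simp add: undirected_cycle_def)
  then obtain a b a' b' where ab: "(a, b) \<in> set (zip xs (rotate1 xs))" "(a', b') \<in> set (zip xs (rotate1 xs))"
    "a < b" "b' < a'" "c a b = c b' a'"
    unfolding conflict_def by blast
  then obtain i j where ij: "i < length xs" "a = xs ! i" "b = rotate1 xs ! i"
     "j < length xs" "a' = xs ! j" "b' = rotate1 xs ! j"
    by (auto simp: in_set_zip)
  have "a \<in> set xs" "b \<in> set xs" "a' \<in> set xs" "b' \<in> set xs" 
    using ab(1,2)[THEN set_zip_leftD] ab(1,2)[THEN set_zip_rightD] by simp_all
  then have "a \<in> {1..n}" "b \<in> {1..n}" "a' \<in> {1..n}" "b' \<in> {1..n}" using sub by blast+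
  then have edges: "(a, b) \<in> tournament_edges n" "(b', a') \<in> tournament_edges n"
    using ab(3,4) by (simp_all add: tournament_edges_def)
  show "\<exists>B\<in>colour_classes n c. \<exists>i<length xs. \<exists>j<length xs.
      (xs ! i, next_vertex xs i) \<in> B \<and> (next_vertex xs j, xs ! j) \<in> B"
  proof (intro bexI exI conjI)
    show "(xs ! i, next_vertex xs i) \<in> colour_class n c (c a b)"
      using mem[OF edges(1)] ij next_vertex_rotate1 by simp
    show "(next_vertex xs j, xs ! j) \<in> colour_class n c (c a b)"
      using mem[OF edges(2)] ij next_vertex_rotate1 ab(5) by simp
    show "colour_class n c (c a b) \<in> colour_classes n c"
      using mem[OF edges(1)] by (simp add: colour_classes_def)
  qed (use ij in auto)
qed

lemma inj_on_colour_class: "colouring n 1 c \<Longrightarrow> inj_on (colour_class n c) {1..n - 1}"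
proof (rule inj_onI)
  fix i j assume c: "colouring n 1 c" and ij: "i \<in> {1..n - 1}" "j \<in> {1..n - 1}" and eq: "colour_class n c i = colour_class n c j"
  have "(i, Suc i) \<in> colour_class n c i"
    using ij colouring_Suc[OF c, of i] by (auto simp: colour_class_def tournament_edges_def)
  then have "(i, Suc i) \<in> colour_class n c j" using eq by simp
  then show "i = j" using ij colouring_Suc[OF c, of i] by (auto simp: colour_class_def)
qed

text \<open>The class of colour i is recognized by the edge (i, i+1) in it, so the unlabelled set of
  classes determines the colours.\<close>

lemma inj_on_colour_classes: "inj_on (colour_classes n) {c. colouring n 1 c}"
proof (rule inj_onI, intro ext)
  fix c d j k assume "c \<in> {c. colouring n 1 c}" "d \<in> {c. colouring n 1 c}" and eq: "colour_classes n c = colour_classes n d"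
  then have c: "colouring n 1 c" and d: "colouring n 1 d" by auto
  show "c j k = d j k"
  proof (cases "1 \<le> j \<and> j < k \<and> k \<le> n")
    case True
    define i where "i = c j k"
    have i: "i \<in> {1..n - 1}" using colouring_bounds[OF c, of j k] True by (auto simp: i_def)
    then have "colour_class n c i \<in> colour_classes n d" unfolding eq[symmetric] by (simp add: colour_classes_def)
    then obtain i' where i': "colour_class n c i = colour_class n d i'" by (auto simp: colour_classes_def)
    have "(i, Suc i) \<in> colour_class n c i"
      using i colouring_Suc[OF c, of i] by (auto simp: colour_class_def tournament_edges_def)
    then have "(i, Suc i) \<in> colour_class n d i'" using i' by simp
    then have "i' = i" using i colouring_Suc[OF d, of i] by (auto simp: colour_class_def)
    moreover have "(j, k) \<in> colour_class n d i'"
      using True unfolding i'[symmetric] by (auto simp: colour_class_def i_def tournament_edges_def)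
    ultimately show ?thesis by (auto simp: colour_class_def i_def)
  qed (use colouring_outside[OF c] colouring_outside[OF d] in simp)
qed

text \<open>On a 3-cycle j < k < l only the edge between j and l runs against the traversal, so it
  shares its block with one of the other two. By induction every edge shares its block with some
  path edge (i, i+1). The n-1 path edges thus meet all blocks, and since there are n-1 blocks they
  lie in distinct ones and can name them.\<close>

lemma transitive_partition_is_colour_classes:
  assumes P: "P \<in> transitive_partitions n (n - 1)"
  obtains c where "colouring n 1 c" "P = colour_classes n c"
proof -
  let ?E = "tournament_edges n"
  have part: "partition_on ?E P" and card: "card P = n - 1"
    and cyc: "\<And>xs. undirected_cycle ?E xs \<Longrightarrow> \<exists>B\<in>P. \<exists>i<length xs. \<exists>j<length xs.
      (xs ! i, next_vertex xs i) \<in> B \<and> (next_vertex xs j, xs ! j) \<in> B"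
    using P by (auto simp: transitive_partitions_def transitive_partition_def)
  define blk where "blk j k = (THE B. B \<in> P \<and> (j, k) \<in> B)" for j k
  have ex1: "\<exists>!B. B \<in> P \<and> (j, k) \<in> B" if "(j, k) \<in> ?E" for j k
  proof -
    have "(j, k) \<in> \<Union> P" using that part by (simp add: partition_on_def)
    then obtain B where B: "B \<in> P" "(j, k) \<in> B" by blast
    moreover have "B' = B" if "B' \<in> P \<and> (j, k) \<in> B'" for B'
      using that B part by (auto simp: partition_on_def disjoint_def)
    ultimately show ?thesis by blast
  qed
  have blk: "blk j k \<in> P" "(j, k) \<in> blk j k" if "(j, k) \<in> ?E" for j k
    using theI'[OF ex1[OF that]] unfolding blk_def by auto
  have blk_eq: "B \<in> P \<Longrightarrow> (j, k) \<in> B \<Longrightarrow> blk j k = B" for B j k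
  proof -
    assume B: "B \<in> P" "(j, k) \<in> B"
    then have "(j, k) \<in> ?E" using part by (auto simp: partition_on_def)
    then show "blk j k = B" using ex1 blk B by blast
  qed
  have tri: "blk j l = blk j k \<or> blk j l = blk k l" if "1 \<le> j" "j < k" "k < l" "l \<le> n" for j k l
  proof -
    have next3: "next_vertex [j, k, l] 0 = k" "next_vertex [j, k, l] 1 = l" "next_vertex [j, k, l] 2 = j"
      by (simp_all add: next_vertex_def)
    have less3: "p = 0 \<or> p = 1 \<or> p = 2" if "p < 3" for p :: nat using that by linarith
    have edges: "(j, k) \<in> ?E" "(k, l) \<in> ?E" "(j, l) \<in> ?E" "(k, j) \<notin> ?E" "(l, k) \<notin> ?E" "(l, j) \<notin> ?E"
      using that by (auto simp: tournament_edges_def)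
    have "([j, k, l] ! p, next_vertex [j, k, l] p) \<in> ?E \<union> ?E\<inverse>" if "p < 3" for p
      using less3[OF that] edges next3 by auto
    then have "undirected_cycle ?E [j, k, l]"
      using that by (simp add: undirected_cycle_def)
    from cyc[OF this] obtain B p q where B: "B \<in> P" "p < 3" "q < 3"
      "([j, k, l] ! p, next_vertex [j, k, l] p) \<in> B" "(next_vertex [j, k, l] q, [j, k, l] ! q) \<in> B"
      by (auto simp: numeral_3_eq_3)
    have "B \<subseteq> ?E" using B part by (auto simp: partition_on_def)
    then have "([j, k, l] ! p, next_vertex [j, k, l] p) \<in> ?E" "(next_vertex [j, k, l] q, [j, k, l] ! q) \<in> ?E"
      using B by blast+
    \<comment> \<open>Index 2 is the closing step from l back to j, the only one against its
      edge.\<close>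
    then have "p \<noteq> 2" "q = 2" using less3[OF B(2)] less3[OF B(3)] edges next3 by auto
    then have "((j, k) \<in> B \<or> (k, l) \<in> B) \<and> (j, l) \<in> B"
      using B(4,5) less3[OF B(2)] next3 by auto
    then show ?thesis using blk_eq[OF B(1)] by auto
  qed
  have steps: "\<exists>i\<in>{j..<k}. blk j k = blk i (Suc i)" if "1 \<le> j" "j < k" "k \<le> n" for j k
    using that
  proof (induction "k - j" arbitrary: j k rule: less_induct)
    case less
    show ?case
    proof (cases "k = Suc j")
      case False
      then have "blk j k = blk j (Suc j) \<or> blk j k = blk (Suc j) k" using tri less.prems by simp
      moreover have "\<exists>i\<in>{Suc j..<k}. blk (Suc j) k = blk i (Suc i)"
        using less.hyps[of k "Suc j"] less.prems False by simp
      ultimately show ?thesis using less.prems by (metis Suc_leD atLeastLessThan_iff order_refl)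
    qed (use less.prems in auto)
  qed
  define f where "f i = blk i (Suc i)" for i
  have fP: "P = f ` {1..n - 1}"
  proof (intro equalityI subsetI)
    fix B assume "B \<in> P"
    then have "B \<noteq> {}" "B \<subseteq> ?E" using part by (auto simp: partition_on_def)
    then obtain j k where jk: "(j, k) \<in> B" "(j, k) \<in> ?E" by fastforce
    then have "1 \<le> j" "j < k" "k \<le> n" by (auto simp: tournament_edges_def)
    then obtain i where "i \<in> {j..<k}" "blk j k = blk i (Suc i)" using steps by blast
    then have "B = f i" "i \<in> {1..n - 1}"
      using blk_eq[OF \<open>B \<in> P\<close> jk(1)] \<open>1 \<le> j\<close> \<open>k \<le> n\<close> by (auto simp: f_def)
    then show "B \<in> f ` {1..n - 1}" by blast
  next
    fix B assume "B \<in> f ` {1..n - 1}"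
    then show "B \<in> P" using blk(1) by (auto simp: f_def tournament_edges_def)
  qed
  have "inj_on f {1..n - 1}" using card unfolding fP by (intro eq_card_imp_inj_on) auto
  define c where "c j k = (if 1 \<le> j \<and> j < k \<and> k \<le> n then the_inv_into {1..n - 1} f (blk j k) else 0)" for j k
  have c_eq: "c j k = i" if "(j, k) \<in> ?E" "i \<in> {1..n - 1}" "blk j k = f i" for i j k
    using that the_inv_into_f_f[OF \<open>inj_on f {1..n - 1}\<close>] by (auto simp: c_def tournament_edges_def)
  have f_c: "f (c j k) = blk j k" if "(j, k) \<in> ?E" for j k
    using that blk(1)[OF that] f_the_inv_into_f[OF \<open>inj_on f {1..n - 1}\<close>] unfolding fP
    by (auto simp: c_def tournament_edges_def)
  have c_ran: "c j k \<in> {1..n - 1}" if "(j, k) \<in> ?E" for j k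
    using that blk(1)[OF that] the_inv_into_into[OF \<open>inj_on f {1..n - 1}\<close>, of "blk j k" "{1..n - 1}"] unfolding fP
    by (auto simp: c_def tournament_edges_def)
  have "colouring n 1 c" unfolding colouring_def
  proof (intro conjI allI impI)
    fix j assume "1 \<le> j \<and> j < n"
    then show "c j (Suc j) = j" by (intro c_eq) (auto simp: f_def tournament_edges_def)
  next
    fix j k l assume jkl: "1 \<le> j \<and> j < k \<and> k < l \<and> l \<le> n"
    then have "c j k = the_inv_into {1..n - 1} f (blk j k)" "c j l = the_inv_into {1..n - 1} f (blk j l)"
       "c k l = the_inv_into {1..n - 1} f (blk k l)" by (auto simp: c_def)
    then show "c j l = c j k \<or> c j l = c k l" using tri[of j k l] jkl by metis
  qed (auto simp: c_def)
  moreover have "colour_class n c i = f i" if "i \<in> {1..n - 1}" for i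
  proof (intro equalityI subsetI)
    fix e assume "e \<in> colour_class n c i"
    then obtain j k where "e = (j, k)" "(j, k) \<in> ?E" "c j k = i" by (auto simp: colour_class_def)
    then show "e \<in> f i" using f_c[of j k] blk(2)[of j k] by simp
  next
    fix e assume e: "e \<in> f i"
    have "f i \<in> P" using that fP by blast
    then have "f i \<subseteq> ?E" using part by (auto simp: partition_on_def)
    then obtain j k where jk: "e = (j, k)" "(j, k) \<in> ?E" using e by (cases e) blast
    then have "c j k = i" using blk_eq[OF \<open>f i \<in> P\<close>, of j k] e that by (intro c_eq) auto
    then show "e \<in> colour_class n c i" using jk by (simp add: colour_class_def)
  qed
  then have "P = colour_classes n c" unfolding fP colour_classes_def by (intro image_cong) auto
  ultimately show ?thesis using that by blast
qed

lemma bij_betw_colour_classes: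
  "bij_betw (colour_classes n) {c. colouring n 1 c} (transitive_partitions n (n - 1))"
  unfolding bij_betw_def
proof (intro conjI equalityI subsetI)
  fix P assume "P \<in> colour_classes n ` {c. colouring n 1 c}"
  then obtain c where "colouring n 1 c" "P = colour_classes n c" by blast
  then show "P \<in> transitive_partitions n (n - 1)"
    using transitive_partition_colour_classes card_image[OF inj_on_colour_class, of n c]
    by (simp add: transitive_partitions_def colour_classes_def)
next
  fix P assume "P \<in> transitive_partitions n (n - 1)"
  then show "P \<in> colour_classes n ` {c. colouring n 1 c}"
    by (elim transitive_partition_is_colour_classes) blast
qed (rule inj_on_colour_classes)

text \<open>If the class of colour i has an edge other than (i, i+1), it reaches further to the left
  or to the right, and then the class already contains (i-1, i+1) or (i, i+2). These are the edges
  tested by \<open>up_step\<close> at i-1 and at i.\<close>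

lemma Des_colour_classes:
  assumes c: "colouring n 1 c"
  shows "Des n (colour_classes n c) =
    {i \<in> {1..n - 1}. up_step n i c \<and> (i = 1 \<or> \<not> up_step n (i - 1) c)}"
proof -
  have sing: "{(i, i + 1)} \<in> colour_classes n c \<longleftrightarrow> up_step n i c \<and> (i = 1 \<or> \<not> up_step n (i - 1) c)"
    if i: "i \<in> {1..n - 1}" for i
  proof -
    have self: "(i, Suc i) \<in> colour_class n c i"
      using i colouring_Suc[OF c, of i] by (auto simp: colour_class_def tournament_edges_def)
    have "{(i, i + 1)} \<in> colour_classes n c \<longleftrightarrow> colour_class n c i = {(i, Suc i)}"
    proof
      assume "{(i, i + 1)} \<in> colour_classes n c"
      then obtain i' where i': "colour_class n c i' = {(i, Suc i)}" by (auto simp: colour_classes_def)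
      then have "(i, Suc i) \<in> colour_class n c i'" by simp
      then have "i' = i" using i colouring_Suc[OF c, of i] by (auto simp: colour_class_def)
      then show "colour_class n c i = {(i, Suc i)}" using i' by simp
    qed (use i in \<open>auto simp: colour_classes_def\<close>)
    also have "\<dots> \<longleftrightarrow> up_step n i c \<and> (i = 1 \<or> \<not> up_step n (i - 1) c)"
    proof
      assume single: "colour_class n c i = {(i, Suc i)}"
      have "up_step n i c"
      proof (rule ccontr)
        assume "\<not> up_step n i c"
        then have "(i, Suc (Suc i)) \<in> colour_class n c i"
          using i by (auto simp: up_step_def colour_class_def tournament_edges_def)
        then show False using single by simp
      qed
      moreover have "\<not> up_step n (i - 1) c" if "i \<noteq> 1"
      proof
        assume "up_step n (i - 1) c"
        then have "c (i - 1) (Suc i) \<noteq> i - 1" using that i by (auto simp: up_step_def)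
        then have "c (i - 1) (Suc i) = i"
          using colouring_triangle[OF c, of "i - 1" i "Suc i"] colouring_Suc[OF c, of "i - 1"]
            colouring_Suc[OF c, of i] that i by auto
        then have "(i - 1, Suc i) \<in> colour_class n c i"
          using that i by (auto simp: colour_class_def tournament_edges_def)
        then have "i - 1 = i" unfolding single by simp
        then show False using i by auto
      qed
      ultimately show "up_step n i c \<and> (i = 1 \<or> \<not> up_step n (i - 1) c)" by blast
    next
      assume leaf: "up_step n i c \<and> (i = 1 \<or> \<not> up_step n (i - 1) c)"
      have "(j, k) = (i, Suc i)" if jk: "(j, k) \<in> colour_class n c i" for j k
      proof -
        have jk': "1 \<le> j" "j < k" "k \<le> n" "c j k = i" using jk by (auto simp: colour_class_def tournament_edges_def)
        have jik: "j \<le> i" "i < k" using colouring_bounds[OF c, of j k] jk' by auto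
        \<comment> \<open>Colour i passes from (j, k) to every smaller interval around i, since by
          \<open>colouring_bounds\<close> a piece that is cut off on the left has a colour below i
          and one on the right a colour above i.\<close>
        have inner: "c j' k' = i" if "j \<le> j'" "j' \<le> i" "i < k'" "k' \<le> k" for j' k'
        proof -
          have "c j' k = i"
          proof (cases "j = j'")
            case False
            then show ?thesis
              using colouring_triangle[OF c, of j j' k] colouring_bounds[OF c, of j j'] that jk' by auto
          qed (use jk' in simp)
          then show ?thesis
            using colouring_triangle[OF c, of j' k' k] colouring_bounds[OF c, of k' k] that jk'
            by (cases "k' = k") auto
        qed
        have "j = i"
        proof (rule ccontr)
          assume "j \<noteq> i"
          then have "c (i - 1) (Suc i) = i" "1 < i" using inner[of "i - 1" "Suc i"] jk' jik by auto
          then show False using leaf i by (auto simp: up_step_def)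
        qed
        moreover have "k = Suc i"
        proof (rule ccontr)
          assume "k \<noteq> Suc i"
          then have "c i (Suc (Suc i)) = i" "Suc i < n" using inner[of i "Suc (Suc i)"] jk' jik by auto
          then show False using leaf i by (auto simp: up_step_def)
        qed
        ultimately show ?thesis by simp
      qed
      then have "colour_class n c i \<subseteq> {(i, Suc i)}" by (intro subrelI) simp
      then show "colour_class n c i = {(i, Suc i)}" using self by blast
    qed
    finally show ?thesis .
  qed
  then show ?thesis unfolding Des_def by blast
qed

lemma card_transitive_partitions:
  assumes "1 \<le> n"
  shows "card {P \<in> transitive_partitions n (n - 1). Des n P \<subseteq> S} = ballot_count S (n - 1) 0 False"
proof -
  have "bij_betw (colour_classes n) {c \<in> {c. colouring n 1 c}. Des n (colour_classes n c) \<subseteq> S}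
     {P \<in> transitive_partitions n (n - 1). Des n P \<subseteq> S}"
  proof (rule bij_betw_subset[OF bij_betw_colour_classes])
    show "colour_classes n ` {c \<in> {c. colouring n 1 c}. Des n (colour_classes n c) \<subseteq> S} =
       {P \<in> transitive_partitions n (n - 1). Des n P \<subseteq> S}"
      unfolding bij_betw_imp_surj_on[OF bij_betw_colour_classes, symmetric] by blast
  qed blast
  then have "card {c \<in> {c. colouring n 1 c}. Des n (colour_classes n c) \<subseteq> S} =
      card {P \<in> transitive_partitions n (n - 1). Des n P \<subseteq> S}"
    by (rule bij_betw_same_card)
  moreover have "{c \<in> {c. colouring n 1 c}. Des n (colour_classes n c) \<subseteq> S} =
     {d. colouring n 1 d \<and> (\<forall>j\<in>{1..n - 1}. admissible n S j d)}"
    by (auto simp: Des_colour_classes admissible_def)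
  ultimately show ?thesis using card_colourings[OF assms] by simp
qed

lemma finite_transitive_partitions: "finite (transitive_partitions n (n - 1))"
  by (rule iffD1[OF bij_betw_finite[OF bij_betw_colour_classes] finite_colourings])

section \<open>Schur functions of two-row shapes\<close>

lemma card_submultisets_replicate:
  assumes x: "x \<notin># m"
  shows "card {A. A \<subseteq># m + replicate_mset r x \<and> P A} =
    (\<Sum>c\<le>r. card {A. A \<subseteq># m \<and> P (A + replicate_mset c x)})"
proof -
  let ?F = "\<lambda>c. (\<lambda>A. A + replicate_mset c x) ` {A. A \<subseteq># m \<and> P (A + replicate_mset c x)}"
  have count: "count A x = 0" if "A \<subseteq># m" for A
    using mset_subset_eq_count[OF that, of x] x by (simp add: not_in_iff)
  have "{A. A \<subseteq># m + replicate_mset r x \<and> P A} = (\<Union>c\<le>r. ?F c)"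
  proof (intro equalityI subsetI)
    fix A assume A: "A \<in> {A. A \<subseteq># m + replicate_mset r x \<and> P A}"
    define A' where "A' = filter_mset (\<lambda>y. y \<noteq> x) A"
    have dec: "A = A' + replicate_mset (count A x) x"
      by (simp add: A'_def multiset_eq_iff)
    have le: "count A y \<le> count (m + replicate_mset r x) y" for y
      using A by (intro mset_subset_eq_count) simp
    have "count A x \<le> r" using le[of x] x by (simp add: not_in_iff)
    moreover have "A' \<subseteq># m"
    proof (rule mset_subset_eqI)
      fix y show "count A' y \<le> count m y" using le[of y] by (cases "y = x") (simp_all add: A'_def)
    qed
    moreover have "P (A' + replicate_mset (count A x) x)" using A dec[symmetric] by simp
    ultimately show "A \<in> (\<Union>c\<le>r. ?F c)" using dec by blast
  next
    fix A assume "A \<in> (\<Union>c\<le>r. ?F c)"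
    then obtain c A' where A: "c \<le> r" "A' \<subseteq># m" "P (A' + replicate_mset c x)" "A = A' + replicate_mset c x"
      by auto
    have "replicate_mset c x \<subseteq># replicate_mset r x"
      using A(1) by (intro mset_subset_eqI) simp
    then show "A \<in> {A. A \<subseteq># m + replicate_mset r x \<and> P A}"
      using A by (auto intro: subset_mset.add_mono)
  qed
  also have "card \<dots> = (\<Sum>c\<le>r. card (?F c))"
  proof (rule card_UN_disjoint)
    show "\<forall>c\<in>{..r}. finite (?F c)"
      using finite_submultisets[of m] by simp
    have "?F c \<inter> ?F d = {}" if "c \<noteq> d" for c d
    proof (rule ccontr)
      assume "?F c \<inter> ?F d \<noteq> {}"
      then obtain A A' where A: "A \<subseteq># m" "A' \<subseteq># m" "A + replicate_mset c x = A' + replicate_mset d x" by blast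
      from A(3) have "count (A + replicate_mset c x) x = count (A' + replicate_mset d x) x" by simp
      then show False using count[OF A(1)] count[OF A(2)] that by simp
    qed
    then show "\<forall>c\<in>{..r}. \<forall>d\<in>{..r}. c \<noteq> d \<longrightarrow> ?F c \<inter> ?F d = {}" by blast
  qed simp
  also have "\<dots> = (\<Sum>c\<le>r. card {A. A \<subseteq># m \<and> P (A + replicate_mset c x)})"
    by (intro sum.cong refl card_image inj_onI) simp
  finally show ?thesis .
qed

text \<open>An integer index, with value 0 for negative sizes, keeps the reflection and the
  telescoping sums free of side conditions.\<close>

definition sub_count_int :: "'a multiset \<Rightarrow> int \<Rightarrow> int" where
  "sub_count_int m k = (if k < 0 then 0 else int (sub_count m (nat k)))"

lemma sub_count_int_sym: "sub_count_int m (int (size m) - k) = sub_count_int m k"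
proof -
  consider "k < 0" | "k > int (size m)" | "0 \<le> k" "k \<le> int (size m)" by linarith
  then show ?thesis
  proof cases
    case 3
    then have "nat (int (size m) - k) = size m - nat k" by linarith
    then show ?thesis using 3 sub_count_sym[of "nat k" m] by (simp add: sub_count_int_def nat_le_iff)
  qed (simp_all add: sub_count_int_def sub_count_above)
qed

lemma sub_count_int_replicate:
  assumes "x \<notin># m"
  shows "sub_count_int (m + replicate_mset r x) k = (\<Sum>c\<le>r. sub_count_int m (k - int c))"
proof (cases "k < 0")
  case False
  have "card {A. A \<subseteq># m \<and> size (A + replicate_mset c x) = nat k} = (if k < int c then 0 else sub_count m (nat (k - int c)))" for c
  proof (cases "k < int c")
    case True
    then have "{A. A \<subseteq># m \<and> size (A + replicate_mset c x) = nat k} = {}" using False by auto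
    then show ?thesis using True by (simp only: card.empty if_True)
  next
    case False
    then have "size (A + replicate_mset c x) = nat k \<longleftrightarrow> size A = nat (k - int c)" for A :: "'a multiset" by auto
    then show ?thesis using False by (simp add: sub_count_def)
  qed
  then show ?thesis using False
    by (simp add: sub_count_int_def sub_count_def[of "m + _"] card_submultisets_replicate[OF assms])
       (intro sum.cong; simp)
qed (simp add: sub_count_int_def)

text \<open>
  The possible contents of the second row of a two-row semistandard tableau with content \<open>m\<close>.
\<close>

definition lattice_sub :: "'a::linorder multiset \<Rightarrow> nat \<Rightarrow> 'a multiset set" where
  "lattice_sub m k = {A. A \<subseteq># m \<and> size A = k \<and>
     (\<forall>x. size (filter_mset (\<lambda>y. y \<le> x) A) \<le> size (filter_mset (\<lambda>y. y < x) (m - A)))}"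

text \<open>Copies of a new largest letter \<open>x\<close> do not touch the conditions at values
  below \<open>x\<close>. At \<open>x\<close> the condition says that the k entries of the second
  row fit under the entries of the first row smaller than \<open>x\<close>, which is the inequality
  k + size A <= size m. Beyond \<open>x\<close> it follows from the one at \<open>x\<close>, as the
  left side no longer grows.\<close>

lemma lattice_sub_replicate:
  assumes less: "\<And>y. y \<in># m \<Longrightarrow> y < x" and A: "A \<subseteq># m" "c \<le> r"
  shows "A + replicate_mset c x \<in> lattice_sub (m + replicate_mset r x) k \<longleftrightarrow>
    A \<in> lattice_sub m (k - c) \<and> c \<le> k \<and> k + size A \<le> size m"
proof -
  have x: "x \<notin># m" using less by blast
  have sub: "A + replicate_mset c x \<subseteq># m + replicate_mset r x"
    using A by (intro subset_mset.add_mono) (auto intro: mset_subset_eqI)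
  have lessA: "y < x" if "y \<in># A" for y using A(1) less that mset_subset_eqD by metis
  have lessB: "y < x" if "y \<in># m - A" for y using less that in_diffD by metis
  have diff: "m + replicate_mset r x - (A + replicate_mset c x) = (m - A) + replicate_mset (r - c) x"
    using A x lessA by (auto simp: multiset_eq_iff not_in_iff mset_subset_eq_count)
  have sizes: "size (m - A) = size m - size A" "size A \<le> size m"
    using A by (auto simp: size_Diff_submset size_mset_mono)
  have low: "filter_mset (\<lambda>z. z \<le> y) (replicate_mset p x) = {#}" "filter_mset (\<lambda>z. z < y) (replicate_mset p x) = {#}" if "y < x" for y p
    using that by (auto simp: filter_mset_eq_conv dest: in_replicate_mset[THEN iffD1])
  have eqx: "filter_mset (\<lambda>z. z \<le> x) (replicate_mset p x) = replicate_mset p x"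
     "filter_mset (\<lambda>z. z < x) (replicate_mset p x) = {#}" for p
    by (auto simp: filter_mset_eq_conv)
  have allA: "filter_mset (\<lambda>z. z \<le> y) A = A" if "x \<le> y" for y
  proof -
    have "filter_mset (\<lambda>z. z \<le> y) A = filter_mset (\<lambda>_. True) A"
      using that by (intro filter_mset_cong) (auto intro: less_imp_le less_le_trans lessA)
    then show ?thesis by simp
  qed
  have allB: "filter_mset (\<lambda>z. z < y) (m - A) = m - A" if "x \<le> y" for y
  proof -
    have "filter_mset (\<lambda>z. z < y) (m - A) = filter_mset (\<lambda>_. True) (m - A)"
      using that by (intro filter_mset_cong) (auto intro: less_le_trans lessB)
    then show ?thesis by simp
  qed
  let ?c = "\<lambda>y. size (filter_mset (\<lambda>z. z \<le> y) (A + replicate_mset c x)) \<le>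
    size (filter_mset (\<lambda>z. z < y) ((m - A) + replicate_mset (r - c) x))"
  let ?d = "\<lambda>y. size (filter_mset (\<lambda>z. z \<le> y) A) \<le> size (filter_mset (\<lambda>z. z < y) (m - A))"
  have below: "?c y \<longleftrightarrow> ?d y" if "y < x" for y
    unfolding filter_union_mset low[OF that] by simp
  have at: "?c x \<longleftrightarrow> size A + c \<le> size m - size A" using allA allB sizes by (simp add: eqx)
  have above: "?c y" if "x < y" "?c x" for y
  proof -
    have "size (filter_mset (\<lambda>z. z \<le> y) (A + replicate_mset c x)) \<le> size (A + replicate_mset c x)"
      by (rule size_filter_mset_lesseq)
    moreover have "filter_mset (\<lambda>z. z < y) (m - A + replicate_mset (r - c) x) = m - A + replicate_mset (r - c) x"
      using that allB[of y] by (auto simp: filter_mset_eq_conv)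
    ultimately show ?thesis using \<open>?c x\<close> sizes unfolding at by simp
  qed
  have above': "?d y" if "x \<le> y" "?c x" for y
    using that(2) unfolding at using allA[OF that(1)] allB[OF that(1)] sizes by simp
  have iff: "(\<forall>y. ?c y) \<longleftrightarrow> (\<forall>y. ?d y) \<and> ?c x"
  proof (intro iffI conjI allI)
    fix y assume *: "\<forall>y. ?c y"
    show "?c x" using * by blast
    show "?d y" using * below[of y] above'[of y] by (cases "y < x") auto
  next
    fix y assume *: "(\<forall>y. ?d y) \<and> ?c x"
    consider "y < x" | "y = x" | "x < y" using linorder_less_linear by blast
    then show "?c y" using * below[of y] above[of y] by cases auto
  qed
  define P where "P \<longleftrightarrow> (\<forall>y. ?c y)"
  define Q where "Q \<longleftrightarrow> (\<forall>y. ?d y)"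
  have "A + replicate_mset c x \<in> lattice_sub (m + replicate_mset r x) k \<longleftrightarrow> size A + c = k \<and> P"
    unfolding lattice_sub_def mem_Collect_eq diff P_def using sub by simp
  moreover have "A \<in> lattice_sub m (k - c) \<longleftrightarrow> size A = k - c \<and> Q"
    unfolding lattice_sub_def mem_Collect_eq Q_def using A by simp
  moreover have "P \<longleftrightarrow> Q \<and> size A + c \<le> size m - size A"
    unfolding P_def Q_def iff at ..
  ultimately show ?thesis using sizes by auto
qed

text \<open>This is the two-row Jacobi-Trudi formula. Removing the largest letter gives, by
  induction, a telescoping sum over the number of its copies in the second row. The upper end agrees
  with that of the telescoped right side, and the lower end is moved to k by the symmetry of
  \<open>sub_count_int\<close>.\<close>

lemma card_lattice_sub:
  fixes m :: "'a::linorder multiset"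
  assumes "2 * k \<le> size m"
  shows "int (card (lattice_sub m k)) = sub_count_int m (int k) - sub_count_int m (int k - 1)"
  using assms
proof (induction "size m" arbitrary: m k rule: less_induct)
  case less
  show ?case
  proof (cases "m = {#}")
    case True
    have "lattice_sub {#} 0 = {{#} :: 'a multiset}" by (auto simp: lattice_sub_def)
    then show ?thesis using less.prems True by (simp add: sub_count_int_def)
  next
    case False
    define x where "x = Max (set_mset m)"
    define r where "r = count m x"
    define m' where "m' = filter_mset (\<lambda>y. y \<noteq> x) m"
    have "x \<in># m" using False by (simp add: x_def)
    have m: "m = m' + replicate_mset r x" by (auto simp: m'_def r_def multiset_eq_iff)
    have ltx: "y < x" if "y \<in># m'" for y
    proof -
      have "y \<le> x" using that unfolding x_def m'_def by (intro Max_ge) auto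
      then show ?thesis using that by (auto simp: m'_def)
    qed
    then have x: "x \<notin># m'" by blast
    have "r > 0" using \<open>x \<in># m\<close> by (simp add: r_def)
    define N where "N = size m'"
    have size: "size m = N + r" unfolding N_def by (subst m) simp
    \<comment> \<open>The inequality k + (k - c) <= N coming from
      \<open>lattice_sub_replicate\<close> bounds c from below; truncated subtraction gives 0 when
      the bound is void.\<close>
    define c0 where "c0 = 2 * k - N"
    have c0: "c0 \<le> r" using less.prems size by (simp add: c0_def)
    define S where "S = sub_count_int m'"
    have part: "int (card {A. A \<subseteq># m' \<and> A + replicate_mset c x \<in> lattice_sub m k}) =
        (if c0 \<le> c then S (int k - int c) - S (int k - int c - 1) else 0)" if "c \<le> r" for c
    proof -
      have *: "{A. A \<subseteq># m' \<and> A + replicate_mset c x \<in> lattice_sub m k} =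
          {A. A \<in> lattice_sub m' (k - c) \<and> c \<le> k \<and> k + (k - c) \<le> N}"
      proof (intro Collect_cong)
        fix A
        have "A + replicate_mset c x \<in> lattice_sub m k \<longleftrightarrow>
            A \<in> lattice_sub m' (k - c) \<and> c \<le> k \<and> k + size A \<le> N" if "A \<subseteq># m'"
          using lattice_sub_replicate[OF ltx that \<open>c \<le> r\<close>, of k] unfolding m[symmetric] N_def .
        moreover have "A \<subseteq># m' \<and> size A = k - c" if "A \<in> lattice_sub m' (k - c)"
          using that by (simp add: lattice_sub_def)
        ultimately show "A \<subseteq># m' \<and> A + replicate_mset c x \<in> lattice_sub m k \<longleftrightarrow>
            A \<in> lattice_sub m' (k - c) \<and> c \<le> k \<and> k + (k - c) \<le> N"
          by auto
      qed
      show ?thesis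
      proof (cases "c0 \<le> c \<and> c \<le> k")
        case True
        then have "k + (k - c) \<le> N" "2 * (k - c) \<le> N" by (auto simp: c0_def)
        then have "int (card {A. A \<subseteq># m' \<and> A + replicate_mset c x \<in> lattice_sub m k}) =
            int (card (lattice_sub m' (k - c)))" using True by (simp add: *)
        also have "\<dots> = S (int (k - c)) - S (int (k - c) - 1)"
          unfolding S_def using \<open>2 * (k - c) \<le> N\<close> size \<open>r > 0\<close> by (intro less.hyps) (simp_all add: N_def)
        finally show ?thesis using True by (simp add: of_nat_diff)
      next
        case False
        then have "\<not> (c \<le> k \<and> k + (k - c) \<le> N)" by (auto simp: c0_def)
        then have "{A. A \<in> lattice_sub m' (k - c) \<and> c \<le> k \<and> k + (k - c) \<le> N} = {}" by blast
        then have "int (card {A. A \<subseteq># m' \<and> A + replicate_mset c x \<in> lattice_sub m k}) = 0"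
          unfolding * by (simp only: card.empty of_nat_0)
        moreover have "(if c0 \<le> c then S (int k - int c) - S (int k - int c - 1) else 0) = 0"
          using False by (auto simp: S_def sub_count_int_def)
        ultimately show ?thesis by simp
      qed
    qed
    have "int (card (lattice_sub m k)) = int (card {A. A \<subseteq># m' + replicate_mset r x \<and> A \<in> lattice_sub m k})"
    proof -
      have "lattice_sub m k = {A. A \<subseteq># m' + replicate_mset r x \<and> A \<in> lattice_sub m k}"
        unfolding m[symmetric] by (auto simp: lattice_sub_def)
      then show ?thesis by simp
    qed
    also have "\<dots> = (\<Sum>c\<le>r. if c0 \<le> c then S (int k - int c) - S (int k - int c - 1) else 0)"
      unfolding card_submultisets_replicate[OF x] by (simp add: part)
    also have "\<dots> = (\<Sum>c=c0..r. S (int k - int c) - S (int k - int (Suc c)))"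
      by (rule sum.mono_neutral_cong_right) (auto simp: algebra_simps)
    also have "\<dots> = S (int k - int c0) - S (int k - int (Suc r))"
    proof -
      have "(\<Sum>c=c0..<Suc r. - S (int k - int (Suc c)) - - S (int k - int c)) = - S (int k - int (Suc r)) - - S (int k - int c0)"
        by (rule sum_Suc_diff') (use c0 in simp)
      then show ?thesis by (simp add: atLeastLessThanSuc_atLeastAtMost)
    qed
    \<comment> \<open>For c0 > 0 the lower end is N - k, the mirror image of k.\<close>
    also have "S (int k - int c0) = S (int k)"
    proof (cases "c0 = 0")
      case False
      then have "int k - int c0 = int N - int k" unfolding c0_def by simp
      show ?thesis
        unfolding S_def \<open>int k - int c0 = int N - int k\<close> N_def by (rule sub_count_int_sym)
    qed simp
    finally have lhs: "int (card (lattice_sub m k)) = S (int k) - S (int k - int (Suc r))" .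
    have "sub_count_int m (int k) - sub_count_int m (int k - 1) =
        (\<Sum>c=0..<Suc r. - S (int k - int (Suc c)) - - S (int k - int c))"
      unfolding m sub_count_int_replicate[OF x] sum_subtractf[symmetric] S_def
      by (intro sum.cong) (auto simp: algebra_simps)
    also have "\<dots> = - S (int k - int (Suc r)) - - S (int k - int 0)"
      by (rule sum_Suc_diff') simp
    finally show ?thesis using lhs by simp
  qed
qed


section \<open>From ballot sub-multisets to semistandard tableaux\<close>

lemma length_filter_index: "size (filter_mset P (mset xs)) = card {i. i < length xs \<and> P (xs ! i)}"
  by (metis length_filter_conv_card mset_filter size_mset)

text \<open>From left to right, the index set for \<open>v\<close> is contained in the one for
  \<open>u\<close>. For the converse the value to test is x = \<open>v ! c\<close>: if
  \<open>u ! c\<close> is not smaller, at most c entries of \<open>u\<close> are below x, while at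
  least c + 1 entries of \<open>v\<close> are at most x.\<close>

lemma columns_increasing_iff:
  fixes u v :: "'a::linorder list"
  assumes "sorted u" "sorted v" "length v \<le> length u"
  shows "(\<forall>c<length v. u ! c < v ! c) \<longleftrightarrow>
    (\<forall>x. size (filter_mset (\<lambda>y. y \<le> x) (mset v)) \<le> size (filter_mset (\<lambda>y. y < x) (mset u)))"
  unfolding length_filter_index
proof (intro iffI allI impI)
  fix x assume *: "\<forall>c<length v. u ! c < v ! c"
  show "card {i. i < length v \<and> v ! i \<le> x} \<le> card {i. i < length u \<and> u ! i < x}"
    by (rule card_mono) (use * assms(3) in force)+
next
  fix c assume le: "\<forall>x. card {i. i < length v \<and> v ! i \<le> x} \<le> card {i. i < length u \<and> u ! i < x}"
    and c: "c < length v"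
  show "u ! c < v ! c"
  proof (rule ccontr)
    assume nless: "\<not> u ! c < v ! c"
    have "{i. i < length u \<and> u ! i < v ! c} \<subseteq> {..<c}"
    proof
      fix i assume i: "i \<in> {i. i < length u \<and> u ! i < v ! c}"
      show "i \<in> {..<c}"
      proof (rule ccontr)
        assume "i \<notin> {..<c}"
        then have "u ! c \<le> u ! i" using i assms(1) by (intro sorted_nth_mono) auto
        then show False using i nless by auto
      qed
    qed
    then have "card {i. i < length u \<and> u ! i < v ! c} \<le> card {..<c}" by (intro card_mono) auto
    moreover have "{..c} \<subseteq> {i. i < length v \<and> v ! i \<le> v ! c}"
      using c assms(2) by (auto intro: sorted_nth_mono)
    then have "card {..c} \<le> card {i. i < length v \<and> v ! i \<le> v ! c}" by (intro card_mono) auto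
    ultimately show False using le[rule_format, of "v ! c"] by simp
  qed
qed

lemma diagram_two_rows: "(r, c) \<in> diagram [a, b] \<longleftrightarrow> (r = 0 \<and> c < a) \<or> (r = 1 \<and> c < b)"
  by (auto simp: diagram_def less_Suc_eq)

definition tableau_row :: "(nat \<times> nat \<Rightarrow> nat) \<Rightarrow> nat \<Rightarrow> nat \<Rightarrow> nat list" where
  "tableau_row T r k = map (\<lambda>c. T (r, c)) [0..<k]"

lemma content_two_rows:
  "image_mset T (mset_set (diagram [a, b])) = mset (tableau_row T 0 a) + mset (tableau_row T 1 b)"
proof -
  have d: "diagram [a, b] = Pair 0 ` {..<a} \<union> Pair 1 ` {..<b}"
    by (auto simp: diagram_two_rows)
  have row: "image_mset T (mset_set (Pair r ` {..<k})) = mset (tableau_row T r k)" for r k :: nat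
    by (simp add: tableau_row_def image_mset_mset_set[symmetric] inj_on_def multiset.map_comp o_def
        mset_map[symmetric] atLeast0LessThan[symmetric] del: mset_map)
       (simp add: mset_map atLeast0LessThan)
  have "mset_set (diagram [a, b]) = mset_set (Pair 0 ` {..<a}) + mset_set (Pair 1 ` {..<b})"
    unfolding d by (rule mset_set_Union) auto
  then show ?thesis by (simp add: row)
qed

lemma ssyt_two_rows:
  assumes "b \<le> a"
  shows "T \<in> ssyt [a, b] \<longleftrightarrow> T \<in> diagram [a, b] \<rightarrow>\<^sub>E UNIV \<and> sorted (tableau_row T 0 a) \<and> sorted (tableau_row T 1 b) \<and>
    (\<forall>c<b. T (0, c) < T (1, c))"
proof -
  have sorted_row: "sorted (tableau_row T r k) \<longleftrightarrow> (\<forall>c d. c < d \<and> d < k \<longrightarrow> T (r, c) \<le> T (r, d))" for r k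
    by (auto simp: tableau_row_def sorted_iff_nth_mono_less)
  have "(\<forall>r c d. c < d \<and> (r, c) \<in> diagram [a, b] \<and> (r, d) \<in> diagram [a, b] \<longrightarrow> T (r, c) \<le> T (r, d)) \<longleftrightarrow>
      sorted (tableau_row T 0 a) \<and> sorted (tableau_row T 1 b)"
    unfolding sorted_row diagram_two_rows by (auto dest: less_trans)
  moreover have "(\<forall>r s c. r < s \<and> (r, c) \<in> diagram [a, b] \<and> (s, c) \<in> diagram [a, b] \<longrightarrow> T (r, c) < T (s, c)) \<longleftrightarrow>
      (\<forall>c<b. T (0, c) < T (1, c))"
    unfolding diagram_two_rows using assms by auto
  ultimately show ?thesis by (auto simp: ssyt_def)
qed

lemma schur_two_rows:
  assumes "b \<le> a"
  shows "schur [a, b] m = (if size m = a + b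
    then of_int (sub_count_int m (int b) - sub_count_int m (int b - 1)) else 0)"
proof (cases "size m = a + b")
  case False
  have "size (image_mset T (mset_set (diagram [a, b]))) = a + b" for T :: "nat \<times> nat \<Rightarrow> nat"
    unfolding content_two_rows by (simp add: tableau_row_def)
  then have "{T \<in> ssyt [a, b]. image_mset T (mset_set (diagram [a, b])) = m} = {}" using False by auto
  then show ?thesis using False unfolding schur_def by (simp only: card.empty of_nat_0 if_False)
next
  case True
  let ?X = "{T \<in> ssyt [a, b]. image_mset T (mset_set (diagram [a, b])) = m}"
  let ?f = "\<lambda>T. mset (tableau_row T 1 b)"
  \<comment> \<open>The rows are sorted, so a tableau is recovered from the content of its second
    row. The value \<open>undefined\<close> off the diagram is dictated by the extensional function
    space in \<open>ssyt\<close>.\<close>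
  let ?g = "\<lambda>A (r, c). if r = 0 \<and> c < a then sorted_list_of_multiset (m - A) ! c
     else if r = 1 \<and> c < b then sorted_list_of_multiset A ! c else undefined"
  have row_f: "tableau_row T 1 b = sorted_list_of_multiset (?f T)"
    "tableau_row T 0 a = sorted_list_of_multiset (m - ?f T)" "?f T \<in> lattice_sub m b" if T: "T \<in> ?X" for T
  proof -
    have srt: "sorted (tableau_row T 0 a)" "sorted (tableau_row T 1 b)" and cols: "\<forall>c<b. T (0, c) < T (1, c)"
      and m: "m = mset (tableau_row T 0 a) + mset (tableau_row T 1 b)"
      using T by (auto simp: ssyt_two_rows[OF assms] content_two_rows)
    show "tableau_row T 1 b = sorted_list_of_multiset (?f T)"
      using srt by (simp add: sorted_sort_id)
    show "tableau_row T 0 a = sorted_list_of_multiset (m - ?f T)"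
      using srt by (simp add: m sorted_sort_id)
    have "\<forall>c<length (tableau_row T 1 b). tableau_row T 0 a ! c < tableau_row T 1 b ! c"
      using cols assms by (simp add: tableau_row_def)
    then show "?f T \<in> lattice_sub m b"
      using columns_increasing_iff[OF srt] assms by (simp add: lattice_sub_def m) (simp add: tableau_row_def)
  qed
  have row_g: "tableau_row (?g A) 1 b = sorted_list_of_multiset A"
     "tableau_row (?g A) 0 a = sorted_list_of_multiset (m - A)" "?g A \<in> ?X" if A: "A \<in> lattice_sub m b" for A
  proof -
    let ?u = "sorted_list_of_multiset (m - A)" and ?v = "sorted_list_of_multiset A"
    have sub: "A \<subseteq># m" and len: "length ?v = b" "length ?u = a"
      using A True by (auto simp: lattice_sub_def size_Diff_submset simp flip: size_mset)
    show r1: "tableau_row (?g A) 1 b = ?v" by (rule nth_equalityI) (simp_all add: tableau_row_def len)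
    show r0: "tableau_row (?g A) 0 a = ?u" by (rule nth_equalityI) (simp_all add: tableau_row_def len)
    have "\<forall>c<b. ?u ! c < ?v ! c"
      using columns_increasing_iff[of ?u ?v] A assms by (simp add: len lattice_sub_def)
    then have "?g A \<in> ssyt [a, b]"
      unfolding ssyt_two_rows[OF assms] r0 r1 using assms by (auto simp: PiE_iff extensional_def diagram_two_rows)
    then show "?g A \<in> ?X" using sub unfolding mem_Collect_eq content_two_rows r0 r1 by simp
  qed
  have "bij_betw ?f ?X (lattice_sub m b)"
  proof (rule bij_betw_byWitness[where f' = ?g])
    show "\<forall>T\<in>?X. ?g (?f T) = T"
    proof (intro ballI ext)
      fix T and e :: "nat \<times> nat" assume T: "T \<in> ?X"
      obtain r c where e: "e = (r, c)" by fastforce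
      have undef: "T (r, c) = undefined" if "(r, c) \<notin> diagram [a, b]"
        using T that by (auto simp: ssyt_def PiE_iff extensional_def)
      show "?g (?f T) e = T e"
        using undef unfolding e prod.case row_f(1,2)[OF T, symmetric] diagram_two_rows by (auto simp: tableau_row_def)
    qed
    show "\<forall>A\<in>lattice_sub m b. ?f (?g A) = A" using row_g(1) by simp
  qed (use row_f(3) row_g(3) in auto)
  then have "card ?X = card (lattice_sub m b)" by (rule bij_betw_same_card)
  moreover have "2 * b \<le> size m" using True assms by simp
  ultimately show ?thesis using True unfolding schur_def by (simp flip: card_lattice_sub)
qed

section \<open>Traces\<close>

lemma sum_fun_apply: "(\<Sum>i\<in>A. f i) x = (\<Sum>i\<in>A. f i x)"
  for f :: "'i \<Rightarrow> 'a \<Rightarrow> complex"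
  by (induction A rule: infinite_finite_induct) (simp_all add: zero_fun_def)

text \<open>\<open>trace_on\<close> chooses its basis, so a trace computed in a known basis has to
  be compared with it. Expanding the elements of each basis in the other and exchanging the sums is
  the identity tr(PQ) = tr(QP).\<close>

lemma trace_basis_independent:
  fixes L :: "('a \<Rightarrow> complex) \<Rightarrow> ('a \<Rightarrow> complex)"
  assumes B: "finite B" "cfun.independent B" and C: "finite C" "cfun.independent C"
    and eq: "cfun.span B = cfun.span C"
    and add: "\<And>f g. L (f + g) = L f + L g" and scale: "\<And>a f. L (scale_fun a f) = scale_fun a (L f)"
    and into: "\<And>f. f \<in> cfun.span B \<Longrightarrow> L f \<in> cfun.span B"
  shows "(\<Sum>b\<in>B. cfun.representation B (L b) b) = (\<Sum>c\<in>C. cfun.representation C (L c) c)"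
proof -
  have L0: "L 0 = 0" using scale[of 0 0] by simp
  have L_sum: "L (\<Sum>i\<in>I. scale_fun (r i) (f i)) = (\<Sum>i\<in>I. scale_fun (r i) (L (f i)))"
    for r and f :: "'i \<Rightarrow> 'a \<Rightarrow> complex" and I
    by (induction I rule: infinite_finite_induct) (simp_all only: L0 add scale sum.infinite sum.empty sum.insert simp_thms)
  have expand: "v = (\<Sum>b\<in>D. scale_fun (cfun.representation D v b) b)"
    if "finite D" "cfun.independent D" "v \<in> cfun.span D" for D and v :: "'a \<Rightarrow> complex"
    using cfun.sum_representation_eq[OF that(2,3,1) subset_refl] by simp
  have rep_sum: "cfun.representation D (\<Sum>i\<in>I. scale_fun (r i) (f i)) b = (\<Sum>i\<in>I. r i * cfun.representation D (f i) b)"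
    if "cfun.independent D" "\<And>i. i \<in> I \<Longrightarrow> f i \<in> cfun.span D" for D I r b and f :: "'i \<Rightarrow> 'a \<Rightarrow> complex"
  proof -
    have "cfun.representation D (\<Sum>i\<in>I. scale_fun (r i) (f i)) = (\<lambda>b. \<Sum>i\<in>I. cfun.representation D (scale_fun (r i) (f i)) b)"
      using that by (intro cfun.representation_sum) (auto intro: cfun.span_scale)
    then show ?thesis using that by (simp add: cfun.representation_scale)
  qed
  have inB: "b \<in> cfun.span C" if "b \<in> B" for b using that cfun.span_base eq by blast
  have inC: "c \<in> cfun.span B" if "c \<in> C" for c using that cfun.span_base eq by blast
  have "(\<Sum>b\<in>B. cfun.representation B (L b) b) =
      (\<Sum>b\<in>B. \<Sum>c\<in>C. cfun.representation C b c * cfun.representation B (L c) b)"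
  proof (rule sum.cong[OF refl])
    fix b assume b: "b \<in> B"
    have "L b = (\<Sum>c\<in>C. scale_fun (cfun.representation C b c) (L c))"
      by (subst expand[OF C inB[OF b]]) (rule L_sum)
    then show "cfun.representation B (L b) b = (\<Sum>c\<in>C. cfun.representation C b c * cfun.representation B (L c) b)"
      using rep_sum[OF B(2), of C L] into inC by simp
  qed
  also have "\<dots> = (\<Sum>c\<in>C. \<Sum>b\<in>B. cfun.representation B (L c) b * cfun.representation C b c)"
    by (subst sum.swap) (simp add: mult.commute)
  also have "\<dots> = (\<Sum>c\<in>C. cfun.representation C (L c) c)"
  proof (rule sum.cong[OF refl])
    fix c assume c: "c \<in> C"
    have "(\<Sum>b\<in>B. cfun.representation B (L c) b * cfun.representation C b c) =
        cfun.representation C (\<Sum>b\<in>B. scale_fun (cfun.representation B (L c) b) b) c"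
      using rep_sum[OF C(2), of B "\<lambda>b. b"] inB by simp
    also have "\<dots> = cfun.representation C (L c) c"
      using expand[OF B into[OF inC[OF c]]] by simp
    finally show "(\<Sum>b\<in>B. cfun.representation B (L c) b * cfun.representation C b c) = cfun.representation C (L c) c" .
  qed
  finally show ?thesis .
qed

lemma independent_union:
  fixes B C :: "('a \<Rightarrow> complex) set"
  assumes "cfun.independent B" "cfun.independent C" "finite B" "finite C"
    and disj: "cfun.span B \<inter> cfun.span C = {0}"
  shows "cfun.independent (B \<union> C)" "B \<inter> C = {}"
proof -
  show BC: "B \<inter> C = {}"
  proof (rule ccontr)
    assume "B \<inter> C \<noteq> {}"
    then obtain v where "v \<in> B" "v \<in> C" by blast
    then have "v = 0" using disj cfun.span_base by blast
    then show False using \<open>v \<in> B\<close> assms(1) cfun.dependent_zero by blast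
  qed
  show "cfun.independent (B \<union> C)"
    unfolding cfun.independent_explicit_module
  proof (intro allI impI)
    fix D r v
    assume D: "finite D" "D \<subseteq> B \<union> C" "(\<Sum>v\<in>D. scale_fun (r v) v) = 0" "v \<in> D"
    let ?b = "\<Sum>v\<in>D \<inter> B. scale_fun (r v) v" and ?c = "\<Sum>v\<in>D \<inter> C. scale_fun (r v) v"
    have split: "(D \<inter> B) \<union> (D \<inter> C) = D" using D(2) by blast
    have "(\<Sum>v\<in>(D \<inter> B) \<union> (D \<inter> C). scale_fun (r v) v) = ?b + ?c"
      using D(1) BC by (intro sum.union_disjoint) auto
    then have "?b + ?c = 0" unfolding split using D(3) by (rule trans[OF sym])
    then have "?b = - ?c" by (simp only: eq_neg_iff_add_eq_0)
    moreover have "?b \<in> cfun.span B" by (intro cfun.span_sum cfun.span_scale cfun.span_base) blast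
    moreover have "?c \<in> cfun.span C" by (intro cfun.span_sum cfun.span_scale cfun.span_base) blast
    ultimately have "?b \<in> cfun.span B \<inter> cfun.span C" using cfun.span_neg[of ?c C] by (metis IntI)
    then have "?b = 0" unfolding disj by (rule singletonD)
    then have "?c = 0" using \<open>?b = - ?c\<close> by (metis neg_0_equal_iff_equal)
    from D(2,4) consider "v \<in> D \<inter> B" | "v \<in> D \<inter> C" by blast
    then show "r v = 0"
    proof cases
      case 1
      then show ?thesis
        using assms(1)[unfolded cfun.independent_explicit_module, rule_format, of "D \<inter> B" r v] D(1) \<open>?b = 0\<close> by blast
    next
      case 2
      then show ?thesis
        using assms(2)[unfolded cfun.independent_explicit_module, rule_format, of "D \<inter> C" r v] D(1) \<open>?c = 0\<close> by blast
    qed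
  qed
qed

text \<open>The trace on \<open>S\<close> is obtained from bases of the whole space and of an
  invariant complement, both of which the group will permute. \<open>S\<close> itself enters through
  the basis chosen by \<open>trace_on\<close>.\<close>

lemma trace_complement:
  fixes L :: "('a \<Rightarrow> complex) \<Rightarrow> ('a \<Rightarrow> complex)"
  assumes D: "finite D" "cfun.independent D" and C: "finite C" "cfun.independent C"
    and S: "cfun.subspace S" and disj: "S \<inter> cfun.span C = {0}"
    and sub: "S \<subseteq> cfun.span D" "C \<subseteq> cfun.span D" and all: "D \<subseteq> cfun.span (S \<union> C)"
    and add: "\<And>f g. L (f + g) = L f + L g" and scale: "\<And>a f. L (scale_fun a f) = scale_fun a (L f)"
    and into: "\<And>f. f \<in> S \<Longrightarrow> L f \<in> S" "\<And>c. c \<in> C \<Longrightarrow> L c \<in> cfun.span C" "\<And>d. d \<in> D \<Longrightarrow> L d \<in> cfun.span D"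
  shows "trace_on S L = (\<Sum>d\<in>D. cfun.representation D (L d) d) - (\<Sum>c\<in>C. cfun.representation C (L c) c)"
proof -
  define B where "B = (SOME B. cfun.independent B \<and> cfun.span B = S)"
  have "\<exists>B. cfun.independent B \<and> cfun.span B = S"
    using cfun.basis_exists[of S] S by (metis cfun.span_minimal cfun.span_eq_iff cfun.span_mono subset_antisym)
  then have "cfun.independent B \<and> cfun.span B = S" unfolding B_def by (rule someI_ex)
  then have B: "cfun.independent B" "cfun.span B = S" by auto
  have finB: "finite B"
    using cfun.independent_span_bound[OF D(1) B(1)] B(2) sub(1) cfun.span_superset by blast
  have disj': "cfun.span B \<inter> cfun.span C = {0}" using disj B(2) by simp
  note BC = independent_union[OF B(1) C(2) finB C(1) disj']
  have spanBC: "cfun.span (B \<union> C) = cfun.span D"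
  proof
    show "cfun.span (B \<union> C) \<subseteq> cfun.span D"
      using sub B(2) cfun.span_superset[of B] by (intro cfun.span_minimal) auto
    have "S \<union> C \<subseteq> cfun.span (B \<union> C)"
      using B(2) cfun.span_mono[of B "B \<union> C"] cfun.span_superset[of "B \<union> C"] by blast
    then have "cfun.span (S \<union> C) \<subseteq> cfun.span (B \<union> C)" by (rule cfun.span_minimal) simp
    then show "cfun.span D \<subseteq> cfun.span (B \<union> C)" using all by (intro cfun.span_minimal) auto
  qed
  have intoD: "L f \<in> cfun.span D" if "f \<in> cfun.span D" for f
    using that
  proof (induction f rule: cfun.span_induct_alt)
    case base
    have "L 0 = 0" using scale[of 0 0] by simp
    then show ?case by (simp only: cfun.span_zero)
  next
    case (step c x y)
    then have "L x \<in> cfun.span D" using into by blast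
    then show ?case unfolding add scale using step by (intro cfun.span_add cfun.span_scale)
  qed
  have "(\<Sum>d\<in>D. cfun.representation D (L d) d) = (\<Sum>b\<in>B \<union> C. cfun.representation (B \<union> C) (L b) b)"
    using D finB C(1) BC(1) spanBC add scale intoD by (intro trace_basis_independent) auto
  also have "\<dots> = (\<Sum>b\<in>B. cfun.representation (B \<union> C) (L b) b) + (\<Sum>b\<in>C. cfun.representation (B \<union> C) (L b) b)"
    using finB C(1) BC(2) by (rule sum.union_disjoint)
  also have "(\<Sum>b\<in>B. cfun.representation (B \<union> C) (L b) b) = (\<Sum>b\<in>B. cfun.representation B (L b) b)"
  proof (rule sum.cong[OF refl])
    fix b assume "b \<in> B"
    then have "L b \<in> cfun.span B" using into(1) B(2) cfun.span_base by blast
    then show "cfun.representation (B \<union> C) (L b) b = cfun.representation B (L b) b"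
      using cfun.representation_extend[OF BC(1), of "L b" B] by simp
  qed
  also have "(\<Sum>b\<in>C. cfun.representation (B \<union> C) (L b) b) = (\<Sum>b\<in>C. cfun.representation C (L b) b)"
    using cfun.representation_extend[OF BC(1), of _ C] into(2) by (intro sum.cong) auto
  also have "(\<Sum>b\<in>B. cfun.representation B (L b) b) = trace_on S L"
    unfolding trace_on_def B_def[symmetric] by simp
  finally show ?thesis by simp
qed

lemma representation_permuted_basis:
  fixes e :: "'i \<Rightarrow> 'a \<Rightarrow> complex"
  assumes "cfun.independent (e ` I)" "inj_on e I" "finite I"
    and "\<And>i. i \<in> I \<Longrightarrow> p i \<in> I \<and> L (e i) = e (p i)"
  shows "(\<Sum>b\<in>e ` I. cfun.representation (e ` I) (L b) b) = of_nat (card {i \<in> I. p i = i})"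
proof -
  have "(\<Sum>b\<in>e ` I. cfun.representation (e ` I) (L b) b) = (\<Sum>i\<in>I. cfun.representation (e ` I) (e (p i)) (e i))"
    using assms by (simp add: sum.reindex)
  also have "\<dots> = (\<Sum>i\<in>I. if p i = i then 1 else 0)"
  proof (rule sum.cong[OF refl])
    fix i assume i: "i \<in> I"
    then have "cfun.representation (e ` I) (e (p i)) = (\<lambda>v. if v = e (p i) then 1 else 0)"
      using assms by (intro cfun.representation_basis) auto
    moreover have "e i = e (p i) \<longleftrightarrow> p i = i"
      using assms(2,4) i by (metis inj_onD)
    ultimately show "cfun.representation (e ` I) (e (p i)) (e i) = (if p i = i then 1 else 0)" by simp
  qed
  also have "\<dots> = of_nat (card {i \<in> I. p i = i})"
    using assms(3) by (simp add: sum.If_cases Int_def)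
  finally show ?thesis .
qed

section \<open>Specht modules of two-row shapes\<close>

definition ksubsets :: "nat \<Rightarrow> nat \<Rightarrow> nat set set" where
  "ksubsets N k = {X. X \<subseteq> {1..N} \<and> card X = k}"

lemma finite_ksubsets [simp]: "finite (ksubsets N k)"
  by (rule finite_subset[of _ "Pow {1..N}"]) (auto simp: ksubsets_def)

lemma ksubsetsD: "X \<in> ksubsets N k \<Longrightarrow> X \<subseteq> {1..N} \<and> card X = k \<and> finite X"
  by (auto simp: ksubsets_def intro: finite_subset)

lemma ksubsets_image: "w permutes {1..N} \<Longrightarrow> X \<in> ksubsets N k \<Longrightarrow> w ` X \<in> ksubsets N k"
  using permutes_image[of w "{1..N}"] by (auto simp: ksubsets_def card_image permutes_inj_on)

definition fixed_subsets :: "nat \<Rightarrow> nat \<Rightarrow> (nat \<Rightarrow> nat) \<Rightarrow> nat" where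
  "fixed_subsets N k w = card {X \<in> ksubsets N k. w ` X = X}"

text \<open>The added element lies outside the union of \<open>Y\<close> and \<open>Z\<close>, or in
  \<open>Z - Y\<close> and then raises the intersection. If the intersection has i elements, the
  union has 2m - i.\<close>

lemma card_insert_meets:
  assumes Y: "Y \<in> ksubsets N m" and Z: "Z \<in> ksubsets N m" and "2 * m \<le> N"
  shows "card {x \<in> {1..N} - Y. card (insert x Y \<inter> Z) = j} =
    (if card (Y \<inter> Z) = j then N - 2 * m + j else if Suc (card (Y \<inter> Z)) = j then m - card (Y \<inter> Z) else 0)"
proof -
  note Y' = ksubsetsD[OF Y] and Z' = ksubsetsD[OF Z]
  define i where "i = card (Y \<inter> Z)"
  have c: "card (insert x Y \<inter> Z) = (if x \<in> Z then Suc i else i)" if "x \<notin> Y" for x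
    using that Y' by (auto simp: i_def Int_insert_left)
  have un: "card (Y \<union> Z) + i = 2 * m" using card_Un_Int[of Y Z] Y' Z' by (simp add: i_def)
  have le: "i \<le> m" unfolding i_def using Y' by (metis card_mono inf_le1)
  have set: "{x \<in> {1..N} - Y. card (insert x Y \<inter> Z) = j} = {x \<in> {1..N} - Y. (if x \<in> Z then Suc i else i) = j}"
  proof (rule Collect_cong, rule conj_cong[OF refl])
    fix x assume "x \<in> {1..N} - Y"
    then have "x \<notin> Y" by blast
    show "(card (insert x Y \<inter> Z) = j) = ((if x \<in> Z then Suc i else i) = j)"
      unfolding c[OF \<open>x \<notin> Y\<close>] ..
  qed
  consider "i = j" | "Suc i = j" | "i \<noteq> j" "Suc i \<noteq> j" by blast
  then show ?thesis
    unfolding i_def[symmetric] set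
  proof cases
    case 1
    then have "{x \<in> {1..N} - Y. (if x \<in> Z then Suc i else i) = j} = {1..N} - (Y \<union> Z)" by auto
    moreover have "card ({1..N} - (Y \<union> Z)) = N - card (Y \<union> Z)"
      using Y' Z' by (subst card_Diff_subset) auto
    ultimately show "card {x \<in> {1..N} - Y. (if x \<in> Z then Suc i else i) = j} =
        (if i = j then N - 2 * m + j else if Suc i = j then m - i else 0)"
      using 1 un le \<open>2 * m \<le> N\<close> by simp
  next
    case 2
    then have "{x \<in> {1..N} - Y. (if x \<in> Z then Suc i else i) = j} = Z - Y \<inter> Z" using Z' by auto
    moreover have "card (Z - Y \<inter> Z) = m - i" using Y' Z' by (subst card_Diff_subset) (auto simp: i_def)
    ultimately show "card {x \<in> {1..N} - Y. (if x \<in> Z then Suc i else i) = j} =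
        (if i = j then N - 2 * m + j else if Suc i = j then m - i else 0)"
      using 2 by auto
  qed auto
qed

text \<open>Group the values of \<open>h\<close> by the size of the intersection with the fixed set
  \<open>Z\<close>, and add up the hypothesis over all X that meet \<open>Z\<close> in j elements.
  In the resulting recursion the leading factor N - 2m + j is positive, so all group sums vanish;
  the group j = m consists of \<open>Z\<close> alone.\<close>

lemma up_injective:
  fixes h :: "nat set \<Rightarrow> complex"
  assumes "2 * Suc m \<le> N"
    and zero: "\<And>X. X \<in> ksubsets N (Suc m) \<Longrightarrow> (\<Sum>x\<in>X. h (X - {x})) = 0"
    and Z: "Z \<in> ksubsets N m"
  shows "h Z = 0"
proof -
  define H where "H j = (\<Sum>Y | Y \<in> ksubsets N m \<and> card (Y \<inter> Z) = j. h Y)" for j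
  have eq: "of_nat (N - 2 * m + j) * H j + (if j = 0 then 0 else of_nat (Suc m - j) * H (j - 1)) = 0" for j
  proof -
    have "0 = (\<Sum>X\<in>ksubsets N (Suc m). of_bool (card (X \<inter> Z) = j) * (\<Sum>x\<in>X. h (X - {x})))"
      using zero by simp
    also have "\<dots> = (\<Sum>X\<in>ksubsets N (Suc m). \<Sum>x\<in>X. of_bool (card (X \<inter> Z) = j) * h (X - {x}))"
      by (simp add: sum_distrib_left)
    also have "\<dots> = (\<Sum>(X, x)\<in>Sigma (ksubsets N (Suc m)) (\<lambda>X. X). of_bool (card (X \<inter> Z) = j) * h (X - {x}))"
      by (rule sum.Sigma) (auto dest: ksubsetsD)
    also have "\<dots> = (\<Sum>(Y, x)\<in>Sigma (ksubsets N m) (\<lambda>Y. {1..N} - Y). of_bool (card (insert x Y \<inter> Z) = j) * h Y)"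
      by (rule sum.reindex_bij_witness[where i = "\<lambda>(Y, x). (insert x Y, x)" and j = "\<lambda>(X, x). (X - {x}, x)"])
         (auto simp: ksubsets_def insert_absorb card_insert_if finite_subset)
    also have "\<dots> = (\<Sum>Y\<in>ksubsets N m. \<Sum>x\<in>{1..N} - Y. of_bool (card (insert x Y \<inter> Z) = j) * h Y)"
      by (rule sum.Sigma[symmetric]) auto
    also have "\<dots> = (\<Sum>Y\<in>ksubsets N m. of_nat (card {x \<in> {1..N} - Y. card (insert x Y \<inter> Z) = j}) * h Y)"
      by (simp add: sum_distrib_right[symmetric] Int_def)
    also have "\<dots> = (\<Sum>Y\<in>ksubsets N m. of_nat (N - 2 * m + j) * (if card (Y \<inter> Z) = j then h Y else 0) +
        (if j = 0 then 0 else of_nat (Suc m - j) * (if card (Y \<inter> Z) = j - 1 then h Y else 0)))"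
      using assms(1) by (intro sum.cong refl) (subst card_insert_meets[OF _ Z], auto simp: gr0_conv_Suc)
    also have "\<dots> = of_nat (N - 2 * m + j) * H j + (if j = 0 then 0 else of_nat (Suc m - j) * H (j - 1))"
      by (simp add: H_def sum.distrib sum_distrib_left[symmetric] sum.inter_filter)
    finally show ?thesis by simp
  qed
  have "H j = 0" for j
  proof (induction j)
    case 0
    then show ?case using eq[of 0] assms(1) by simp
  next
    case (Suc j)
    have "of_nat (N - 2 * m + Suc j) * H (Suc j) = 0" using eq[of "Suc j"] Suc by simp
    then show ?case by (metis Zero_not_Suc add_Suc_right mult_eq_0_iff of_nat_eq_0_iff)
  qed
  moreover have "{Y. Y \<in> ksubsets N m \<and> card (Y \<inter> Z) = m} = {Z}"
  proof -
    have "Y = Z" if "Y \<in> ksubsets N m" "card (Y \<inter> Z) = m" for Y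
      using ksubsetsD[OF that(1)] ksubsetsD[OF Z] that(2) card_subset_eq[of Y "Y \<inter> Z"] card_subset_eq[of Z "Y \<inter> Z"] by auto
    then show ?thesis using Z ksubsetsD[OF Z] by auto
  qed
  then have "H m = h Z" by (simp add: H_def)
  ultimately show ?thesis by simp
qed

text \<open>\<open>cfun.independent\<close> speaks of a set, so the indexed form must also show that
  no vector is listed twice.\<close>

lemma independent_family:
  fixes e :: "'i \<Rightarrow> 'a \<Rightarrow> complex"
  assumes "finite I"
    and zero: "\<And>r i. (\<Sum>i\<in>I. scale_fun (r i) (e i)) = 0 \<Longrightarrow> i \<in> I \<Longrightarrow> r i = 0"
  shows "inj_on e I" "cfun.independent (e ` I)"
proof -
  show inj: "inj_on e I"
  proof (rule inj_onI, rule ccontr)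
    fix i j assume ij: "i \<in> I" "j \<in> I" "e i = e j" "i \<noteq> j"
    define r :: "'i \<Rightarrow> complex" where "r l = (if l = i then 1 else if l = j then -1 else 0)" for l
    have "(\<Sum>l\<in>I. scale_fun (r l) (e l)) = (\<Sum>l\<in>{i, j}. scale_fun (r l) (e l))"
      using assms(1) ij by (intro sum.mono_neutral_right) (auto simp: r_def)
    also have "\<dots> = 0" using ij by (simp add: r_def)
    finally show False using zero[of r i] ij by (simp add: r_def)
  qed
  show "cfun.independent (e ` I)"
    unfolding cfun.independent_explicit_module
  proof (intro allI impI)
    fix D u v assume D: "finite D" "D \<subseteq> e ` I" "(\<Sum>v\<in>D. scale_fun (u v) v) = 0" "v \<in> D"
    define r where "r i = (if e i \<in> D then u (e i) else 0)" for i
    have "(\<Sum>i\<in>I. scale_fun (r i) (e i)) = (\<Sum>v\<in>e ` I. scale_fun (if v \<in> D then u v else 0) v)"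
      using inj by (simp add: sum.reindex r_def)
    also have "\<dots> = (\<Sum>v\<in>D. scale_fun (if v \<in> D then u v else 0) v)"
      using assms(1) D(2) by (intro sum.mono_neutral_right) auto
    also have "\<dots> = 0" using D(3) by simp
    finally have "(\<Sum>i\<in>I. scale_fun (r i) (e i)) = 0" .
    moreover obtain i where "i \<in> I" "v = e i" using D by blast
    ultimately show "u v = 0" using zero[of r i] D(4) by (simp add: r_def)
  qed
qed

lemma alternating_permutation_sum:
  fixes F :: "(nat \<Rightarrow> nat) \<Rightarrow> complex"
  assumes "finite C" and closed: "\<And>q. q \<in> C \<Longrightarrow> \<tau> \<circ> q \<in> C" and "\<tau> \<circ> \<tau> = id"
    and anti: "\<And>q. q \<in> C \<Longrightarrow> F (\<tau> \<circ> q) = - F q"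
  shows "(\<Sum>q\<in>C. F q) = 0"
proof -
  have inv: "\<tau> \<circ> (\<tau> \<circ> q) = q" for q by (metis assms(3) comp_assoc id_comp)
  have "(\<Sum>q\<in>C. F q) = (\<Sum>q\<in>C. F (\<tau> \<circ> q))"
    by (rule sum.reindex_bij_witness[where i = "\<lambda>q. \<tau> \<circ> q" and j = "\<lambda>q. \<tau> \<circ> q"])
       (simp_all add: inv closed)
  also have "\<dots> = - (\<Sum>q\<in>C. F q)" by (simp add: anti sum_negf)
  finally show ?thesis by simp
qed

lemma permutes_mapping_subset:
  assumes "finite R" "A \<subseteq> R" "B \<subseteq> R" "card A = card B"
  obtains h where "h permutes R" "h ` A = B"
proof -
  have fin: "finite A" "finite B" "finite (R - A)" "finite (R - B)" using assms finite_subset by auto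
  obtain f where f: "bij_betw f A B" using finite_same_card_bij[OF fin(1,2) assms(4)] by blast
  have "card (R - A) = card (R - B)" using assms fin by (simp add: card_Diff_subset)
  then obtain g where g: "bij_betw g (R - A) (R - B)" using finite_same_card_bij[OF fin(3,4)] by blast
  define h where "h x = (if x \<in> A then f x else if x \<in> R then g x else x)" for x
  have hA: "bij_betw h A B" using f by (subst bij_betw_cong[of _ _ f]) (auto simp: h_def)
  have hR: "bij_betw h (R - A) (R - B)" using g by (subst bij_betw_cong[of _ _ g]) (auto simp: h_def)
  have "bij_betw h (A \<union> (R - A)) (B \<union> (R - B))" by (rule bij_betw_combine[OF hA hR]) blast
  moreover have "A \<union> (R - A) = R" "B \<union> (R - B) = R" using assms by auto
  ultimately have "h permutes R" using assms by (intro bij_imp_permutes) (auto simp: h_def)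
  then show ?thesis using that hA by (auto simp: bij_betw_def)
qed

locale two_rows =
  fixes N k :: nat
  assumes k_pos: "1 \<le> k" and k_le: "2 * k \<le> N"
begin

definition tab :: "nat set \<Rightarrow> tabloid" where
  "tab X = [{1..N} - X, X]"

text \<open>Coordinates are indexed by the bottom row, which is entry 1 of a tabloid. The value 0 on
  all other lists makes such a vector determined by its values on the k-subsets.\<close>

definition vec :: "(nat set \<Rightarrow> complex) \<Rightarrow> tabloid \<Rightarrow> complex" where
  "vec r = (\<lambda>T. if \<exists>X\<in>ksubsets N k. T = tab X then r (T ! 1) else 0)"

lemma tab_inj: "tab X = tab Y \<longleftrightarrow> X = Y"
  by (auto simp: tab_def)

lemma vec_tab: "X \<in> ksubsets N k \<Longrightarrow> vec r (tab X) = r X"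
  by (auto simp: vec_def tab_def)

lemma vec_eqI: "(\<And>X. X \<in> ksubsets N k \<Longrightarrow> r X = s X) \<Longrightarrow> vec r = vec s"
  by (auto simp: vec_def tab_def fun_eq_iff)

lemma vec_eqD: "vec r = vec s \<Longrightarrow> X \<in> ksubsets N k \<Longrightarrow> r X = s X"
  by (metis vec_tab)

lemma vec_add: "vec r + vec s = vec (\<lambda>X. r X + s X)"
  by (auto simp: vec_def fun_eq_iff)

lemma vec_diff: "vec r - vec s = vec (\<lambda>X. r X - s X)"
  by (auto simp: vec_def fun_eq_iff)

lemma vec_scale: "scale_fun a (vec r) = vec (\<lambda>X. a * r X)"
  by (auto simp: vec_def fun_eq_iff scale_fun_def)

lemma vec_sum: "(\<Sum>i\<in>I. vec (r i)) = vec (\<lambda>X. \<Sum>i\<in>I. r i X)"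
  by (auto simp: vec_def fun_eq_iff sum_fun_apply)

lemma vec_zero: "vec (\<lambda>_. 0) = 0"
  by (auto simp: vec_def fun_eq_iff)

definition dl :: "nat set \<Rightarrow> tabloid \<Rightarrow> complex" where
  "dl Z = vec (\<lambda>X. of_bool (X = Z))"

lemma sum_scale_dl: "(\<Sum>Z\<in>ksubsets N k. scale_fun (r Z) (dl Z)) = vec r"
proof -
  have "(\<Sum>Z\<in>ksubsets N k. scale_fun (r Z) (dl Z)) = vec (\<lambda>X. \<Sum>Z\<in>ksubsets N k. r Z * of_bool (X = Z))"
    by (simp only: dl_def vec_scale vec_sum)
  also have "\<dots> = vec r" by (rule vec_eqI) simp
  finally show ?thesis .
qed

lemma vec_in_span: "vec r \<in> cfun.span (dl ` ksubsets N k)"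
  unfolding sum_scale_dl[symmetric] by (intro cfun.span_sum cfun.span_scale cfun.span_base) blast

lemma independent_dl: "inj_on dl (ksubsets N k)" "cfun.independent (dl ` ksubsets N k)"
proof -
  have "r i = 0" if "(\<Sum>Z\<in>ksubsets N k. scale_fun (r Z) (dl Z)) = 0" "i \<in> ksubsets N k" for r i
    using that vec_eqD[of r "\<lambda>_. 0" i] unfolding sum_scale_dl vec_zero by blast
  then show "inj_on dl (ksubsets N k)" "cfun.independent (dl ` ksubsets N k)"
    using independent_family[of "ksubsets N k" dl] finite_ksubsets by blast+
qed

text \<open>For a (k-1)-subset \<open>P\<close> and empty \<open>Q\<close> this is the image of
  \<open>P\<close> under the up operator, and for a k-subset \<open>P\<close> and empty
  \<open>Q\<close> it is a basis vector. The forbidden part \<open>Q\<close> serves for averages of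
  polytabloids, which prescribe the intersection with a given set.\<close>

definition ev :: "nat set \<Rightarrow> nat set \<Rightarrow> tabloid \<Rightarrow> complex" where
  "ev P Q = vec (\<lambda>X. of_bool (P \<subseteq> X \<and> X \<inter> Q = {}))"

abbreviation up :: "nat set \<Rightarrow> tabloid \<Rightarrow> complex" where
  "up Y \<equiv> ev Y {}"

lemma independent_up: "inj_on up (ksubsets N (k - 1))" "cfun.independent (up ` ksubsets N (k - 1))"
proof -
  obtain m where m: "k = Suc m" using k_pos by (cases k) auto
  have "r Z = 0" if z: "(\<Sum>Y\<in>ksubsets N (k - 1). scale_fun (r Y) (up Y)) = 0" and Z: "Z \<in> ksubsets N (k - 1)" for r Z
  proof (rule up_injective)
    show "2 * Suc m \<le> N" using k_le m by simp
    show "Z \<in> ksubsets N m" using Z m by simp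
    fix X assume X: "X \<in> ksubsets N (Suc m)"
    have "(\<Sum>Y\<in>ksubsets N m. scale_fun (r Y) (up Y)) = vec (\<lambda>X. \<Sum>Y\<in>ksubsets N m. r Y * of_bool (Y \<subseteq> X \<and> X \<inter> {} = {}))"
      by (simp only: ev_def vec_scale vec_sum)
    then have "(\<Sum>Y\<in>ksubsets N m. r Y * of_bool (Y \<subseteq> X \<and> X \<inter> {} = {})) = 0"
      using z X vec_eqD[of _ "\<lambda>_. 0" X] m unfolding vec_zero by simp
    then have "0 = (\<Sum>Y | Y \<in> ksubsets N m \<and> Y \<subseteq> X. r Y)"
      by (simp add: sum.inter_filter if_distrib of_bool_def cong: if_cong)
    also have "\<dots> = (\<Sum>x\<in>X. r (X - {x}))"
    proof -
      have inj: "inj_on (\<lambda>x. X - {x}) X" by (rule inj_onI) blast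
      have "{Y \<in> ksubsets N m. Y \<subseteq> X} = (\<lambda>x. X - {x}) ` X"
      proof (intro equalityI subsetI)
        fix Y assume Y: "Y \<in> {Y \<in> ksubsets N m. Y \<subseteq> X}"
        then have "card (X - Y) = 1"
          using ksubsetsD[OF X] ksubsetsD[of Y N m] by (subst card_Diff_subset) auto
        then obtain x where "X - Y = {x}" by (auto simp: card_Suc_eq)
        then show "Y \<in> (\<lambda>x. X - {x}) ` X" using Y by blast
      qed (use ksubsetsD[OF X] in \<open>auto simp: ksubsets_def\<close>)
      then show ?thesis using inj by (simp add: sum.reindex)
    qed
    finally show "(\<Sum>x\<in>X. r (X - {x})) = 0" by simp
  qed
  then show "inj_on up (ksubsets N (k - 1))" "cfun.independent (up ` ksubsets N (k - 1))"
    using independent_family[of "ksubsets N (k - 1)" up] finite_ksubsets by blast+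
qed

section \<open>Tableaux, column stabilizers and polytabloids\<close>

definition bottom :: "(nat \<times> nat \<Rightarrow> nat) \<Rightarrow> nat set" where
  "bottom t = (\<lambda>c. t (1, c)) ` {..<k}"

lemma diagram_iff: "(r, c) \<in> diagram [N - k, k] \<longleftrightarrow> (r = 0 \<and> c < N - k) \<or> (r = 1 \<and> c < k)"
  by (auto simp: diagram_def less_Suc_eq)

lemma shape_size: "sum_list [N - k, k] = N"
  using k_le by simp

lemma tableauD:
  assumes "t \<in> tableaux [N - k, k]"
  shows "bij_betw t (diagram [N - k, k]) {1..N}" "inj_on t (diagram [N - k, k])" "t ` diagram [N - k, k] = {1..N}"
  using assms unfolding tableaux_def shape_size by (auto simp: bij_betw_def)

lemma tableau_in: "t \<in> tableaux [N - k, k] \<Longrightarrow> (r, c) \<in> diagram [N - k, k] \<Longrightarrow> t (r, c) \<in> {1..N}"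
  using tableauD(3) by blast

lemma tableau_eq_iff:
  assumes "t \<in> tableaux [N - k, k]" "(r, c) \<in> diagram [N - k, k]" "(s, d) \<in> diagram [N - k, k]"
  shows "t (r, c) = t (s, d) \<longleftrightarrow> r = s \<and> c = d"
  using inj_on_eq_iff[OF tableauD(2)[OF assms(1)] assms(2,3)] by simp

lemma tabloid_of_eq:
  assumes t: "t \<in> tableaux [N - k, k]"
  shows "tabloid_of [N - k, k] t = tab (bottom t)" "bottom t \<in> ksubsets N k"
proof -
  have inj: "inj_on (\<lambda>c. t (1, c)) {..<k}"
    by (rule inj_onI) (use tableau_eq_iff[OF t] in \<open>simp add: diagram_iff\<close>)
  show "bottom t \<in> ksubsets N k"
    using tableau_in[OF t, of 1] card_image[OF inj] by (fastforce simp: bottom_def ksubsets_def diagram_iff)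
  have "(\<lambda>c. t (0, c)) ` {..<N - k} = {1..N} - bottom t"
  proof (intro equalityI subsetI)
    fix x assume "x \<in> (\<lambda>c. t (0, c)) ` {..<N - k}"
    then obtain c where c: "c < N - k" "x = t (0, c)" by blast
    then show "x \<in> {1..N} - bottom t"
      using tableau_in[OF t, of 0 c] tableau_eq_iff[OF t, of 0 c 1] by (auto simp: bottom_def diagram_iff)
  next
    fix x assume x: "x \<in> {1..N} - bottom t"
    then obtain r c where "(r, c) \<in> diagram [N - k, k]" "x = t (r, c)"
      using tableauD(3)[OF t] by (metis DiffD1 imageE surj_pair)
    then show "x \<in> (\<lambda>c. t (0, c)) ` {..<N - k}" using x by (auto simp: bottom_def diagram_iff)
  qed
  then show "tabloid_of [N - k, k] t = tab (bottom t)"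
    by (simp add: tabloid_of_def tab_def bottom_def upt_rec numeral_2_eq_2)
qed

lemma permute_tab: "q permutes {1..N} \<Longrightarrow> permute_tabloid q (tab X) = tab (q ` X)"
  by (simp add: permute_tabloid_def tab_def image_set_diff[OF permutes_inj] permutes_image)

definition col :: "(nat \<times> nat \<Rightarrow> nat) \<Rightarrow> nat \<Rightarrow> nat set" where
  "col t c = {t (r, c) |r. (r, c) \<in> diagram [N - k, k]}"

abbreviation colstab :: "(nat \<times> nat \<Rightarrow> nat) \<Rightarrow> (nat \<Rightarrow> nat) set" where
  "colstab t \<equiv> column_stabilizer [N - k, k] t"

lemma col_low: "c < k \<Longrightarrow> col t c = {t (0, c), t (1, c)}"
  using k_le by (auto simp: col_def diagram_iff)

lemma col_high: "k \<le> c \<Longrightarrow> col t c \<subseteq> {t (0, c)}"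
  by (auto simp: col_def diagram_iff)

lemma colstab_iff: "q \<in> colstab t \<longleftrightarrow> q permutes {1..N} \<and> (\<forall>c. q ` col t c = col t c)"
  unfolding column_stabilizer_def shape_size col_def by simp

lemma finite_colstab: "finite (colstab t)"
  by (rule finite_subset[of _ "{q. q permutes {1..N}}"]) (auto simp: colstab_iff finite_permutations)

lemma polytabloid_eq:
  assumes t: "t \<in> tableaux [N - k, k]"
  shows "polytabloid [N - k, k] t =
    vec (\<lambda>X. \<Sum>q\<in>colstab t. if X = q ` bottom t then of_int (sign q) else 0)"
proof
  fix T
  have tab: "permute_tabloid q (tabloid_of [N - k, k] t) = tab (q ` bottom t)" "q ` bottom t \<in> ksubsets N k"
    if "q \<in> colstab t" for q
    using that tabloid_of_eq[OF t] permute_tab ksubsets_image by (auto simp: colstab_iff)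
  have eq: "polytabloid [N - k, k] t T = (\<Sum>q\<in>colstab t. if T = tab (q ` bottom t) then of_int (sign q) else 0)"
    unfolding polytabloid_def by (rule sum.cong) (simp_all add: tab)
  show "polytabloid [N - k, k] t T = vec (\<lambda>X. \<Sum>q\<in>colstab t. if X = q ` bottom t then of_int (sign q) else 0) T"
  proof (cases "\<exists>X\<in>ksubsets N k. T = tab X")
    case True
    then obtain X where "X \<in> ksubsets N k" "T = tab X" by blast
    then show ?thesis unfolding eq by (simp add: vec_tab tab_inj)
  next
    case False
    then have "polytabloid [N - k, k] t T = 0" unfolding eq using tab by (intro sum.neutral) auto
    then show ?thesis using False unfolding vec_def by simp
  qed
qed

lemma colstab_comp:
  assumes "q \<in> colstab t" "g permutes {1..N}"
  shows "g \<circ> q \<circ> inv g \<in> colstab (g \<circ> t)"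
proof -
  have "g \<circ> q \<circ> inv g permutes {1..N}"
    using assms by (intro permutes_compose permutes_inv) (auto simp: colstab_iff)
  moreover have "(g \<circ> q \<circ> inv g) ` col (g \<circ> t) c = col (g \<circ> t) c" for c
  proof -
    have col: "col (g \<circ> t) c = g ` col t c" by (auto simp: col_def)
    have "(g \<circ> q \<circ> inv g) ` col (g \<circ> t) c = g ` q ` (inv g \<circ> g) ` col t c" unfolding col by (simp add: image_comp comp_assoc)
    also have "\<dots> = g ` q ` col t c" using permutes_inv_o(2)[OF assms(2)] by simp
    also have "\<dots> = col (g \<circ> t) c" using assms by (simp add: col colstab_iff)
    finally show ?thesis .
  qed
  ultimately show ?thesis by (simp add: colstab_iff)
qed

lemma tableau_comp:
  assumes "t \<in> tableaux [N - k, k]" "g permutes {1..N}"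
  shows "g \<circ> t \<in> tableaux [N - k, k]"
  using bij_betw_trans[OF tableauD(1)[OF assms(1)] permutes_imp_bij[OF assms(2)]]
  unfolding tableaux_def shape_size by simp

lemma bottom_comp: "bottom (g \<circ> t) = g ` bottom t"
  by (auto simp: bottom_def)

lemma polytabloid_comp:
  assumes t: "t \<in> tableaux [N - k, k]" and g: "g permutes {1..N}"
  shows "polytabloid [N - k, k] (g \<circ> t) =
    vec (\<lambda>X. \<Sum>q\<in>colstab t. if X = g ` q ` bottom t then of_int (sign q) else 0)"
proof -
  have gi: "inv g \<circ> g = id" "g \<circ> inv g = id" using permutes_inv_o[OF g] by auto
  have perm: "permutation g" using g finite_atLeastAtMost permutation_permutes by blast
  have "(\<Sum>q\<in>colstab (g \<circ> t). if X = q ` bottom (g \<circ> t) then of_int (sign q) else 0) =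
      (\<Sum>q\<in>colstab t. if X = g ` q ` bottom t then of_int (sign q) else (0::complex))" for X
  proof (rule sum.reindex_bij_witness[where i = "\<lambda>q. g \<circ> q \<circ> inv g" and j = "\<lambda>q. inv g \<circ> q \<circ> g"])
    fix q assume q: "q \<in> colstab (g \<circ> t)"
    show "g \<circ> (inv g \<circ> q \<circ> g) \<circ> inv g = q" using gi by (metis comp_assoc comp_id id_comp)
    have "inv g \<circ> (g \<circ> t) = t" using gi by (metis comp_assoc id_comp)
    then show "inv g \<circ> q \<circ> g \<in> colstab t"
      using colstab_comp[OF q permutes_inv[OF g]] permutes_inv_inv[OF g] by simp
    have qp: "permutation q" using q finite_atLeastAtMost permutation_permutes by (auto simp: colstab_iff)
    have "sign (inv g \<circ> q \<circ> g) = sign q"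
      using perm qp
      by (simp add: sign_compose permutation_compose permutation_inverse sign_inverse sign_idempotent mult.commute mult.left_commute)
    moreover have "g ` (inv g \<circ> q \<circ> g) ` bottom t = q ` bottom (g \<circ> t)"
    proof -
      have "g ` (inv g \<circ> q \<circ> g) ` bottom t = ((g \<circ> inv g) \<circ> q \<circ> g) ` bottom t" by (simp add: image_comp comp_assoc)
      then show ?thesis by (simp add: gi bottom_comp image_comp)
    qed
    ultimately show "(if X = g ` (inv g \<circ> q \<circ> g) ` bottom t then of_int (sign (inv g \<circ> q \<circ> g)) else 0) =
      (if X = q ` bottom (g \<circ> t) then of_int (sign q) else (0::complex))" by simp
  next
    fix q assume q: "q \<in> colstab t"
    show "inv g \<circ> (g \<circ> q \<circ> inv g) \<circ> g = q" using gi by (metis comp_assoc comp_id id_comp)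
    show "g \<circ> q \<circ> inv g \<in> colstab (g \<circ> t)" by (rule colstab_comp[OF q g])
  qed
  then show ?thesis unfolding polytabloid_eq[OF tableau_comp[OF t g]] by simp
qed

lemma swap_in_colstab:
  assumes t: "t \<in> tableaux [N - k, k]" and c: "c < k" and q: "q \<in> colstab t"
  shows "transpose (t (0, c)) (t (1, c)) \<circ> q \<in> colstab t"
proof -
  let ?\<tau> = "transpose (t (0, c)) (t (1, c))"
  have in01: "t (0, c) \<in> {1..N}" "t (1, c) \<in> {1..N}"
    using tableau_in[OF t] c k_le by (auto simp: diagram_iff)
  have \<tau>: "?\<tau> ` col t d = col t d" for d
  proof (cases "d = c")
    case True
    then show ?thesis using c by (auto simp: col_low)
  next
    case False
    have "?\<tau> x = x" if x: "x \<in> col t d" for x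
    proof -
      obtain r where r: "(r, d) \<in> diagram [N - k, k]" "x = t (r, d)" using x unfolding col_def by blast
      then have "x \<noteq> t (0, c)" "x \<noteq> t (1, c)"
        using tableau_eq_iff[OF t r(1)] c k_le False by (auto simp: diagram_iff)
      then show ?thesis by simp
    qed
    then show ?thesis by force
  qed
  have "(?\<tau> \<circ> q) ` col t d = col t d" for d
    unfolding image_comp[symmetric] using q \<tau>[of d] by (simp add: colstab_iff)
  moreover have "?\<tau> \<circ> q permutes {1..N}"
    using q in01 by (intro permutes_compose permutes_swap_id) (auto simp: colstab_iff)
  ultimately show ?thesis unfolding colstab_iff by blast
qed

lemma sign_swap:
  assumes t: "t \<in> tableaux [N - k, k]" and c: "c < k" and q: "q \<in> colstab t"
  shows "sign (transpose (t (0, c)) (t (1, c)) \<circ> q) = - sign q"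
proof -
  have "t (0, c) \<noteq> t (1, c)" using tableau_eq_iff[OF t, of 0 c 1 c] c k_le by (simp add: diagram_iff)
  moreover have "permutation q" using q finite_atLeastAtMost permutation_permutes by (auto simp: colstab_iff)
  ultimately show ?thesis by (simp add: sign_compose permutation_swap_id sign_swap_id)
qed

text \<open>Some column of the tableau avoids \<open>Y\<close>; exchanging its two entries reverses signs.\<close>

lemma polytabloid_orthogonal_up:
  assumes t: "t \<in> tableaux [N - k, k]" and Y: "Y \<in> ksubsets N (k - 1)"
  shows "(\<Sum>X | X \<in> ksubsets N k \<and> Y \<subseteq> X. polytabloid [N - k, k] t (tab X)) = 0"
proof -
  \<comment> \<open>Pigeonhole: the k columns of height two are disjoint, and \<open>Y\<close> has
    k-1 elements.\<close>
  have "\<exists>c<k. t (0, c) \<notin> Y \<and> t (1, c) \<notin> Y"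
  proof (rule ccontr)
    assume "\<not> ?thesis"
    then have "\<forall>c\<in>{..<k}. \<exists>y. y \<in> Y \<and> y \<in> col t c" by (auto simp: col_low)
    then obtain f where f: "\<forall>c\<in>{..<k}. f c \<in> Y \<and> f c \<in> col t c" by metis
    have "inj_on f {..<k}"
    proof (rule inj_onI)
      fix c d assume cd: "c \<in> {..<k}" "d \<in> {..<k}" "f c = f d"
      then obtain r s where "(r, c) \<in> diagram [N - k, k]" "(s, d) \<in> diagram [N - k, k]" "t (r, c) = t (s, d)"
        using f unfolding col_def by (smt (verit) mem_Collect_eq)
      then show "c = d" using tableau_eq_iff[OF t] by blast
    qed
    then have "card {..<k} \<le> card Y"
      using f ksubsetsD[OF Y] by (intro card_inj_on_le) auto
    then show False using ksubsetsD[OF Y] k_pos by simp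
  qed
  then obtain c where c: "c < k" "t (0, c) \<notin> Y" "t (1, c) \<notin> Y" by blast
  let ?\<tau> = "transpose (t (0, c)) (t (1, c))"
  have \<tau>Y: "Y \<subseteq> ?\<tau> ` Z \<longleftrightarrow> Y \<subseteq> Z" for Z
  proof -
    have \<tau>: "?\<tau> ` Y = Y" using c(2,3) by (auto simp: transpose_def image_iff)
    have "?\<tau> ` ?\<tau> ` Z = Z" by (simp add: image_comp)
    then show ?thesis using \<tau> by (metis image_mono)
  qed
  have "(\<Sum>X | X \<in> ksubsets N k \<and> Y \<subseteq> X. polytabloid [N - k, k] t (tab X)) =
      (\<Sum>X | X \<in> ksubsets N k \<and> Y \<subseteq> X. \<Sum>q\<in>colstab t. if X = q ` bottom t then of_int (sign q) else 0)"
    unfolding polytabloid_eq[OF t] by (intro sum.cong) (auto simp: vec_tab)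
  also have "\<dots> = (\<Sum>q\<in>colstab t. \<Sum>X | X \<in> ksubsets N k \<and> Y \<subseteq> X. if X = q ` bottom t then of_int (sign q) else 0)"
    by (rule sum.swap)
  also have "\<dots> = (\<Sum>q\<in>colstab t. of_int (sign q) * of_bool (Y \<subseteq> q ` bottom t))"
  proof (rule sum.cong[OF refl])
    fix q assume "q \<in> colstab t"
    then have "q ` bottom t \<in> ksubsets N k" using tabloid_of_eq(2)[OF t] ksubsets_image by (auto simp: colstab_iff)
    then show "(\<Sum>X | X \<in> ksubsets N k \<and> Y \<subseteq> X. if X = q ` bottom t then of_int (sign q) else 0) =
        (of_int (sign q) * of_bool (Y \<subseteq> q ` bottom t) :: complex)"
      by (simp add: sum.delta)
  qed
  also have "\<dots> = 0"
  proof (rule alternating_permutation_sum[OF finite_colstab])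
    show "?\<tau> \<circ> ?\<tau> = id" by simp
    fix q assume q: "q \<in> colstab t"
    show "?\<tau> \<circ> q \<in> colstab t" by (rule swap_in_colstab[OF t c(1) q])
    show "of_int (sign (?\<tau> \<circ> q)) * of_bool (Y \<subseteq> (?\<tau> \<circ> q) ` bottom t) =
        - (of_int (sign q) * of_bool (Y \<subseteq> q ` bottom t) :: complex)"
      unfolding sign_swap[OF t c(1) q] image_comp[symmetric] \<tau>Y by simp
  qed
  finally show ?thesis .
qed

lemma colstab_values:
  assumes t: "t \<in> tableaux [N - k, k]" and q: "q \<in> colstab t" and c: "c < k"
  shows "q (t (1, c)) = t (1, c) \<and> q (t (0, c)) = t (0, c) \<or> q (t (1, c)) = t (0, c) \<and> q (t (0, c)) = t (1, c)"
proof -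
  have "q ` {t (0, c), t (1, c)} = {t (0, c), t (1, c)}" using q c by (metis colstab_iff col_low)
  moreover have "t (0, c) \<noteq> t (1, c)" using tableau_eq_iff[OF t, of 0 c 1 c] c k_le by (simp add: diagram_iff)
  moreover have "inj q" using q permutes_inj by (auto simp: colstab_iff)
  then have "q (t (0, c)) \<noteq> q (t (1, c))" using \<open>t (0, c) \<noteq> t (1, c)\<close> by (simp add: inj_eq)
  ultimately show ?thesis by (auto simp: doubleton_eq_iff)
qed

lemma top_notin_bottom:
  assumes t: "t \<in> tableaux [N - k, k]" and c: "c < k"
  shows "t (0, c) \<notin> bottom t"
proof
  assume "t (0, c) \<in> bottom t"
  then obtain d where "d < k" "t (0, c) = t (1, d)" by (auto simp: bottom_def)
  moreover have "c < N - k" using c k_le by linarith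
  ultimately show False using tableau_eq_iff[OF t, of 0 c 1 d] by (simp add: diagram_iff)
qed

text \<open>A column-preserving permutation is the product of the swaps of the columns it exchanges,
  and each swap displaces one bottom entry. Composing with the swap of one such column lowers the
  number of displaced entries by one and reverses the sign.\<close>

lemma sign_colstab:
  assumes t: "t \<in> tableaux [N - k, k]" and q: "q \<in> colstab t"
  shows "sign q = (- 1) ^ card (bottom t - q ` bottom t)"
  using q
proof (induction "card (bottom t - q ` bottom t)" arbitrary: q)
  case 0
  have fin: "finite (bottom t)" by (simp add: bottom_def)
  note neq = top_notin_bottom[OF t]
  have sub: "bottom t \<subseteq> q ` bottom t" using 0(1) fin by auto
  have eq: "q ` bottom t = bottom t"
    using sub fin card_image_le[of "bottom t" q] by (metis card_seteq finite_imageI)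
  have fix1: "q (t (1, c)) = t (1, c) \<and> q (t (0, c)) = t (0, c)" if "c < k" for c
  proof -
    have "q (t (1, c)) \<in> bottom t" using eq that by (auto simp: bottom_def)
    then show ?thesis using colstab_values[OF t 0(2) that] neq[OF that] by auto
  qed
  have "q x = x" for x
  proof (cases "x \<in> {1..N}")
    case True
    then obtain r c where rc: "(r, c) \<in> diagram [N - k, k]" "x = t (r, c)"
      using tableauD(3)[OF t] by (metis imageE surj_pair)
    show ?thesis
    proof (cases "c < k")
      case True
      then show ?thesis using fix1[OF True] rc by (auto simp: diagram_iff)
    next
      case False
      then have "x \<in> col t c" "col t c \<subseteq> {x}" using rc col_high[of c t] by (auto simp: col_def diagram_iff)
      then have "col t c = {x}" by blast
      then have "q ` {x} = {x}" using 0(2) by (metis colstab_iff)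
      then show ?thesis by simp
    qed
  next
    case False
    then show ?thesis using 0(2) permutes_not_in[of q "{1..N}" x] by (simp add: colstab_iff)
  qed
  then have "q = id" by auto
  then show ?case by simp
next
  case (Suc n)
  have fin: "finite (bottom t)" by (simp add: bottom_def)
  then have "bottom t - q ` bottom t \<noteq> {}" using Suc(2) by (metis card.empty Zero_not_Suc)
  then obtain c where c: "c < k" "t (1, c) \<notin> q ` bottom t" by (auto simp: bottom_def)
  let ?\<tau> = "transpose (t (0, c)) (t (1, c))"
  have "t (1, c) \<in> bottom t" using c(1) by (auto simp: bottom_def)
  then have "q (t (1, c)) \<noteq> t (1, c)" using c(2) by (metis imageI)
  then have val: "q (t (1, c)) = t (0, c)" using colstab_values[OF t Suc(3) c(1)] by blast
  then have t0: "t (0, c) \<in> q ` bottom t" using \<open>t (1, c) \<in> bottom t\<close> by (metis imageI)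
  note t0' = top_notin_bottom[OF t c(1)]
  have img: "?\<tau> ` (q ` bottom t) = insert (t (1, c)) (q ` bottom t - {t (0, c)})"
    using t0 c(2) by (auto simp: transpose_def image_iff split: if_splits)
  have diff: "bottom t - (?\<tau> \<circ> q) ` bottom t = (bottom t - q ` bottom t) - {t (1, c)}"
    using t0' unfolding image_comp[symmetric] img by auto
  have "card (bottom t - (?\<tau> \<circ> q) ` bottom t) = n"
    using Suc(2) c(2) \<open>t (1, c) \<in> bottom t\<close> fin unfolding diff by (simp add: card_Diff_singleton)
  then have "sign (?\<tau> \<circ> q) = (- 1) ^ n"
    using Suc(1)[of "?\<tau> \<circ> q"] swap_in_colstab[OF t c(1) Suc(3)] by simp
  then show ?case using sign_swap[OF t c(1) Suc(3)] Suc(2)[symmetric] by simp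
qed

end

context two_rows
begin

section \<open>The Specht module and the image of the up operator span the permutation
  module\<close>

abbreviation specht :: "(tabloid \<Rightarrow> complex) set" where
  "specht \<equiv> specht_module [N - k, k]"

abbreviation total :: "(tabloid \<Rightarrow> complex) set" where
  "total \<equiv> cfun.span (specht \<union> up ` ksubsets N (k - 1))"

text \<open>Extending \<open>P\<close> by one element in all possible ways counts every k-subset
  above \<open>P\<close> exactly k - card P times. So the vector of \<open>P\<close> is a multiple
  of a sum of vectors for larger sets, and sets of size k-1 are the base.\<close>

lemma ev_in_total:
  assumes "P \<subseteq> {1..N}" "card P < k"
  shows "ev P {} \<in> total"
  using assms
proof (induction "k - card P" arbitrary: P rule: less_induct)
  case less
  have finP: "finite P" using less.prems(1) finite_subset by blast
  show ?case
  proof (cases "card P = k - 1")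
    case True
    then show ?thesis using less.prems by (intro cfun.span_base) (auto simp: ksubsets_def)
  next
    case False
    have "scale_fun (of_nat (k - card P)) (ev P {}) = (\<Sum>x\<in>{1..N} - P. ev (insert x P) {})"
      unfolding ev_def vec_scale vec_sum
    proof (rule vec_eqI)
      fix X assume X: "X \<in> ksubsets N k"
      show "of_nat (k - card P) * of_bool (P \<subseteq> X \<and> X \<inter> {} = {}) =
          (\<Sum>x\<in>{1..N} - P. of_bool (insert x P \<subseteq> X \<and> X \<inter> {} = {}) :: complex)"
      proof (cases "P \<subseteq> X")
        case True
        have "({1..N} - P) \<inter> {x. x \<in> X} = X - P" using ksubsetsD[OF X] by auto
        moreover have "card (X - P) = k - card P" using ksubsetsD[OF X] finP True by (simp add: card_Diff_subset)
        ultimately show ?thesis using True by simp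
      qed simp
    qed
    also have "\<dots> \<in> total"
      using less.prems finP False by (intro cfun.span_sum less.hyps) auto
    finally have "scale_fun (inverse (of_nat (k - card P))) (scale_fun (of_nat (k - card P)) (ev P {})) \<in> total"
      by (rule cfun.span_scale)
    then show ?thesis using less.prems by simp
  qed
qed

text \<open>Modulo the image of \<open>up\<close>, moving an element from the prescribed to the forbidden part
  changes the sign.\<close>

lemma ev_minus_dl_in_total:
  assumes X: "X \<in> ksubsets N k" and "finite Q" and PQ: "P \<inter> Q = {}" "P \<union> Q \<subseteq> X"
  shows "ev P Q - scale_fun ((-1) ^ card Q * of_bool (P \<union> Q = X)) (dl X) \<in> total"
  using assms(2-)
proof (induction Q arbitrary: P rule: finite_induct)
  case empty
  show ?case
  proof (cases "P = X")
    case True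
    have "ev X {} = dl X"
      unfolding ev_def dl_def
    proof (rule vec_eqI)
      fix Y assume Y: "Y \<in> ksubsets N k"
      have "X \<subseteq> Y \<longleftrightarrow> Y = X" using ksubsetsD[OF X] ksubsetsD[OF Y] card_subset_eq[of Y X] by auto
      then show "of_bool (X \<subseteq> Y \<and> Y \<inter> {} = {}) = (of_bool (Y = X) :: complex)" by simp
    qed
    then have "ev P {} - scale_fun ((-1) ^ card ({} :: nat set) * of_bool (P \<union> {} = X)) (dl X) = 0"
      using True by simp
    then show ?thesis by (simp only: cfun.span_zero)
  next
    case False
    then have "P \<subset> X" using empty by auto
    then have "card P < k" using ksubsetsD[OF X] by (metis psubset_card_mono)
    moreover have "P \<subseteq> {1..N}" using \<open>P \<subset> X\<close> ksubsetsD[OF X] by blast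
    ultimately show ?thesis using False ev_in_total by simp
  qed
next
  case (insert q Q)
  \<comment> \<open>The k-subsets containing \<open>P\<close> and avoiding \<open>Q\<close> are
    split by whether they contain q. In the first term \<open>P\<close> and \<open>Q\<close> no
    longer exhaust \<open>X\<close>, which puts it into \<open>total\<close>; the second brings the
    change of sign.\<close>
  have "ev P (insert q Q) = ev P Q - ev (insert q P) Q"
    unfolding ev_def vec_diff by (rule vec_eqI) (auto simp: of_bool_def)
  have evPQ: "ev P Q \<in> total"
  proof -
    have "P \<union> Q \<noteq> X" using insert by auto
    then show ?thesis using insert.IH[of P] insert.prems by simp
  qed
  have evqP: "ev (insert q P) Q - scale_fun ((-1) ^ card Q * of_bool (P \<union> insert q Q = X)) (dl X) \<in> total"
  proof -
    have "ev (insert q P) Q - scale_fun ((-1) ^ card Q * of_bool (insert q P \<union> Q = X)) (dl X) \<in> total"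
      using insert.prems insert.hyps by (intro insert.IH) auto
    moreover have "insert q P \<union> Q = P \<union> insert q Q" by blast
    ultimately show ?thesis by (simp only:)
  qed
  have "ev P Q - (ev (insert q P) Q - scale_fun ((-1) ^ card Q * of_bool (P \<union> insert q Q = X)) (dl X)) \<in> total"
    by (rule cfun.span_diff[OF evPQ evqP])
  moreover have "ev P (insert q Q) - scale_fun ((-1) ^ card (insert q Q) * of_bool (P \<union> insert q Q = X)) (dl X) =
      ev P Q - (ev (insert q P) Q - scale_fun ((-1) ^ card Q * of_bool (P \<union> insert q Q = X)) (dl X))"
    using \<open>ev P (insert q Q) = ev P Q - ev (insert q P) Q\<close> insert.hyps by (simp add: cfun.scale_minus_left)
  ultimately show ?case by (simp only:)
qed

lemma exists_tableau:
  assumes X: "X \<in> ksubsets N k"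
  obtains t where "t \<in> tableaux [N - k, k]" "bottom t = X"
proof -
  note X' = ksubsetsD[OF X]
  have "card ({1..N} - X) = N - k" using X' by (simp add: card_Diff_subset)
  then obtain f where f: "bij_betw f {..<N - k} ({1..N} - X)"
    using ex_bij_betw_nat_finite[of "{1..N} - X"] by (auto simp: atLeast0LessThan)
  obtain g where g: "bij_betw g {..<k} X"
    using ex_bij_betw_nat_finite[of X] X' by (auto simp: atLeast0LessThan)
  define t where "t = (\<lambda>(r, c). if r = (0::nat) then f c else g c)"
  have t0: "bij_betw t ({0} \<times> {..<N - k}) ({1..N} - X)"
  proof -
    have "t ` ({0} \<times> {..<N - k}) = f ` {..<N - k}" by (auto simp: t_def image_def)
    moreover have "inj_on t ({0} \<times> {..<N - k})" using f by (auto simp: bij_betw_def inj_on_def t_def)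
    ultimately show ?thesis using f by (simp add: bij_betw_def)
  qed
  have t1: "bij_betw t ({1} \<times> {..<k}) X"
  proof -
    have "t ` ({1} \<times> {..<k}) = g ` {..<k}" by (auto simp: t_def image_def)
    moreover have "inj_on t ({1} \<times> {..<k})" using g by (auto simp: bij_betw_def inj_on_def t_def)
    ultimately show ?thesis using g by (simp add: bij_betw_def)
  qed
  have "bij_betw t ({0} \<times> {..<N - k} \<union> {1} \<times> {..<k}) (({1..N} - X) \<union> X)"
    by (rule bij_betw_combine[OF t0 t1]) blast
  moreover have "{0} \<times> {..<N - k} \<union> {1} \<times> {..<k} = diagram [N - k, k]"
    by (auto simp: diagram_iff)
  moreover have "({1..N} - X) \<union> X = {1..N}" using X' by blast
  ultimately have "t \<in> tableaux [N - k, k]" unfolding tableaux_def shape_size by simp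
  moreover have "bottom t = X" using g by (simp add: bottom_def t_def bij_betw_def)
  ultimately show ?thesis using that by blast
qed

lemma polytabloid_in_specht: "t \<in> tableaux [N - k, k] \<Longrightarrow> polytabloid [N - k, k] t \<in> specht"
  unfolding specht_module_def by (intro cfun.span_base) blast

text \<open>Permutations that fix \<open>X\<close> pointwise preserve the intersection of
  \<open>Z\<close> with \<open>X\<close> and act transitively on the k-subsets having the same
  intersection. Those carrying \<open>Z\<close> to such a \<open>Y\<close> form a coset of the
  stabilizer of \<open>Z\<close>.\<close>

lemma card_stabilizing:
  assumes X: "X \<subseteq> {1..N}" and Z: "Z \<in> ksubsets N k" and Y: "Y \<in> ksubsets N k"
  shows "card {g. g permutes ({1..N} - X) \<and> g ` Z = Y} =
    (if Y \<inter> X = Z \<inter> X then card {g. g permutes ({1..N} - X) \<and> g ` Z = Z} else 0)"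
proof (cases "Y \<inter> X = Z \<inter> X")
  case True
  note Y' = ksubsetsD[OF Y] and Z' = ksubsetsD[OF Z]
  have "card (Z - X) = card (Y - X)"
    using True Y' Z' by (metis Diff_Int2 Int_commute card_Diff_subset_Int finite_Int)
  then obtain h where h: "h permutes ({1..N} - X)" "h ` (Z - X) = Y - X"
    using permutes_mapping_subset[of "{1..N} - X" "Z - X" "Y - X"] Y' Z' by blast
  have hX: "h ` (Z \<inter> X) = Z \<inter> X"
    using permutes_not_in[OF h(1)] by force
  have hZ: "h ` Z = Y"
  proof -
    have "h ` Z = h ` (Z - X) \<union> h ` (Z \<inter> X)" by blast
    also have "\<dots> = (Y - X) \<union> (Y \<inter> X)" unfolding h(2) hX True ..
    finally show ?thesis by blast
  qed
  have hi: "inv h \<circ> h = id" "h \<circ> inv h = id" using permutes_inv_o[OF h(1)] by auto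
  have "card {g. g permutes ({1..N} - X) \<and> g ` Z = Z} = card {g. g permutes ({1..N} - X) \<and> g ` Z = Y}"
  proof (rule bij_betw_same_card[OF bij_betw_byWitness[where f = "\<lambda>g. h \<circ> g" and f' = "\<lambda>g. inv h \<circ> g"]])
    show "\<forall>g\<in>{g. g permutes ({1..N} - X) \<and> g ` Z = Z}. inv h \<circ> (h \<circ> g) = g"
      by (metis comp_assoc hi(1) id_comp)
    show "\<forall>g\<in>{g. g permutes ({1..N} - X) \<and> g ` Z = Y}. h \<circ> (inv h \<circ> g) = g"
      by (metis comp_assoc hi(2) id_comp)
    show "(\<lambda>g. h \<circ> g) ` {g. g permutes ({1..N} - X) \<and> g ` Z = Z} \<subseteq> {g. g permutes ({1..N} - X) \<and> g ` Z = Y}"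
    proof (intro image_subsetI CollectI conjI)
      fix g assume g: "g \<in> {g. g permutes ({1..N} - X) \<and> g ` Z = Z}"
      then show "h \<circ> g permutes ({1..N} - X)" using h(1) by (blast intro: permutes_compose)
      show "(h \<circ> g) ` Z = Y" unfolding image_comp[symmetric] using g hZ by (simp only: mem_Collect_eq)
    qed
    have iY: "inv h ` Y = Z" using hZ hi(1) by (metis image_comp image_id id_apply)
    show "(\<lambda>g. inv h \<circ> g) ` {g. g permutes ({1..N} - X) \<and> g ` Z = Y} \<subseteq> {g. g permutes ({1..N} - X) \<and> g ` Z = Z}"
    proof (intro image_subsetI CollectI conjI)
      fix g assume g: "g \<in> {g. g permutes ({1..N} - X) \<and> g ` Z = Y}"
      then show "inv h \<circ> g permutes ({1..N} - X)" using permutes_inv[OF h(1)] by (blast intro: permutes_compose)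
      show "(inv h \<circ> g) ` Z = Z" unfolding image_comp[symmetric] using g iY by (simp only: mem_Collect_eq)
    qed
  qed
  then show ?thesis using True by simp
next
  case False
  have "g ` Z \<inter> X = Z \<inter> X" if g: "g permutes ({1..N} - X)" for g
  proof -
    have fixX: "g x = x" if "x \<in> X" for x using permutes_not_in[OF g] that by simp
    have inX: "x \<in> X" if "g x \<in> X" for x
      using fixX[OF that] permutes_inj[OF g] that by (metis injD)
    show ?thesis
    proof (intro equalityI subsetI)
      fix y assume "y \<in> g ` Z \<inter> X"
      then obtain x where x: "x \<in> Z" "y = g x" "g x \<in> X" by blast
      then have "x \<in> X" "y = x" using inX[OF x(3)] fixX by simp_all
      then show "y \<in> Z \<inter> X" using x(1) by simp
    next
      fix y assume "y \<in> Z \<inter> X"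
      then have "g y = y" "y \<in> Z" "y \<in> X" using fixX by simp_all
      then show "y \<in> g ` Z \<inter> X" by (metis IntI imageI)
    qed
  qed
  then have "{g. g permutes ({1..N} - X) \<and> g ` Z = Y} = {}" using False by blast
  then show ?thesis using False by (simp only: card.empty if_False)
qed

text \<open>Average the polytabloids with bottom row \<open>X\<close> over the permutations fixing \<open>X\<close>
  pointwise. Modulo the image of \<open>up\<close> all terms become positive multiples of \<open>dl X\<close>.\<close>

lemma dl_in_total:
  assumes X: "X \<in> ksubsets N k"
  shows "dl X \<in> total"
proof -
  note X' = ksubsetsD[OF X]
  obtain t where t: "t \<in> tableaux [N - k, k]" "bottom t = X" using exists_tableau[OF X] by blast
  define G where "G = {g. g permutes ({1..N} - X)}"
  define m where "m Z = card {g. g permutes ({1..N} - X) \<and> g ` Z = Z}" for Z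
  define z where "z = (\<Sum>g\<in>G. polytabloid [N - k, k] (g \<circ> t))"
  have finG: "finite G" unfolding G_def by (intro finite_permutations) simp
  have G: "g permutes {1..N}" if "g \<in> G" for g using that permutes_subset[of g "{1..N} - X" "{1..N}"] by (simp add: G_def)
  have "z \<in> total" unfolding z_def
    using G tableau_comp[OF t(1)] by (intro cfun.span_sum cfun.span_base UnI1 polytabloid_in_specht) blast
  have qX: "q ` X \<in> ksubsets N k" if "q \<in> colstab t" for q
    using that X ksubsets_image by (simp add: colstab_iff)
  have "z = (\<Sum>g\<in>G. vec (\<lambda>Y. \<Sum>q\<in>colstab t. if Y = g ` q ` X then of_int (sign q) else 0))"
    unfolding z_def by (intro sum.cong refl) (simp add: polytabloid_comp[OF t(1) G] t(2))
  also have "\<dots> = vec (\<lambda>Y. \<Sum>q\<in>colstab t. \<Sum>g\<in>G. if Y = g ` q ` X then of_int (sign q) else 0)"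
    unfolding vec_sum by (subst sum.swap) (rule refl)
  also have "\<dots> = vec (\<lambda>Y. \<Sum>q\<in>colstab t. of_int (sign q) * of_nat (m (q ` X)) *
      of_bool (q ` X \<inter> X \<subseteq> Y \<and> Y \<inter> (X - q ` X) = {}))"
  proof (rule vec_eqI, rule sum.cong[OF refl])
    fix Y q assume Y: "Y \<in> ksubsets N k" and q: "q \<in> colstab t"
    have "(\<Sum>g\<in>G. if Y = g ` q ` X then of_int (sign q) else 0) =
        of_int (sign q) * (of_nat (card {g \<in> G. g ` q ` X = Y}) :: complex)"
      using finG by (simp add: sum.If_cases Int_def eq_commute mult.commute)
    also have "card {g \<in> G. g ` q ` X = Y} = (if Y \<inter> X = q ` X \<inter> X then m (q ` X) else 0)"
      using card_stabilizing[OF _ qX[OF q] Y, of X] X' by (simp add: G_def m_def)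
    \<comment> \<open>Prescribing the intersection of Y with X is an \<open>ev\<close> condition
      whose two parts together exhaust X. This is the case in which
      \<open>ev_minus_dl_in_total\<close> leaves a nonzero multiple of \<open>dl X\<close>.\<close>
    also have "(Y \<inter> X = q ` X \<inter> X) \<longleftrightarrow> (q ` X \<inter> X \<subseteq> Y \<and> Y \<inter> (X - q ` X) = {})" by blast
    finally show "(\<Sum>g\<in>G. if Y = g ` q ` X then of_int (sign q) else 0) =
        (of_int (sign q) * of_nat (m (q ` X)) * of_bool (q ` X \<inter> X \<subseteq> Y \<and> Y \<inter> (X - q ` X) = {}) :: complex)"
      by simp
  qed
  also have "\<dots> = (\<Sum>q\<in>colstab t. scale_fun (of_int (sign q) * of_nat (m (q ` X))) (ev (q ` X \<inter> X) (X - q ` X)))"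
    unfolding ev_def vec_scale vec_sum by (rule refl)
  finally have z: "z = (\<Sum>q\<in>colstab t. scale_fun (of_int (sign q) * of_nat (m (q ` X))) (ev (q ` X \<inter> X) (X - q ` X)))" .
  define M where "M = (\<Sum>q\<in>colstab t. m (q ` X))"
  have term_eq: "scale_fun (of_int (sign q) * of_nat (m (q ` X))) (ev (q ` X \<inter> X) (X - q ` X)) - scale_fun (of_nat (m (q ` X))) (dl X)
      \<in> total" if q: "q \<in> colstab t" for q
  proof -
    let ?D = "ev (q ` X \<inter> X) (X - q ` X) - scale_fun ((-1) ^ card (X - q ` X) * of_bool ((q ` X \<inter> X) \<union> (X - q ` X) = X)) (dl X)"
    have "?D \<in> total" using X' by (intro ev_minus_dl_in_total[OF X]) auto
    then have "scale_fun (of_int (sign q) * of_nat (m (q ` X))) ?D \<in> total" by (rule cfun.span_scale)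
    \<comment> \<open>By \<open>sign_colstab\<close> the sign produced by the forbidden part equals
      the sign of q, so the two signs cancel and no term is negative.\<close>
    moreover have "of_int (sign q) * of_nat (m (q ` X)) *
        ((-1) ^ card (X - q ` X) * of_bool ((q ` X \<inter> X) \<union> (X - q ` X) = X)) = (of_nat (m (q ` X)) :: complex)"
    proof -
      have "(q ` X \<inter> X) \<union> (X - q ` X) = X" by blast
      moreover have "sign q * (-1) ^ card (X - q ` X) = 1"
        using sign_colstab[OF t(1) q] unfolding t(2) by (simp add: power_mult_distrib[symmetric])
      then have "(of_int (sign q) :: complex) * (-1) ^ card (X - q ` X) = 1"
        by (metis of_int_1 of_int_minus of_int_mult of_int_power)
      ultimately show ?thesis by (simp add: mult.assoc mult.left_commute[of "of_nat _"])
    qed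
    ultimately show ?thesis by (simp only: cfun.scale_right_diff_distrib cfun.scale_scale)
  qed
  have "(\<Sum>q\<in>colstab t. scale_fun (of_int (sign q) * of_nat (m (q ` X))) (ev (q ` X \<inter> X) (X - q ` X)) -
      scale_fun (of_nat (m (q ` X))) (dl X)) \<in> total"
    by (intro cfun.span_sum term_eq)
  then have "z - scale_fun (of_nat M) (dl X) \<in> total"
    by (simp add: sum_subtractf z M_def cfun.scale_sum_left)
  from cfun.span_diff[OF \<open>z \<in> total\<close> this] have "scale_fun (of_nat M) (dl X) \<in> total" by simp
  then have "scale_fun (inverse (of_nat M)) (scale_fun (of_nat M) (dl X)) \<in> total" by (rule cfun.span_scale)
  moreover have "M > 0"
  proof -
    have "id \<in> colstab t" by (simp add: colstab_iff permutes_id)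
    moreover have "m (id ` X) > 0"
    proof -
      have "id \<in> {g. g permutes ({1..N} - X) \<and> g ` X = X}" by (simp add: permutes_id)
      moreover have "finite {g. g permutes ({1..N} - X) \<and> g ` X = X}"
        by (rule finite_subset[OF _ finG]) (auto simp: G_def)
      ultimately have "m X > 0" unfolding m_def card_gt_0_iff by blast
      then show ?thesis by simp
    qed
    ultimately show ?thesis unfolding M_def using finite_colstab[of t] by (metis gr0I sum_eq_0_iff)
  qed
  ultimately show ?thesis by simp
qed

lemma specht_subset: "specht \<subseteq> cfun.span (dl ` ksubsets N k)"
  unfolding specht_module_def
  by (rule cfun.span_minimal) (auto simp: polytabloid_eq intro: vec_in_span)

text \<open>The complex conjugate makes the form positive definite, so that
  \<open>specht_inter_up\<close> can apply it to a common element paired with itself.\<close>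

lemma specht_orthogonal:
  assumes f: "f \<in> specht" and g: "g \<in> cfun.span (up ` ksubsets N (k - 1))"
  shows "(\<Sum>X\<in>ksubsets N k. f (tab X) * cnj (g (tab X))) = 0"
  using g
proof (induction g rule: cfun.span_induct_alt)
  case (step a u g)
  then obtain Y where Y: "Y \<in> ksubsets N (k - 1)" "u = up Y" by blast
  have "(\<Sum>X\<in>ksubsets N k. f (tab X) * cnj (u (tab X))) = (\<Sum>X | X \<in> ksubsets N k \<and> Y \<subseteq> X. f (tab X))"
    unfolding Y(2) ev_def by (simp add: vec_tab sum.inter_filter if_distrib of_bool_def cong: if_cong)
  also have "\<dots> = 0"
    using f unfolding specht_module_def
  proof (induction f rule: cfun.span_induct_alt)
    case (step b v f)
    then show ?case using polytabloid_orthogonal_up[OF _ Y(1)]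
      by (auto simp: sum.distrib scale_fun_def sum_distrib_left[symmetric])
  qed simp
  finally have "(\<Sum>X\<in>ksubsets N k. f (tab X) * cnj (u (tab X))) = 0" .
  then have "(\<Sum>X\<in>ksubsets N k. cnj a * (f (tab X) * cnj (u (tab X)))) = 0"
    by (simp add: sum_distrib_left[symmetric])
  then show ?case using step.IH
    by (simp add: scale_fun_def algebra_simps sum.distrib)
qed simp

lemma specht_inter_up: "specht \<inter> cfun.span (up ` ksubsets N (k - 1)) = {0}"
proof
  show "specht \<inter> cfun.span (up ` ksubsets N (k - 1)) \<subseteq> {0}"
  proof
    fix f assume f: "f \<in> specht \<inter> cfun.span (up ` ksubsets N (k - 1))"
    then have "(\<Sum>X\<in>ksubsets N k. f (tab X) * cnj (f (tab X))) = 0" by (intro specht_orthogonal) auto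
    then have "complex_of_real (\<Sum>X\<in>ksubsets N k. (cmod (f (tab X)))\<^sup>2) = 0"
      by (simp add: complex_norm_square[symmetric] flip: of_real_power)
    then have "(\<Sum>X\<in>ksubsets N k. (cmod (f (tab X)))\<^sup>2) = 0" by (simp only: of_real_eq_0_iff)
    then have zero: "f (tab X) = 0" if "X \<in> ksubsets N k" for X
      using that by (simp add: sum_nonneg_eq_0_iff)
    have "f \<in> cfun.span (dl ` ksubsets N k)" using f specht_subset by blast
    then have "\<exists>r. f = vec r"
    proof (induction f rule: cfun.span_induct_alt)
      case base
      then show ?case using vec_zero by metis
    next
      case (step a u g)
      then show ?case unfolding dl_def by (metis (no_types, lifting) dl_def imageE vec_add vec_scale)
    qed
    then obtain r where r: "f = vec r" by blast
    have "vec r = vec (\<lambda>_. 0)" using zero by (intro vec_eqI) (simp add: r vec_tab)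
    then show "f \<in> {0}" using r vec_zero by simp
  qed
qed (auto simp: specht_module_def cfun.span_zero)

section \<open>The action on the two bases and the character\<close>

lemma action_vec:
  assumes w: "w permutes {1..N}"
  shows "tabloid_action w (vec r) = vec (\<lambda>X. r (inv w ` X))"
proof
  fix T
  have wi: "w ` inv w ` Y = Y" "inv w ` w ` Y = Y" for Y
    using permutes_inv_o[OF w] by (simp_all add: image_comp)
  note iw = permutes_inv[OF w]
  show "tabloid_action w (vec r) T = vec (\<lambda>X. r (inv w ` X)) T"
  proof (cases "\<exists>X\<in>ksubsets N k. T = tab X")
    case True
    then obtain X where "X \<in> ksubsets N k" "T = tab X" by blast
    then show ?thesis
      using ksubsets_image[OF iw] by (simp add: tabloid_action_def permute_tab[OF iw] vec_tab)
  next
    case False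
    have "permute_tabloid (inv w) T \<noteq> tab X" if "X \<in> ksubsets N k" for X
    proof
      assume "permute_tabloid (inv w) T = tab X"
      then have "permute_tabloid w (permute_tabloid (inv w) T) = tab (w ` X)" by (simp add: permute_tab[OF w])
      then have "T = tab (w ` X)" by (simp add: permute_tabloid_def comp_def wi)
      then show False using False ksubsets_image[OF w that] by blast
    qed
    then show ?thesis using False unfolding tabloid_action_def vec_def by auto
  qed
qed

lemma action_ev:
  assumes w: "w permutes {1..N}"
  shows "tabloid_action w (up Y) = up (w ` Y)" "tabloid_action w (dl Y) = dl (w ` Y)"
proof -
  have wi: "w ` inv w ` Y = Y" "inv w ` w ` Y = Y" for Y
    using permutes_inv_o[OF w] by (simp_all add: image_comp)
  have "Y \<subseteq> inv w ` X \<longleftrightarrow> w ` Y \<subseteq> X" for X by (metis image_mono wi)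
  then show "tabloid_action w (up Y) = up (w ` Y)" unfolding ev_def action_vec[OF w] by simp
  have "inv w ` X = Y \<longleftrightarrow> X = w ` Y" for X by (metis wi)
  then show "tabloid_action w (dl Y) = dl (w ` Y)" unfolding dl_def action_vec[OF w] by simp
qed

lemma action_add: "tabloid_action w (f + g) = tabloid_action w f + tabloid_action w g"
  by (auto simp: tabloid_action_def)

lemma action_scale: "tabloid_action w (scale_fun a f) = scale_fun a (tabloid_action w f)"
  by (auto simp: tabloid_action_def scale_fun_def)

lemma action_specht:
  assumes w: "w permutes {1..N}" and f: "f \<in> specht"
  shows "tabloid_action w f \<in> specht"
  using f unfolding specht_module_def
proof (induction f rule: cfun.span_induct_alt)
  case base
  have "tabloid_action w 0 = 0" by (auto simp: tabloid_action_def)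
  then show ?case by (simp only: cfun.span_zero)
next
  case (step a u g)
  then obtain t where t: "t \<in> tableaux [N - k, k]" "u = polytabloid [N - k, k] t" by blast
  have "inv w ` X = q ` bottom t \<longleftrightarrow> X = w ` q ` bottom t" for X q
    using permutes_inv_o[OF w] by (metis image_comp image_id id_apply)
  then have "tabloid_action w u = polytabloid [N - k, k] (w \<circ> t)"
    unfolding t(2) polytabloid_eq[OF t(1)] action_vec[OF w] polytabloid_comp[OF t(1) w] by simp
  then have "tabloid_action w u \<in> cfun.span (polytabloid [N - k, k] ` tableaux [N - k, k])"
    using tableau_comp[OF t(1) w] by (auto intro: cfun.span_base)
  then show ?case unfolding action_add action_scale using step by (intro cfun.span_add cfun.span_scale)
qed

lemma irr_character_two_rows:
  assumes w: "w permutes {1..N}"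
  shows "irr_character [N - k, k] w = of_nat (fixed_subsets N k w) - of_nat (fixed_subsets N (k - 1) w)"
proof -
  have "irr_character [N - k, k] w = trace_on specht (tabloid_action w)"
    unfolding irr_character_def shape_size using w by simp
  also have "\<dots> = (\<Sum>d\<in>dl ` ksubsets N k. cfun.representation (dl ` ksubsets N k) (tabloid_action w d) d) -
      (\<Sum>c\<in>up ` ksubsets N (k - 1). cfun.representation (up ` ksubsets N (k - 1)) (tabloid_action w c) c)"
  proof (rule trace_complement)
    show "cfun.subspace specht" by (simp add: specht_module_def)
    show "specht \<inter> cfun.span (up ` ksubsets N (k - 1)) = {0}" by (rule specht_inter_up)
    show "specht \<subseteq> cfun.span (dl ` ksubsets N k)" by (rule specht_subset)
    show "up ` ksubsets N (k - 1) \<subseteq> cfun.span (dl ` ksubsets N k)"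
      unfolding ev_def using vec_in_span by blast
    show "dl ` ksubsets N k \<subseteq> total" using dl_in_total by blast
    show "\<And>c. c \<in> up ` ksubsets N (k - 1) \<Longrightarrow> tabloid_action w c \<in> cfun.span (up ` ksubsets N (k - 1))"
      using action_ev(1)[OF w] ksubsets_image[OF w] by (auto intro!: cfun.span_base)
    show "\<And>c. c \<in> dl ` ksubsets N k \<Longrightarrow> tabloid_action w c \<in> cfun.span (dl ` ksubsets N k)"
      using action_ev(2)[OF w] ksubsets_image[OF w] by (auto intro!: cfun.span_base)
    show "cfun.independent (dl ` ksubsets N k)" by (rule independent_dl)
    show "cfun.independent (up ` ksubsets N (k - 1))" by (rule independent_up)
  qed (auto simp: action_specht[OF w] action_add action_scale)
  also have "(\<Sum>d\<in>dl ` ksubsets N k. cfun.representation (dl ` ksubsets N k) (tabloid_action w d) d) = of_nat (fixed_subsets N k w)"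
    unfolding fixed_subsets_def using independent_dl action_ev(2)[OF w] ksubsets_image[OF w]
    by (intro representation_permuted_basis) auto
  also have "(\<Sum>c\<in>up ` ksubsets N (k - 1). cfun.representation (up ` ksubsets N (k - 1)) (tabloid_action w c) c) = of_nat (fixed_subsets N (k - 1) w)"
    unfolding fixed_subsets_def using independent_up action_ev(1)[OF w] ksubsets_image[OF w]
    by (intro representation_permuted_basis) auto
  finally show ?thesis .
qed

end

section \<open>The main theorem\<close>

lemma fixed_subsets_compl:
  assumes w: "w permutes {1..n}" and "j \<le> n"
  shows "fixed_subsets n (n - j) w = fixed_subsets n j w"
  unfolding fixed_subsets_def
proof (rule bij_betw_same_card, rule bij_betw_byWitness[where f = "\<lambda>X. {1..n} - X" and f' = "\<lambda>X. {1..n} - X"])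
  have compl: "{1..n} - X \<in> ksubsets n (n - i) \<and> w ` ({1..n} - X) = {1..n} - X"
    if "X \<in> ksubsets n i" "w ` X = X" for X i
    using that ksubsetsD[OF that(1)] image_set_diff[OF permutes_inj[OF w]] permutes_image[OF w]
    by (simp add: ksubsets_def card_Diff_subset)
  show "(\<lambda>X. {1..n} - X) ` {X \<in> ksubsets n (n - j). w ` X = X} \<subseteq> {X \<in> ksubsets n j. w ` X = X}"
    using compl[of _ "n - j"] \<open>j \<le> n\<close> by auto
  show "(\<lambda>X. {1..n} - X) ` {X \<in> ksubsets n j. w ` X = X} \<subseteq> {X \<in> ksubsets n (n - j). w ` X = X}"
    using compl by auto
qed (auto simp: ksubsets_def double_diff)

text \<open>The letters above n are fixed by \<open>w\<close>. A subset is therefore fixed exactly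
  when its part in {1..n} is, and its part above n is arbitrary.\<close>

lemma fixed_subsets_restrict:
  assumes w: "w permutes {1..n}" and "n \<le> N"
  shows "fixed_subsets N k w = (\<Sum>j\<le>k. (N - n choose (k - j)) * fixed_subsets n j w)"
proof -
  define F where "F j = {A \<in> ksubsets n j. w ` A = A}" for j
  define G where "G l = {B. B \<subseteq> {n + 1..N} \<and> card B = l}" for l
  have fixB: "w ` B = B" if "B \<subseteq> {n + 1..N}" for B
  proof -
    have "w x = x" if "x \<in> B" for x
      using permutes_not_in[OF w] \<open>B \<subseteq> {n + 1..N}\<close> that by force
    then show ?thesis by force
  qed
  have finF: "finite (F j)" for j unfolding F_def by simp
  have finG: "finite (G l)" for l unfolding G_def by (rule finite_subset[of _ "Pow {n + 1..N}"]) auto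
  have parts: "(A \<union> B) \<inter> {1..n} = A" "(A \<union> B) \<inter> {n + 1..N} = B" if "A \<in> F j" "B \<in> G l" for A B j l
    using that by (auto simp: F_def G_def ksubsets_def)
  have inj: "inj_on (\<lambda>(A, B). A \<union> B) (F j \<times> G l)" for j l
    by (rule inj_onI) (use parts[of _ j _ l] in \<open>clarsimp, metis\<close>)
  have decomp: "{X \<in> ksubsets N k. w ` X = X} = (\<Union>j\<le>k. (\<lambda>(A, B). A \<union> B) ` (F j \<times> G (k - j)))"
  proof (intro equalityI subsetI)
    fix X assume X: "X \<in> {X \<in> ksubsets N k. w ` X = X}"
    define A where "A = X \<inter> {1..n}"
    define B where "B = X \<inter> {n + 1..N}"
    have sub: "X \<subseteq> {1..N}" and fin: "finite X" and card: "card X = k" using X ksubsetsD by auto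
    have XAB: "X = A \<union> B" "A \<inter> B = {}" using sub unfolding A_def B_def by auto
    then have "card A + card B = k" using card fin by (metis card_Un_disjoint finite_Un)
    moreover have "w ` A = A"
      unfolding A_def using X permutes_image[OF w] by (simp add: image_Int[OF permutes_inj[OF w]])
    ultimately have "card A \<le> k" "A \<in> F (card A)" "B \<in> G (k - card A)"
      by (auto simp: F_def G_def ksubsets_def A_def B_def)
    then show "X \<in> (\<Union>j\<le>k. (\<lambda>(A, B). A \<union> B) ` (F j \<times> G (k - j)))" using XAB by blast
  next
    fix X assume "X \<in> (\<Union>j\<le>k. (\<lambda>(A, B). A \<union> B) ` (F j \<times> G (k - j)))"
    then obtain j A B where AB: "j \<le> k" "A \<in> F j" "B \<in> G (k - j)" "X = A \<union> B" by auto
    then have sub: "A \<subseteq> {1..n}" "card A = j" "w ` A = A" "B \<subseteq> {n + 1..N}" "card B = k - j"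
      by (auto simp: F_def G_def ksubsets_def)
    then have "A \<inter> B = {}" by fastforce
    moreover have "finite A" "finite B" using sub finite_subset by blast+
    ultimately have "card X = k" using AB sub by (simp add: card_Un_disjoint)
    moreover have "w ` X = X" using fixB[OF sub(4)] sub(3) AB(4) by (simp add: image_Un)
    moreover have "X \<subseteq> {1..N}" using sub AB(4) \<open>n \<le> N\<close> by fastforce
    ultimately show "X \<in> {X \<in> ksubsets N k. w ` X = X}" by (simp add: ksubsets_def)
  qed
  have "fixed_subsets N k w = (\<Sum>j\<le>k. card ((\<lambda>(A, B). A \<union> B) ` (F j \<times> G (k - j))))"
    unfolding fixed_subsets_def decomp
  proof (rule card_UN_disjoint)
    have "(\<lambda>(A, B). A \<union> B) ` (F i \<times> G (k - i)) \<inter> (\<lambda>(A, B). A \<union> B) ` (F j \<times> G (k - j)) = {}" if "i \<noteq> j" for i j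
    proof (rule ccontr)
      assume "\<not> ?thesis"
      then obtain A B A' B' where *: "A \<in> F i" "B \<in> G (k - i)" "A' \<in> F j" "B' \<in> G (k - j)" "A \<union> B = A' \<union> B'" by auto
      then have "A = A'" using parts(1)[OF *(1,2)] parts(1)[OF *(3,4)] by simp
      then show False using * that by (auto simp: F_def ksubsets_def)
    qed
    then show "\<forall>i\<in>{..k}. \<forall>j\<in>{..k}. i \<noteq> j \<longrightarrow>
      (\<lambda>(A, B). A \<union> B) ` (F i \<times> G (k - i)) \<inter> (\<lambda>(A, B). A \<union> B) ` (F j \<times> G (k - j)) = {}"
      by (intro ballI impI)
  qed (use finF finG in auto)
  also have "\<dots> = (\<Sum>j\<le>k. (N - n choose (k - j)) * fixed_subsets n j w)"
  proof (rule sum.cong[OF refl])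
    fix j
    have "card (G (k - j)) = N - n choose (k - j)" unfolding G_def by (subst n_subsets) auto
    then show "card ((\<lambda>(A, B). A \<union> B) ` (F j \<times> G (k - j))) = (N - n choose (k - j)) * fixed_subsets n j w"
      unfolding card_image[OF inj] card_cartesian_product fixed_subsets_def F_def[symmetric]
      by (simp add: mult.commute)
  qed
  finally show ?thesis .
qed

lemma fixed_subsets_conj:
  assumes u: "u permutes {1..n}"
  shows "fixed_subsets n k (u \<circ> w \<circ> inv u) = fixed_subsets n k w"
  unfolding fixed_subsets_def
proof (rule bij_betw_same_card, rule bij_betw_byWitness[where f = "image (inv u)" and f' = "image u"])
  have ui: "u ` inv u ` X = X" "inv u ` u ` X = X" for X
    using permutes_inv_o[OF u] by (simp_all add: image_comp)
  have img: "(u \<circ> w \<circ> inv u) ` X = u ` w ` inv u ` X" for X by (simp add: image_comp comp_assoc)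
  show "\<forall>X\<in>{X \<in> ksubsets n k. (u \<circ> w \<circ> inv u) ` X = X}. u ` inv u ` X = X" by (simp only: ui ball_simps simp_thms)
  show "\<forall>X\<in>{X \<in> ksubsets n k. w ` X = X}. inv u ` u ` X = X" by (simp only: ui ball_simps simp_thms)
  show "image (inv u) ` {X \<in> ksubsets n k. (u \<circ> w \<circ> inv u) ` X = X} \<subseteq> {X \<in> ksubsets n k. w ` X = X}"
  proof (intro image_subsetI CollectI conjI)
    fix X assume X: "X \<in> {X \<in> ksubsets n k. (u \<circ> w \<circ> inv u) ` X = X}"
    then show "inv u ` X \<in> ksubsets n k" using ksubsets_image[OF permutes_inv[OF u]] by blast
    have "u ` w ` inv u ` X = X" using X img by simp
    then show "w ` inv u ` X = inv u ` X" by (metis ui(2))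
  qed
  show "image u ` {X \<in> ksubsets n k. w ` X = X} \<subseteq> {X \<in> ksubsets n k. (u \<circ> w \<circ> inv u) ` X = X}"
  proof (intro image_subsetI CollectI conjI)
    fix X assume X: "X \<in> {X \<in> ksubsets n k. w ` X = X}"
    then show "u ` X \<in> ksubsets n k" using ksubsets_image[OF u] by blast
    show "(u \<circ> w \<circ> inv u) ` u ` X = u ` X" unfolding img ui using X by simp
  qed
qed

text \<open>\<open>frobenius_characteristic\<close> grants additivity and homogeneity on
  \<open>class_functions\<close>, so membership has to be known before \<open>ch\<close> is applied
  termwise.\<close>

lemma irr_character_two_rows_class_function:
  assumes "1 \<le> i" "2 * i \<le> n"
  shows "irr_character [n - i, i] \<in> class_functions n"
proof -
  interpret two_rows n i using assms by unfold_locales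
  have "irr_character [n - i, i] w = 0" if "\<not> w permutes {1..n}" for w
    using that unfolding irr_character_def shape_size by simp
  moreover have "irr_character [n - i, i] (u \<circ> w \<circ> inv u) = irr_character [n - i, i] w"
    if "u permutes {1..n}" "w permutes {1..n}" for u w
  proof -
    have "u \<circ> w \<circ> inv u permutes {1..n}" using that by (intro permutes_compose permutes_inv)
    then show ?thesis using that by (simp add: irr_character_two_rows fixed_subsets_conj)
  qed
  ultimately show ?thesis by (simp add: class_functions_def)
qed

text \<open>By the branching rule the coefficient is the number of standard fillings of the skew
  shape (n-1, n-1)/(n-i, i): the first binomial coefficient counts all lattice paths, the second
  those that violate the ballot condition. Here it comes out of
  \<open>restriction_sum_eq\<close>.\<close>

lemma restricted_character:
  assumes "n \<ge> 2"
  shows "restrict_to_Sym n (irr_character [n - 1, n - 1]) = (\<Sum>i=1..n div 2.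
    scale_fun (of_nat (n - 2 choose (i - 1)) - of_nat (n - 2 choose (n - i))) (irr_character [n - i, i]))"
proof
  fix w
  let ?a = "\<lambda>i. of_nat (n - 2 choose (i - 1)) - of_nat (n - 2 choose (n - i)) :: complex"
  have shape: "sum_list [n - i, i] = n" if "i \<in> {1..n div 2}" for i using that by auto
  show "restrict_to_Sym n (irr_character [n - 1, n - 1]) w =
    (\<Sum>i=1..n div 2. scale_fun (?a i) (irr_character [n - i, i])) w"
  proof (cases "w permutes {1..n}")
    case False
    then have "irr_character [n - i, i] w = 0" if "i \<in> {1..n div 2}" for i
      unfolding irr_character_def shape[OF that] by simp
    then show ?thesis using False by (simp add: restrict_to_Sym_def sum_fun_apply scale_fun_def)
  next
    case True
    define N where "N = 2 * n - 2"
    have N: "N - (n - 1) = n - 1" "N - n = n - 2" "n \<le> N" using assms by (auto simp: N_def)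
    have wN: "w permutes {1..N}" using True N(3) by (auto intro: permutes_subset)
    define fx where "fx j = (of_nat (fixed_subsets n j w) :: complex)" for j
    interpret two_rows N "n - 1" using assms by unfold_locales (auto simp: N_def)
    have "irr_character [n - 1, n - 1] w = of_nat (fixed_subsets N (n - 1) w) - of_nat (fixed_subsets N (n - 1 - 1) w)"
      using irr_character_two_rows[OF wN] unfolding N(1) .
    also have "\<dots> = restriction_sum n fx"
      unfolding fixed_subsets_restrict[OF True N(3)] N(2) restriction_sum_def fx_def
      by (simp add: numeral_2_eq_2)
    also have "\<dots> = (\<Sum>i=1..n div 2. ?a i * (fx i - fx (i - 1)))"
      using assms True by (intro restriction_sum_eq) (simp_all add: fx_def fixed_subsets_compl)
    also have "\<dots> = (\<Sum>i=1..n div 2. ?a i * irr_character [n - i, i] w)"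
    proof (rule sum.cong[OF refl])
      fix i assume i: "i \<in> {1..n div 2}"
      then interpret i: two_rows n i by unfold_locales auto
      show "?a i * (fx i - fx (i - 1)) = ?a i * irr_character [n - i, i] w"
        by (simp add: i.irr_character_two_rows[OF True] fx_def)
    qed
    finally show ?thesis using True by (simp add: restrict_to_Sym_def sum_fun_apply scale_fun_def)
  qed
qed

lemma class_functions_scale: "f \<in> class_functions n \<Longrightarrow> scale_fun a f \<in> class_functions n"
  by (simp add: class_functions_def scale_fun_def)

lemma class_functions_sum:
  "(\<And>i. i \<in> I \<Longrightarrow> f i \<in> class_functions n) \<Longrightarrow> (\<Sum>i\<in>I. f i) \<in> class_functions n"
  by (simp add: class_functions_def sum_fun_apply)

lemma frobenius_characteristic_sum:
  assumes ch: "frobenius_characteristic n ch" and "finite I"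
    and f: "\<And>i. i \<in> I \<Longrightarrow> f i \<in> class_functions n"
  shows "ch (\<Sum>i\<in>I. scale_fun (a i) (f i)) = (\<Sum>i\<in>I. scale_fun (a i) (ch (f i)))"
  using assms(2) f
proof (induction I rule: finite_induct)
  case empty
  have "0 \<in> class_functions n" using class_functions_sum[of "{}"] by simp
  then have "ch (scale_fun 0 0) = scale_fun 0 (ch 0)"
    using ch unfolding frobenius_characteristic_def by blast
  then have "ch 0 = 0" by simp
  then show ?case by (simp only: sum.empty)
next
  case (insert i I)
  have "scale_fun (a i) (f i) \<in> class_functions n" "(\<Sum>i\<in>I. scale_fun (a i) (f i)) \<in> class_functions n"
    using insert.prems by (auto intro!: class_functions_sum class_functions_scale)
  then have "ch (scale_fun (a i) (f i) + (\<Sum>i\<in>I. scale_fun (a i) (f i))) =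
      ch (scale_fun (a i) (f i)) + ch (\<Sum>i\<in>I. scale_fun (a i) (f i))"
    using ch unfolding frobenius_characteristic_def by blast
  moreover have "ch (scale_fun (a i) (f i)) = scale_fun (a i) (ch (f i))"
    using ch insert.prems unfolding frobenius_characteristic_def by blast
  moreover have "ch (\<Sum>i\<in>I. scale_fun (a i) (f i)) = (\<Sum>i\<in>I. scale_fun (a i) (ch (f i)))"
    using insert.prems by (intro insert.IH) blast
  ultimately show ?case unfolding sum.insert[OF insert.hyps] by (simp only:)
qed

section \<open>Coefficients of the quasisymmetric side\<close>

lemma Q_series_eq:
  "Q_series n (transitive_partitions n (n - 1)) m =
    (if size m = n then of_nat (card {P \<in> transitive_partitions n (n - 1).
       Des n P \<subseteq> {j \<in> {1..n - 1}. sorted_list_of_multiset m ! (j - 1) < sorted_list_of_multiset m ! j}}) else 0)"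
proof -
  let ?xs = "sorted_list_of_multiset m"
  let ?S = "{j \<in> {1..n - 1}. ?xs ! (j - 1) < ?xs ! j}"
  have fund: "fundamental_qsym n J m = (if size m = n \<and> J \<subseteq> ?S then 1 else 0)" if "J \<subseteq> {1..n - 1}" for J
  proof -
    have "{xs. length xs = n \<and> sorted xs \<and> (\<forall>j\<in>J. xs ! (j - 1) < xs ! j) \<and> mset xs = m} =
        (if size m = n \<and> J \<subseteq> ?S then {?xs} else {})"
    proof -
      have "xs = ?xs" if "sorted xs" "mset xs = m" for xs
        using that by (metis sorted_list_of_multiset_mset sorted_sort_id)
      moreover have "length ?xs = size m" by (metis mset_sorted_list_of_multiset size_mset)
      ultimately show ?thesis using that by auto
    qed
    then show ?thesis by (simp add: fundamental_qsym_def)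
  qed
  have "Q_series n (transitive_partitions n (n - 1)) m =
      (\<Sum>P\<in>transitive_partitions n (n - 1). if size m = n \<and> Des n P \<subseteq> ?S then 1 else 0)"
    unfolding Q_series_def sum_fun_apply by (intro sum.cong fund) (auto simp: Des_def)
  also have "\<dots> = (if size m = n then of_nat (card {P \<in> transitive_partitions n (n - 1). Des n P \<subseteq> ?S}) else 0)"
    using finite_transitive_partitions[of n] by (simp add: sum.If_cases Int_def)
  finally show ?thesis .
qed

lemma card_partitions_eq_restriction_sum:
  fixes m :: "nat multiset"
  assumes "n \<ge> 2" and m: "size m = n"
  defines "xs \<equiv> sorted_list_of_multiset m"
  shows "int (card {P \<in> transitive_partitions n (n - 1). Des n P \<subseteq> {j \<in> {1..n - 1}. xs ! (j - 1) < xs ! j}}) =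
    restriction_sum n (\<lambda>j. int (sub_count m j))"
proof -
  let ?S = "{j \<in> {1..n - 1}. xs ! (j - 1) < xs ! j}"
  have len: "length xs = n" using m unfolding xs_def by (metis mset_sorted_list_of_multiset size_mset)
  have srt: "sorted xs" unfolding xs_def by simp
  \<comment> \<open>The recursion starts at the vertex n alone: n-1 vertices to add, an empty spine,
    and no node that could be a leaf.\<close>
  have "int (ballot_count ?S (n - 1) 0 False) =
      coeff ([:1, -1:] * ([:1, 1:] ^ (n - 1 + 0 - 1) * (if False \<and> Suc (n - 1) \<notin> ?S
        then full_poly (mset (take (Suc (n - 1)) xs)) (xs ! (n - 1)) else sub_poly (mset (take (Suc (n - 1)) xs))))) (n - 1)"
  proof (rule ballot_count_eq_coeff)
    show "n - 1 < length xs" using len assms(1) by simp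
    fix j assume j: "1 \<le> j" "j < length xs"
    show "xs ! (j - 1) = xs ! j" if "j \<notin> ?S"
      using that j len sorted_nth_mono[OF srt, of "j - 1" j] by auto
    show "xs ! j \<notin> set (take j xs)" if "j \<in> ?S"
    proof
      assume "xs ! j \<in> set (take j xs)"
      then obtain l where l: "l < j" "xs ! j = xs ! l" using j by (auto simp: in_set_conv_nth)
      then have "xs ! l \<le> xs ! (j - 1)" using j by (intro sorted_nth_mono[OF srt]) auto
      then show False using l that by auto
    qed
  qed
  also have "\<dots> = coeff ([:1, -1:] * ([:1, 1:] ^ (n - 2) * sub_poly m)) (n - 1)"
  proof -
    have "mset (take (Suc (n - 1)) xs) = m" using len assms(1) by (simp add: xs_def)
    moreover have "n - 1 + 0 - 1 = n - 2" by simp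
    ultimately show ?thesis by (simp only: if_False simp_thms)
  qed
  also have "\<dots> = restriction_sum n (\<lambda>j. int (sub_count m j))"
    unfolding coeff_eq_restriction_sum[OF assms(1)] coeff_sub_poly ..
  finally show ?thesis using card_transitive_partitions[of n ?S] assms(1) by simp
qed

theorem theorem1p24:
  fixes n :: nat and ch :: "((nat \<Rightarrow> nat) \<Rightarrow> complex) \<Rightarrow> series"
  assumes "n > 1"
    and "frobenius_characteristic n ch"
  shows "Q_series n (transitive_partitions n (n - 1)) =
    ch (restrict_to_Sym n (irr_character [n - 1, n - 1]))"
proof
  fix m
  let ?a = "\<lambda>i. of_nat (n - 2 choose (i - 1)) - of_nat (n - 2 choose (n - i))"
  have n: "n \<ge> 2" using assms(1) by simp
  have "ch (restrict_to_Sym n (irr_character [n - 1, n - 1])) = (\<Sum>i=1..n div 2. scale_fun (?a i) (ch (irr_character [n - i, i])))"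
    unfolding restricted_character[OF n] using irr_character_two_rows_class_function
    by (intro frobenius_characteristic_sum[OF assms(2)]) auto
  also have "\<dots> = (\<Sum>i=1..n div 2. scale_fun (?a i) (schur [n - i, i]))"
  proof (rule sum.cong[OF refl])
    fix i assume "i \<in> {1..n div 2}"
    then have "[n - i, i] \<in> partitions_of n" by (auto simp: partitions_of_def)
    then show "scale_fun (?a i) (ch (irr_character [n - i, i])) = scale_fun (?a i) (schur [n - i, i])"
      using assms(2) by (simp add: frobenius_characteristic_def)
  qed
  finally have "ch (restrict_to_Sym n (irr_character [n - 1, n - 1])) m = (\<Sum>i=1..n div 2. ?a i * schur [n - i, i] m)"
    by (simp add: sum_fun_apply scale_fun_def)
  also have "\<dots> = (\<Sum>i=1..n div 2. ?a i * (if size m = n then of_nat (sub_count m i) - of_nat (sub_count m (i - 1)) else 0))"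
  proof (rule sum.cong[OF refl])
    fix i assume i: "i \<in> {1..n div 2}"
    then have "i \<le> n - i" "n - i + i = n" "nat (int i - 1) = i - 1" by auto
    then show "?a i * schur [n - i, i] m = ?a i * (if size m = n then of_nat (sub_count m i) - of_nat (sub_count m (i - 1)) else 0)"
      using i by (simp add: schur_two_rows sub_count_int_def)
  qed
  \<comment> \<open>The Abel summation is run backwards, with the sub-multiset counts of
    \<open>m\<close> in place of the fixed-subset counts.\<close>
  also have "\<dots> = (if size m = n then restriction_sum n (\<lambda>j. of_nat (sub_count m j)) else 0)"
    using restriction_sum_eq[OF n, of "\<lambda>j. of_nat (sub_count m j) :: complex"] sub_count_sym[of _ m] by auto
  also have "\<dots> = Q_series n (transitive_partitions n (n - 1)) m"
  proof (cases "size m = n")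
    case True
    have "restriction_sum n (\<lambda>j. of_nat (sub_count m j)) = (of_int (restriction_sum n (\<lambda>j. int (sub_count m j))) :: complex)"
      by (simp add: restriction_sum_def)
    then show ?thesis
      unfolding Q_series_eq card_partitions_eq_restriction_sum[OF n True, symmetric] using True by simp
  next
    case False
    then show ?thesis unfolding Q_series_eq by simp
  qed
  finally show "Q_series n (transitive_partitions n (n - 1)) m = ch (restrict_to_Sym n (irr_character [n - 1, n - 1])) m" ..
qed

end
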